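(* Let $D: f=0$ be a hypersurface of degree $d$ in $\mathbb{P}^n$ over $\mathbb{C}$ having only isolated singularities, let $J=J_f$ be the Jacobian ideal of $f$, let $\hat J$ be its saturation, and let $T=(n+1)(d-2)$. Let $f_{smooth}\in S_d$ be a homogeneous polynomial of the same degree $d$ such that $f_{smooth}=0$ is a smooth hypersurface in $\mathbb{P}^n$. Then $$\dim \hat J_d/J_d=\dim M(f)_{d}-\dim M(f_{smooth})_d+\dim M(f)_{T-d}-\tau(D).$$
   Context: $S=\mathbb{C}[x_0,\dots,x_n]$ is the graded polynomial ring and $S_r$ is the vector space of homogeneous polynomials of degree $r$. For $f\in S_d$, the Jacobian ideal $J_f\subset S$ is the ideal generated by the partial derivatives $f_0,\dots,f_n$ of $f$ with respect to $x_0,\dots,x_n$, and the graded Milnor (Jacobian) algebra is $M(f)=S/J_f$, with homogeneous components $M(f)_k$. The saturation $\hat J$ of $J$ is taken with respect to the maximal ideal $(x_0,\dots,x_n)$, i.e. $\hat J=\{h\in S : (x_0,\dots,x_n)^m h\subset J \text{ for some } m\ge 0\}$; $\hat J_d$ and $J_d$ are the degree $d$ homogeneous components. $\tau(D)$ is the total (global) Tjurina number of $D$, i.e. the sum of the Tjurina numbers of all singularities of $D$; the Tjurina number of an isolated hypersurface singularity with local equation $g=0$ in local coordinates $u_1,\dots,u_n$ is $\dim_{\mathbb{C}}\mathbb{C}\{u_1,\dots,u_n\}/(g,\partial g/\partial u_1,\dots,\partial g/\partial u_n)$. Dimensions are over $\mathbb{C}$. *)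

theory Defs
  imports
    "HOL-Analysis.Analysis"
    "HOL-Library.Poly_Mapping"
    "HOL-Library.Function_Algebras"
begin

section \<open>Dimension of a quotient space\<close>

text \<open>
  A set of representatives of a basis of the quotient space \<open>V / W\<close>: the classes of the
  elements of \<open>B\<close> are pairwise distinct, linearly independent and span. Infinite-dimensional
  quotients get dimension \<open>0\<close>.
\<close>

definition quot_basis ::
  "('k::field \<Rightarrow> 'v \<Rightarrow> 'v) \<Rightarrow> 'v::ab_group_add set \<Rightarrow> 'v set \<Rightarrow> 'v set \<Rightarrow> bool" where
  "quot_basis scl V W B \<longleftrightarrow> B \<subseteq> V \<and>
     (\<forall>F u. finite F \<and> F \<subseteq> B \<and> (\<Sum>b\<in>F. scl (u b) b) \<in> W \<longrightarrow> (\<forall>b\<in>F. u b = 0)) \<and>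
     (\<forall>v\<in>V. \<exists>w\<in>W. v - w \<in> module.span scl B)"

definition quot_dim ::
  "('k::field \<Rightarrow> 'v \<Rightarrow> 'v) \<Rightarrow> 'v::ab_group_add set \<Rightarrow> 'v set \<Rightarrow> nat" where
  "quot_dim scl V W = card (SOME B. quot_basis scl V W B)"


section \<open>Polynomials\<close>

text \<open>
  The homogeneous coordinates are indexed by a finite type \<open>'n\<close>; the polynomial ring in
  \<open>n + 1\<close> variables is the whole type \<open>'n cpoly\<close> with \<open>CARD('n) = n + 1\<close>.
\<close>

type_synonym 'n mono = "'n \<Rightarrow>\<^sub>0 nat"
type_synonym 'n cpoly = "'n mono \<Rightarrow>\<^sub>0 complex"

definition mdeg :: "'n::finite mono \<Rightarrow> nat" where
  "mdeg m = (\<Sum>j\<in>UNIV. Poly_Mapping.lookup m j)"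

definition pconst :: "complex \<Rightarrow> 'n::finite cpoly" where
  "pconst c = Poly_Mapping.single 0 c"

definition pvar :: "'n::finite \<Rightarrow> 'n cpoly" where
  "pvar j = Poly_Mapping.single (Poly_Mapping.single j 1) 1"

definition pscale :: "complex \<Rightarrow> 'n::finite cpoly \<Rightarrow> 'n cpoly" where
  "pscale c h = pconst c * h"

definition peval :: "'n::finite cpoly \<Rightarrow> complex ^ 'n \<Rightarrow> complex" where
  "peval f v = (\<Sum>m\<in>Poly_Mapping.keys f.
     Poly_Mapping.lookup f m * (\<Prod>j\<in>UNIV. (v $ j) ^ Poly_Mapping.lookup m j))"

definition psubst :: "'n::finite cpoly \<Rightarrow> ('n \<Rightarrow> 'n cpoly) \<Rightarrow> 'n cpoly" where
  "psubst f s = (\<Sum>m\<in>Poly_Mapping.keys f.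
     pconst (Poly_Mapping.lookup f m) * (\<Prod>j\<in>UNIV. s j ^ Poly_Mapping.lookup m j))"

text \<open>In the terms with \<open>lookup m j = 0\<close> the exponent is truncated, but the coefficient vanishes.\<close>

definition pdiff :: "'n::finite \<Rightarrow> 'n cpoly \<Rightarrow> 'n cpoly" where
  "pdiff j f = (\<Sum>m\<in>Poly_Mapping.keys f.
     Poly_Mapping.single (m - Poly_Mapping.single j 1)
       (of_nat (Poly_Mapping.lookup m j) * Poly_Mapping.lookup f m))"

text \<open>The degree is an integer, so that the components of negative degree are \<open>0\<close>.\<close>

definition hom_comp :: "int \<Rightarrow> 'n::finite cpoly set" where
  "hom_comp k = {h. \<forall>m\<in>Poly_Mapping.keys h. int (mdeg m) = k}"


section \<open>Jacobian ideal, Milnor algebra, saturation\<close>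

definition pideal :: "'n::finite cpoly set \<Rightarrow> 'n cpoly set" where
  "pideal G = module.span (*) G"

definition jacobian_ideal :: "'n::finite cpoly \<Rightarrow> 'n cpoly set" where
  "jacobian_ideal f = pideal {pdiff j f | j. True}"

definition milnor_dim :: "'n::finite cpoly \<Rightarrow> int \<Rightarrow> nat" where
  "milnor_dim f k = quot_dim pscale (hom_comp k) (jacobian_ideal f \<inter> hom_comp k)"

primrec ideal_power :: "'n::finite cpoly set \<Rightarrow> nat \<Rightarrow> 'n cpoly set" where
  "ideal_power I 0 = UNIV"
| "ideal_power I (Suc m) = pideal {a * b | a b. a \<in> ideal_power I m \<and> b \<in> I}"

definition max_ideal :: "'n::finite cpoly set" where
  "max_ideal = pideal {pvar j | j. True}"

definition saturation :: "'n::finite cpoly set \<Rightarrow> 'n cpoly set" where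
  "saturation J = {h. \<exists>m. \<forall>g\<in>ideal_power max_ideal m. g * h \<in> J}"


section \<open>Projective space\<close>

definition cline :: "complex ^ 'n \<Rightarrow> (complex ^ 'n) set" where
  "cline v = {c *s v | c. True}"

typedef 'n proj = "{cline v | v :: complex ^ 'n::finite. v \<noteq> 0}"
proof -
  have "(1 :: complex ^ 'n) \<noteq> 0"
    by simp
  then show ?thesis
    by blast
qed

definition proj_pt :: "complex ^ 'n::finite \<Rightarrow> 'n proj" where
  "proj_pt v = Abs_proj (cline v)"

text \<open>The complex topology, i.e. the quotient topology from the punctured vector space.\<close>

instantiation proj :: (finite) topological_space
begin

definition open_proj :: "'a proj set \<Rightarrow> bool" where
  "open_proj U \<longleftrightarrow> open {v :: complex ^ 'a. v \<noteq> 0 \<and> proj_pt v \<in> U}"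

instance
proof
  have "{v :: complex ^ 'a. v \<noteq> 0 \<and> proj_pt v \<in> UNIV} = - {0}"
    by auto
  then show "open (UNIV :: 'a proj set)"
    unfolding open_proj_def by (simp only:) (rule open_Compl, rule closed_singleton)
next
  fix S T :: "'a proj set"
  assume "open S" "open T"
  moreover have "{v :: complex ^ 'a. v \<noteq> 0 \<and> proj_pt v \<in> S \<inter> T} =
    {v. v \<noteq> 0 \<and> proj_pt v \<in> S} \<inter> {v. v \<noteq> 0 \<and> proj_pt v \<in> T}"
    by auto
  ultimately show "open (S \<inter> T)"
    unfolding open_proj_def by (simp only: open_Int)
next
  fix K :: "'a proj set set"
  assume "\<forall>S\<in>K. open S"
  moreover have "{v :: complex ^ 'a. v \<noteq> 0 \<and> proj_pt v \<in> \<Union>K} =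
    (\<Union>S\<in>K. {v. v \<noteq> 0 \<and> proj_pt v \<in> S})"
    by auto
  ultimately show "open (\<Union>K)"
    unfolding open_proj_def by (simp only:) (rule open_UN, simp)
qed

end


section \<open>Hypersurfaces and their singularities\<close>

definition hypersurface :: "nat \<Rightarrow> 'n::finite cpoly \<Rightarrow> bool" where
  "hypersurface d f \<longleftrightarrow> d \<ge> 1 \<and> f \<noteq> 0 \<and> f \<in> hom_comp (int d)"

definition sing_locus :: "'n::finite cpoly \<Rightarrow> 'n proj set" where
  "sing_locus f = {proj_pt v | v. v \<noteq> 0 \<and> peval f v = 0 \<and> (\<forall>j. peval (pdiff j f) v = 0)}"

definition smooth_hypersurface :: "'n::finite cpoly \<Rightarrow> bool" where
  "smooth_hypersurface f \<longleftrightarrow> sing_locus f = {}"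

definition isolated_singularities :: "'n::finite cpoly \<Rightarrow> bool" where
  "isolated_singularities f \<longleftrightarrow> (\<forall>P\<in>sing_locus f. P isolated_in sing_locus f)"


section \<open>Convergent power series and Tjurina numbers\<close>

text \<open>
  A formal power series is its family of coefficients. \<open>conv_series V\<close> is the ring of power
  series in the variables from \<open>V\<close> that converge absolutely on some polydisc around \<open>0\<close>.
\<close>

type_synonym 'n series = "'n mono \<Rightarrow> complex"

definition conv_series :: "'n::finite set \<Rightarrow> 'n series set" where
  "conv_series V = {a. (\<forall>m. a m \<noteq> 0 \<longrightarrow> Poly_Mapping.keys m \<subseteq> V) \<and>
     (\<exists>r>0. (\<lambda>m. norm (a m) * r ^ mdeg m) summable_on UNIV)}"

text \<open>The Cauchy product; the times instance for functions is pointwise and is not used.\<close>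

definition series_mult :: "'n::finite series \<Rightarrow> 'n series \<Rightarrow> 'n series" where
  "series_mult a b m = (\<Sum>(k, l)\<in>{(k, l). k + l = m}. a k * b l)"

definition series_diff :: "'n::finite \<Rightarrow> 'n series \<Rightarrow> 'n series" where
  "series_diff j a m = of_nat (Poly_Mapping.lookup m j + 1) * a (m + Poly_Mapping.single j 1)"

definition series_scale :: "complex \<Rightarrow> 'n::finite series \<Rightarrow> 'n series" where
  "series_scale c a m = c * a m"

text \<open>The ideal of \<open>conv_series V\<close> generated by \<open>g\<close> and its partial derivatives.\<close>

definition tjurina_ideal :: "'n::finite set \<Rightarrow> 'n series \<Rightarrow> 'n series set" where
  "tjurina_ideal V g =
     {series_mult a g + (\<Sum>j\<in>V. series_mult (b j) (series_diff j g)) | a b.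
        a \<in> conv_series V \<and> (\<forall>j\<in>V. b j \<in> conv_series V)}"

definition tjurina_number :: "'n::finite set \<Rightarrow> 'n series \<Rightarrow> nat" where
  "tjurina_number V g = quot_dim series_scale (conv_series V) (tjurina_ideal V g)"

text \<open>
  The equation of the hypersurface in the affine chart \<open>x\<^sub>i = 1\<close>, in the coordinates
  \<open>u\<^sub>j = x\<^sub>j - v\<^sub>j\<close> for \<open>j \<noteq> i\<close> centred at the point \<open>v\<close> with \<open>v\<^sub>i = 1\<close>.
\<close>

definition local_eq :: "'n::finite cpoly \<Rightarrow> complex ^ 'n \<Rightarrow> 'n \<Rightarrow> 'n series" where
  "local_eq f v i =
     Poly_Mapping.lookup (psubst f (\<lambda>j. if j = i then 1 else pconst (v $ j) + pvar j))"

text \<open>The Tjurina number does not depend on the affine chart in which it is computed.\<close>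

definition tjurina_at :: "'n::finite cpoly \<Rightarrow> 'n proj \<Rightarrow> nat" where
  "tjurina_at f P =
     (let (v, i) = (SOME (v, i). P = proj_pt v \<and> v $ i = 1)
      in tjurina_number (- {i}) (local_eq f v i))"

definition total_tjurina :: "'n::finite cpoly \<Rightarrow> nat" where
  "total_tjurina f = (\<Sum>P\<in>sing_locus f. tjurina_at f P)"

end

theory Submission
  imports Defs "HOL-Computational_Algebra.Fundamental_Theorem_Algebra"
begin

text \<open>
  Write \<open>e = d - 1\<close>. Since the singularities are isolated, \<open>J = (g\<^sub>1, \<dots>, g\<^sub>n, h)\<close> where the \<open>g\<^sub>i\<close>
  are general linear combinations of the partial derivatives and \<open>g\<^sub>1, \<dots>, g\<^sub>n, l\<close> is a regular
  sequence for a general linear form \<open>l\<close>. Let \<open>I = (g\<^sub>1, \<dots>, g\<^sub>n)\<close> and \<open>A = S/I\<close>. The Artinian ring \<open>A/l\<close>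
  has a one-dimensional socle, in degree \<open>s = n (e - 1)\<close>: this property is carried from the
  variables \<open>x\<^sub>0, \<dots>, x\<^sub>n\<close> to \<open>g\<^sub>1, \<dots>, g\<^sub>n, l\<close> by exchanging one element at a time. The coefficient of the
  socle generator is a residue, which induces a perfect pairing on \<open>A\<^sub>l\<close> under which \<open>A\<^sub>k\<close> and
  \<open>A\<^bsub>s-1-k\<^esub>\<close> annihilate each other. Hence the annihilator of \<open>h\<close> in \<open>A\<^bsub>s-1-k\<^esub>\<close> is dual to
  \<open>A\<^sub>l / (A\<^sub>k + h A\<^sub>l)\<close>, a space of dimension \<open>\<tau> - dim (S/\<close>saturation\<open>)\<^sub>k\<close>, because the component of
  \<open>S/J\<close> of any high degree is the product of the Tjurina algebras. For \<open>k = d\<close> this computes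
  \<open>dim M(f)\<^bsub>T-d\<^esub>\<close> in terms of the Hilbert function of \<open>A\<close>, which depends only on \<open>n\<close> and \<open>d\<close>; the
  symmetry of that function and the case of a smooth hypersurface give the formula.
\<close>

section \<open>Dimensions of quotients\<close>

text \<open>A singular \<open>D\<close> of degree at least 2 makes \<open>h\<close> a zero divisor
  in \<open>A\<close>, so \<open>S/J\<close> is not Artinian and Gorenstein duality does not apply
  to it directly. It is applied to the one-dimensional ring \<open>A\<close> instead, with only
  \<open>l\<close> inverted. To keep dimensions finite, the localization is represented by one large
  degree: \<open>x / l^K\<close> with \<open>x\<close> of degree \<open>K\<close>, the smaller
  degrees being embedded by powers of \<open>l\<close>. Let \<open>H\<close> be the Hilbert function
  of \<open>A\<close>, \<open>j = s - 1 - d\<close>, so that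
  \<open>T - d = j + (d - 1) = s - 2\<close>, and let \<open>r\<close> be the dimension in degree
  \<open>d\<close> of \<open>S\<close> modulo the saturation. For large \<open>K\<close> duality
  gives \<open>dim M(f)_(T-d) + H(j) + r = H(T-d) + \<tau>\<close>. The symmetries
  \<open>H(j) + H(d) = H(K) = H(T-d) + H(1)\<close> turn \<open>H(T-d) - H(j)\<close> into
  \<open>H(d) - H(1)\<close>, which is the smooth value \<open>dim M(f_smooth)_d\<close>. Finally
  \<open>r\<close> differs from \<open>dim M(f)_d\<close> by the dimension sought.\<close>

text \<open>Finite dimension is part of the assertion, whereas \<open>quot_dim\<close> falls back on
  0. An indexed basis can be concatenated and transported along linear maps without injectivity side
  conditions.\<close>

definition has_qdim ::
  "('k::field \<Rightarrow> 'v \<Rightarrow> 'v) \<Rightarrow> 'v::ab_group_add set \<Rightarrow> 'v set \<Rightarrow> nat \<Rightarrow> bool" where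
  "has_qdim scl V W n \<longleftrightarrow> (\<exists>b. (\<forall>i<n. b i \<in> V) \<and>
     (\<forall>c. (\<Sum>i<n. scl (c i) (b i)) \<in> W \<longrightarrow> (\<forall>i<n. c i = 0)) \<and>
     (\<forall>v\<in>V. \<exists>c. v - (\<Sum>i<n. scl (c i) (b i)) \<in> W))"

lemma has_qdimI:
  assumes "\<And>i. i < n \<Longrightarrow> b i \<in> V"
    and "\<And>c i. (\<Sum>i<n. scl (c i) (b i)) \<in> W \<Longrightarrow> i < n \<Longrightarrow> c i = 0"
    and "\<And>v. v \<in> V \<Longrightarrow> \<exists>c. v - (\<Sum>i<n. scl (c i) (b i)) \<in> W"
  shows "has_qdim scl V W n"
  unfolding has_qdim_def using assms by blast

lemma has_qdimE:
  assumes "has_qdim scl V W n"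
  obtains b where "\<And>i. i < n \<Longrightarrow> b i \<in> V"
    and "\<And>c i. (\<Sum>i<n. scl (c i) (b i)) \<in> W \<Longrightarrow> i < n \<Longrightarrow> c i = 0"
    and "\<And>v. v \<in> V \<Longrightarrow> \<exists>c. v - (\<Sum>i<n. scl (c i) (b i)) \<in> W"
proof -
  from assms obtain b where "(\<forall>i<n. b i \<in> V) \<and>
     (\<forall>c. (\<Sum>i<n. scl (c i) (b i)) \<in> W \<longrightarrow> (\<forall>i<n. c i = 0)) \<and>
     (\<forall>v\<in>V. \<exists>c. v - (\<Sum>i<n. scl (c i) (b i)) \<in> W)"
    unfolding has_qdim_def by (rule exE)
  then show ?thesis by (intro that[of b]) simp_all
qed

text \<open>Gaussian elimination: the last equation either is void or eliminates one
  unknown.\<close>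

lemma homogeneous_system_solution:
  fixes M :: "'i \<Rightarrow> nat \<Rightarrow> 'k::field"
  assumes "finite I" "m < card I"
  shows "\<exists>a. (\<exists>i\<in>I. a i \<noteq> 0) \<and> (\<forall>j<m. (\<Sum>i\<in>I. a i * M i j) = 0)"
  using assms
proof (induction m arbitrary: I M)
  case 0
  then have "I \<noteq> {}" by auto
  then show ?case by (intro exI[of _ "\<lambda>_. 1"]) auto
next
  case (Suc m)
  show ?case
  proof (cases "\<forall>i\<in>I. M i m = 0")
    case True
    with Suc.IH[of I M] Suc.prems show ?thesis
      by (auto simp: less_Suc_eq)
  next
    case False
    then obtain k where k: "k \<in> I" "M k m \<noteq> 0" by blast
    \<comment> \<open>The pivot unknown \<open>k\<close> is eliminated from the remaining
      equations.\<close>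
    define M' where "M' i j = M i j - M i m / M k m * M k j" for i j
    have "m < card (I - {k})" using Suc.prems k by simp
    then obtain a where a: "\<exists>i\<in>I - {k}. a i \<noteq> 0"
      "\<And>j. j < m \<Longrightarrow> (\<Sum>i\<in>I - {k}. a i * M' i j) = 0"
      using Suc.IH[of "I - {k}" M'] Suc.prems by blast
    \<comment> \<open>The value at \<open>k\<close> is the one that solves equation
      \<open>m\<close>.\<close>
    define a' where "a' = a(k := - (\<Sum>i\<in>I - {k}. a i * M i m) / M k m)"
    have s: "(\<Sum>i\<in>I. a' i * M i j) = a' k * M k j + (\<Sum>i\<in>I - {k}. a i * M i j)" for j
    proof -
      have "(\<Sum>i\<in>I - {k}. a' i * M i j) = (\<Sum>i\<in>I - {k}. a i * M i j)"
        by (rule sum.cong) (auto simp: a'_def)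
      then show ?thesis using sum.remove[of I k "\<lambda>i. a' i * M i j"] Suc.prems k by simp
    qed
    have "(\<Sum>i\<in>I. a' i * M i j) = 0" if "j < Suc m" for j
    proof (cases "j = m")
      case True
      then show ?thesis using k by (simp add: s) (simp add: a'_def)
    next
      case False
      then have "j < m" using that by simp
      have "(\<Sum>i\<in>I - {k}. a i * M' i j) = (\<Sum>i\<in>I - {k}. a i * M i j) - (\<Sum>i\<in>I - {k}. a i * M i m) / M k m * M k j"
        by (simp add: M'_def algebra_simps sum_subtractf sum_divide_distrib sum_distrib_left)
      with a(2)[OF \<open>j < m\<close>] show ?thesis by (simp add: s) (simp add: a'_def)
    qed
    moreover have "\<exists>i\<in>I. a' i \<noteq> 0" using a(1) unfolding a'_def by auto
    ultimately show ?thesis by blast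
  qed
qed

section \<open>Dimension counting in an abstract vector space\<close>

context vector_space
begin

text \<open>More than \<open>m\<close> vectors with \<open>m\<close> coordinates each modulo
  \<open>W\<close> satisfy a nontrivial relation. The index set is arbitrary because the bound is
  later applied to families indexed by points.\<close>

lemma has_qdim_indep_le:
  assumes q: "has_qdim scale V W m" and W: "subspace W"
    and "finite I" and c: "\<And>i. i \<in> I \<Longrightarrow> v i \<in> V"
    and ind: "\<And>a. (\<Sum>i\<in>I. scale (a i) (v i)) \<in> W \<Longrightarrow> \<forall>i\<in>I. a i = 0"
  shows "card I \<le> m"
proof (rule ccontr)
  assume "\<not> card I \<le> m"
  obtain b where b: "\<And>x. x \<in> V \<Longrightarrow> \<exists>c. x - (\<Sum>j<m. scale (c j) (b j)) \<in> W"
    using q by (rule has_qdimE) blast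
  have "\<forall>i\<in>I. \<exists>c. v i - (\<Sum>j<m. scale (c j) (b j)) \<in> W" using b c by blast
  then obtain M where M: "\<And>i. i \<in> I \<Longrightarrow> v i - (\<Sum>j<m. scale (M i j) (b j)) \<in> W"
    by (auto simp: bchoice_iff)
  from homogeneous_system_solution[OF \<open>finite I\<close>, of m M] \<open>\<not> card I \<le> m\<close>
  obtain a where a: "\<exists>i\<in>I. a i \<noteq> 0" "\<And>j. j < m \<Longrightarrow> (\<Sum>i\<in>I. a i * M i j) = 0"
    by auto
  have "(\<Sum>i\<in>I. scale (a i) (v i - (\<Sum>j<m. scale (M i j) (b j)))) \<in> W"
    by (intro subspace_sum[OF W] subspace_scale[OF W] M)
  moreover have "(\<Sum>i\<in>I. scale (a i) (\<Sum>j<m. scale (M i j) (b j))) = 0"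
  proof -
    have "(\<Sum>i\<in>I. scale (a i) (\<Sum>j<m. scale (M i j) (b j)))
        = (\<Sum>j<m. scale (\<Sum>i\<in>I. a i * M i j) (b j))"
      by (simp add: scale_sum_right scale_sum_left sum.swap[of _ _ I])
    then show ?thesis using a(2) by simp
  qed
  ultimately have "(\<Sum>i\<in>I. scale (a i) (v i)) \<in> W"
    by (simp add: scale_right_diff_distrib sum_subtractf)
  with ind a(1) show False by blast
qed

lemma has_qdim_unique:
  assumes "has_qdim scale V W m" "has_qdim scale V W n" "subspace W"
  shows "m = n"
proof -
  have "m \<le> n" if mn: "has_qdim scale V W m" "has_qdim scale V W n" for m n
  proof -
    obtain b where b: "\<And>i. i < m \<Longrightarrow> b i \<in> V"
      "\<And>c i. (\<Sum>i<m. scale (c i) (b i)) \<in> W \<Longrightarrow> i < m \<Longrightarrow> c i = 0"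
      using mn(1) by (rule has_qdimE) blast
    show ?thesis
      using has_qdim_indep_le[OF mn(2) assms(3), of "{..<m}" b] b by auto
  qed
  then show ?thesis using assms by (simp add: le_antisym)
qed

text \<open>Links the \<open>SOME\<close> in \<open>quot_dim\<close> to \<open>has_qdim\<close>: a
  quotient basis exists, and every such basis has \<open>n\<close> elements.\<close>

lemma quot_dim_eq:
  assumes q: "has_qdim scale V W n" and W: "subspace W"
  shows "quot_dim scale V W = n"
proof -
  obtain b where b: "\<And>i. i < n \<Longrightarrow> b i \<in> V"
    "\<And>c i. (\<Sum>i<n. scale (c i) (b i)) \<in> W \<Longrightarrow> i < n \<Longrightarrow> c i = 0"
    "\<And>v. v \<in> V \<Longrightarrow> \<exists>c. v - (\<Sum>i<n. scale (c i) (b i)) \<in> W"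
    using q by (rule has_qdimE) blast
  have inj: "inj_on b {..<n}"
  proof (rule inj_onI, rule ccontr)
    fix i j assume ij: "i \<in> {..<n}" "j \<in> {..<n}" "b i = b j" "i \<noteq> j"
    define c where "c k = (if k = i then 1 else if k = j then -1 else (0::'a))" for k
    have "(\<Sum>k<n. scale (c k) (b k)) = (\<Sum>k\<in>{i,j}. scale (c k) (b k))"
      by (rule sum.mono_neutral_right) (use ij in \<open>auto simp: c_def\<close>)
    also have "\<dots> = 0" using ij by (simp add: c_def)
    finally have "c i = 0" using b(2)[of c i] ij subspace_0[OF W] by simp
    then show False by (simp add: c_def)
  qed
  have ex: "quot_basis scale V W (b ` {..<n})"
    unfolding quot_basis_def
  proof (intro conjI allI impI ballI)
    show "b ` {..<n} \<subseteq> V" using b by auto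
    fix F u x assume F: "finite F \<and> F \<subseteq> b ` {..<n} \<and> (\<Sum>b\<in>F. scale (u b) b) \<in> W" and x: "x \<in> F"
    obtain i where i: "x = b i" "i < n" using F x by auto
    define c where "c k = (if b k \<in> F then u (b k) else 0)" for k
    have "(\<Sum>k<n. scale (c k) (b k)) = (\<Sum>y\<in>b ` {..<n}. scale (if y \<in> F then u y else 0) y)"
      by (simp add: sum.reindex[OF inj] c_def)
    also have "\<dots> = (\<Sum>y\<in>F. scale (u y) y)"
      by (rule sum.mono_neutral_cong_right) (use F in auto)
    finally have "c i = 0" using b(2)[of c i] F i by auto
    then show "u x = 0" using i x by (simp add: c_def)
  next
    fix v assume "v \<in> V"
    then obtain c where "v - (\<Sum>i<n. scale (c i) (b i)) \<in> W" using b(3) by blast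
    moreover have "(\<Sum>i<n. scale (c i) (b i)) \<in> span (b ` {..<n})"
      by (intro span_sum span_scale span_base) auto
    ultimately show "\<exists>w\<in>W. v - w \<in> span (b ` {..<n})"
      by (intro bexI[of _ "v - (\<Sum>i<n. scale (c i) (b i))"]) auto
  qed
  \<comment> \<open>Independence bounds the finite subsets of \<open>B\<close>, so \<open>B\<close>
    is finite; an enumeration of it is then a basis to which uniqueness applies.\<close>
  have *: "card B = n" if B: "quot_basis scale V W B" for B
  proof -
    have ind: "\<forall>x\<in>F. u x = 0" if "finite F" "F \<subseteq> B" "(\<Sum>b\<in>F. scale (u b) b) \<in> W" for F u
      using B that unfolding quot_basis_def by blast
    have bd: "card F \<le> n" if "finite F" "F \<subseteq> B" for F
      by (rule has_qdim_indep_le[OF q W that(1)]) 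
        (use B that ind in \<open>auto simp: quot_basis_def\<close>)
    have fin: "finite B"
    proof (rule ccontr)
      assume "infinite B"
      then obtain F where "F \<subseteq> B" "finite F" "card F = Suc n"
        by (meson infinite_arbitrarily_large)
      with bd show False by fastforce
    qed
    obtain h where h: "bij_betw h {..<card B} B"
      using ex_bij_betw_nat_finite[OF fin] by (auto simp: atLeast0LessThan)
    have "has_qdim scale V W (card B)"
    proof (rule has_qdimI)
      fix i assume "i < card B"
      then have "h i \<in> B" using h bij_betwE by blast
      then show "h i \<in> V" using B by (auto simp: quot_basis_def)
    next
      fix c i assume c: "(\<Sum>i<card B. scale (c i) (h i)) \<in> W" and i: "i < card B"
      define u where "u y = c (inv_into {..<card B} h y)" for y
      have inj: "inj_on h {..<card B}" using h by (simp add: bij_betw_def)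
      have "(\<Sum>y\<in>B. scale (u y) y) = (\<Sum>i<card B. scale (u (h i)) (h i))"
        using sum.reindex_bij_betw[OF h, of "\<lambda>y. scale (u y) y"] by simp
      also have "\<dots> = (\<Sum>i<card B. scale (c i) (h i))"
        by (rule sum.cong) (auto simp: u_def inv_into_f_f[OF inj])
      finally have "\<forall>y\<in>B. u y = 0" using ind[OF fin] c by simp
      moreover have "h i \<in> B" using h i bij_betwE by blast
      ultimately show "c i = 0" using i inv_into_f_f[OF inj, of i] unfolding u_def by force
    next
      fix v assume "v \<in> V"
      then obtain w where w: "w \<in> W" "v - w \<in> span B" using B unfolding quot_basis_def by blast
      then obtain u where u: "v - w = (\<Sum>y\<in>B. scale (u y) y)"
        unfolding span_finite[OF fin] by auto
      have "(\<Sum>y\<in>B. scale (u y) y) = (\<Sum>i<card B. scale (u (h i)) (h i))"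
        using sum.reindex_bij_betw[OF h, of "\<lambda>y. scale (u y) y"] by simp
      with u have "v - (\<Sum>i<card B. scale (u (h i)) (h i)) = w" by (simp add: algebra_simps)
      with w show "\<exists>c. v - (\<Sum>i<card B. scale (c i) (h i)) \<in> W" by metis
    qed
    with q W has_qdim_unique show ?thesis by blast
  qed
  show ?thesis unfolding quot_dim_def
    by (rule *, rule someI[of "quot_basis scale V W"], rule ex)
qed

lemma has_qdim_0: "V \<subseteq> W \<Longrightarrow> has_qdim scale V W 0"
  by (rule has_qdimI) auto

lemma has_qdim_0D: "has_qdim scale V W 0 \<Longrightarrow> V \<subseteq> W"
  by (erule has_qdimE) auto

lemma has_qdim_1:
  assumes "b \<in> V" "b \<notin> W" "subspace W" "\<And>v. v \<in> V \<Longrightarrow> \<exists>c. v - scale c b \<in> W"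
  shows "has_qdim scale V W 1"
proof (rule has_qdimI[where b = "\<lambda>_. b"])
  fix c :: "nat \<Rightarrow> 'a" and i :: nat assume c: "(\<Sum>i<1::nat. scale (c i) b) \<in> W" "i < 1"
  show "c i = 0"
  proof (rule ccontr)
    assume "c i \<noteq> 0"
    then have "b = scale (inverse (c i)) (scale (c i) b)" by simp
    also have "\<dots> \<in> W" using c by (subst subspace_scale[OF assms(3)]) auto
    finally show False using assms by simp
  qed
next
  fix v assume "v \<in> V"
  then obtain c where "v - scale c b \<in> W" using assms(4) by blast
  then show "\<exists>c. v - (\<Sum>i<1::nat. scale (c i) b) \<in> W"
    by (intro exI[of _ "\<lambda>_. c"]) (simp only: One_nat_def sum.lessThan_Suc lessThan_0 sum.empty add_0)
qed (use assms in auto)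

lemma has_qdim_add:
  assumes "has_qdim scale V U m" "has_qdim scale U W n"
    and "U \<subseteq> V" "W \<subseteq> U" "subspace U"
  shows "has_qdim scale V W (m + n)"
proof -
  obtain b where b: "\<And>i. i < m \<Longrightarrow> b i \<in> V"
    "\<And>c i. (\<Sum>i<m. scale (c i) (b i)) \<in> U \<Longrightarrow> i < m \<Longrightarrow> c i = 0"
    "\<And>v. v \<in> V \<Longrightarrow> \<exists>c. v - (\<Sum>i<m. scale (c i) (b i)) \<in> U"
    using assms(1) by (rule has_qdimE) blast
  obtain d where d: "\<And>i. i < n \<Longrightarrow> d i \<in> U"
    "\<And>c i. (\<Sum>i<n. scale (c i) (d i)) \<in> W \<Longrightarrow> i < n \<Longrightarrow> c i = 0"
    "\<And>v. v \<in> U \<Longrightarrow> \<exists>c. v - (\<Sum>i<n. scale (c i) (d i)) \<in> W"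
    using assms(2) by (rule has_qdimE) blast
  define e where "e i = (if i < m then b i else d (i - m))" for i
  have s: "(\<Sum>i<m + n. scale (c i) (e i)) = (\<Sum>i<m. scale (c i) (b i)) + (\<Sum>i<n. scale (c (m + i)) (d i))" for c
  proof -
    have "(\<Sum>i<m + n. scale (c i) (e i)) = (\<Sum>i<m. scale (c i) (e i)) + (\<Sum>i=m..<m+n. scale (c i) (e i))"
      by (simp add: sum.atLeastLessThan_concat[of 0 m "m+n", symmetric] lessThan_atLeast0)
    moreover have "(\<Sum>i=m..<m+n. scale (c i) (e i)) = (\<Sum>i<n. scale (c (m + i)) (d i))"
      using sum.shift_bounds_nat_ivl[of "\<lambda>i. scale (c i) (e i)" 0 m n]
      by (simp add: e_def lessThan_atLeast0 add.commute)
    ultimately show ?thesis by (simp add: e_def)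
  qed
  have dU: "(\<Sum>i<n. scale (c i) (d i)) \<in> U" for c
    by (intro subspace_sum[OF assms(5)] subspace_scale[OF assms(5)] d) auto
  show ?thesis
  proof (rule has_qdimI)
    fix i assume "i < m + n" then show "e i \<in> V" using b(1) d(1) assms(3) by (auto simp: e_def)
  next
    fix c i assume c: "(\<Sum>i<m + n. scale (c i) (e i)) \<in> W" and i: "i < m + n"
    have "(\<Sum>i<m + n. scale (c i) (e i)) - (\<Sum>i<n. scale (c (m + i)) (d i)) \<in> U"
      using c assms(4) dU by (intro subspace_diff[OF assms(5)]) auto
    then have "(\<Sum>i<m. scale (c i) (b i)) \<in> U" by (simp add: s)
    then have cm: "\<And>i. i < m \<Longrightarrow> c i = 0" using b(2) by blast
    then have "(\<Sum>i<n. scale (c (m + i)) (d i)) \<in> W" using c by (simp add: s)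
    then have "\<And>i. i < n \<Longrightarrow> c (m + i) = 0" using d(2)[of "\<lambda>i. c (m + i)"] by blast
    from this[of "i - m"] cm[of i] i show "c i = 0" by (cases "i < m") auto
  next
    fix v assume "v \<in> V"
    then obtain c1 where "v - (\<Sum>i<m. scale (c1 i) (b i)) \<in> U" using b(3) by blast
    then obtain c2 where c2: "v - (\<Sum>i<m. scale (c1 i) (b i)) - (\<Sum>i<n. scale (c2 i) (d i)) \<in> W"
      using d(3) by blast
    show "\<exists>c. v - (\<Sum>i<m + n. scale (c i) (e i)) \<in> W"
      by (rule exI[of _ "\<lambda>i. if i < m then c1 i else c2 (i - m)"]) (use c2 in \<open>simp add: s diff_diff_eq\<close>)
  qed
qed

text \<open>Each functional lowers the dimension by at most one. Linearity is demanded on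
  \<open>Y\<close> only, since the functionals used later are controlled only on forms of one
  degree.\<close>

lemma has_qdim_functionals:
  fixes l :: "nat \<Rightarrow> 'b \<Rightarrow> 'a"
  assumes Y: "subspace Y"
    and add: "\<And>i x y. i < m \<Longrightarrow> x \<in> Y \<Longrightarrow> y \<in> Y \<Longrightarrow> l i (x + y) = l i x + l i y"
    and scl: "\<And>i c x. i < m \<Longrightarrow> x \<in> Y \<Longrightarrow> l i (scale c x) = c * l i x"
  shows "\<exists>k\<le>m. has_qdim scale Y {y \<in> Y. \<forall>i<m. l i y = 0} k"
  using add scl
proof (induction m)
  case 0
  have "has_qdim scale Y {y \<in> Y. \<forall>i<0. l i y = 0} 0" by (rule has_qdim_0) auto
  then show ?case by blast
next
  case (Suc m)
  have "\<exists>k\<le>m. has_qdim scale Y {y \<in> Y. \<forall>i<m. l i y = 0} k"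
    by (rule Suc.IH) (simp_all add: Suc.prems)
  then obtain k where k: "k \<le> m" "has_qdim scale Y {y \<in> Y. \<forall>i<m. l i y = 0} k"
    by blast
  let ?U = "{y \<in> Y. \<forall>i<m. l i y = 0}" and ?W = "{y \<in> Y. \<forall>i<Suc m. l i y = 0}"
  have l0: "l i 0 = 0" if "i < Suc m" for i
    using Suc.prems(2)[OF that subspace_0[OF Y], of 0] by simp
  have U: "subspace ?U"
    by (rule subspaceI) (use Suc.prems subspace_0[OF Y] subspace_add[OF Y] subspace_scale[OF Y] l0 in auto)
  have W: "subspace ?W"
    by (rule subspaceI) (use Suc.prems subspace_0[OF Y] subspace_add[OF Y] subspace_scale[OF Y] l0 in auto)
  have "\<exists>k'\<le>1. has_qdim scale ?U ?W k'"
  proof (cases "?U \<subseteq> ?W")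
    case True
    then have "has_qdim scale ?U ?W 0" by (rule has_qdim_0)
    then show ?thesis by auto
  next
    case False
    then obtain b where b: "b \<in> ?U" "b \<notin> ?W" by blast
    then have bm: "l m b \<noteq> 0" by (auto simp: less_Suc_eq)
    have "has_qdim scale ?U ?W 1"
    proof (rule has_qdim_1[OF b W])
      fix v assume v: "v \<in> ?U"
      \<comment> \<open>The multiple of \<open>b\<close> whose subtraction makes the last functional
        vanish.\<close>
      define c where "c = l m v / l m b"
      have *: "v + scale (-c) b \<in> ?U" using U v b by (intro subspace_add subspace_scale) auto
      moreover have "l m (v + scale (-c) b) = 0"
        using Suc.prems v b subspace_scale[OF Y] bm by (simp add: c_def del: scale_minus_left)
      ultimately have "v + scale (-c) b \<in> ?W" by (auto simp: less_Suc_eq)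
      then show "\<exists>c. v - scale c b \<in> ?W" by (intro exI[of _ c]) simp
    qed
    then show ?thesis by auto
  qed
  then obtain k' where k': "k' \<le> 1" "has_qdim scale ?U ?W k'" by blast
  have "has_qdim scale Y ?W (k + k')"
    by (rule has_qdim_add[OF k(2) k'(2) _ _ U]) auto
  then show ?case using k k' by (intro exI[of _ "k + k'"]) auto
qed

text \<open>Coordinates are chosen by \<open>SOME\<close>; independence modulo \<open>W\<close>
  makes them unique, hence linear on \<open>V\<close>.\<close>

lemma has_qdim_coordinates:
  assumes q: "has_qdim scale V W n" and V: "subspace V" and W: "subspace W" "W \<subseteq> V"
  obtains l :: "nat \<Rightarrow> 'b \<Rightarrow> 'a" where
    "\<And>i x y. i < n \<Longrightarrow> x \<in> V \<Longrightarrow> y \<in> V \<Longrightarrow> l i (x + y) = l i x + l i y"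
    "\<And>i c x. i < n \<Longrightarrow> x \<in> V \<Longrightarrow> l i (scale c x) = c * l i x"
    "W = {x \<in> V. \<forall>i<n. l i x = 0}"
proof -
  obtain b where b: "\<And>i. i < n \<Longrightarrow> b i \<in> V"
    "\<And>c i. (\<Sum>i<n. scale (c i) (b i)) \<in> W \<Longrightarrow> i < n \<Longrightarrow> c i = 0"
    "\<And>v. v \<in> V \<Longrightarrow> \<exists>c. v - (\<Sum>i<n. scale (c i) (b i)) \<in> W"
    using q by (rule has_qdimE) blast
  define co where "co v = (SOME c. v - (\<Sum>i<n. scale (c i) (b i)) \<in> W)" for v
  have co: "v - (\<Sum>i<n. scale (co v i) (b i)) \<in> W" if "v \<in> V" for v
    unfolding co_def using someI_ex[OF b(3)[OF that]] by simp
  have u: "c i = co v i" if v: "v \<in> V" "v - (\<Sum>i<n. scale (c i) (b i)) \<in> W" "i < n" for c v i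
  proof -
    have "(v - (\<Sum>i<n. scale (co v i) (b i))) - (v - (\<Sum>i<n. scale (c i) (b i))) \<in> W"
      by (rule subspace_diff[OF W(1) co[OF v(1)] v(2)])
    then have "(\<Sum>i<n. scale (c i - co v i) (b i)) \<in> W"
      by (simp add: scale_left_diff_distrib sum_subtractf)
    then show ?thesis using b(2)[of "\<lambda>i. c i - co v i"] that by simp
  qed
  show ?thesis
  proof (rule that[of "\<lambda>i v. co v i"])
    fix i x y assume a: "i < n" "x \<in> V" "y \<in> V"
    have "(x - (\<Sum>i<n. scale (co x i) (b i))) + (y - (\<Sum>i<n. scale (co y i) (b i))) \<in> W"
      using co a by (intro subspace_add[OF W(1)]) auto
    then have "(x + y) - (\<Sum>i<n. scale (co x i + co y i) (b i)) \<in> W"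
      by (simp add: scale_left_distrib sum.distrib algebra_simps)
    then show "co (x + y) i = co x i + co y i"
      using u[of "x + y" "\<lambda>i. co x i + co y i"] a subspace_add[OF V] by simp
  next
    fix i c x assume a: "i < n" "x \<in> V"
    have "scale c (x - (\<Sum>i<n. scale (co x i) (b i))) \<in> W"
      using co a by (intro subspace_scale[OF W(1)]) auto
    then have "scale c x - (\<Sum>i<n. scale (c * co x i) (b i)) \<in> W"
      by (simp add: scale_right_diff_distrib scale_sum_right)
    then show "co (scale c x) i = c * co x i"
      using u[of "scale c x" "\<lambda>i. c * co x i"] a subspace_scale[OF V] by simp
  next
    show "W = {x \<in> V. \<forall>i<n. co x i = 0}"
    proof (intro set_eqI iffI)
      fix x assume x: "x \<in> W"
      then have "0 = co x i" if "i < n" for i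
        using u[of x "\<lambda>_. 0"] W that by auto
      then show "x \<in> {x \<in> V. \<forall>i<n. co x i = 0}" using x W by auto
    next
      fix x assume "x \<in> {x \<in> V. \<forall>i<n. co x i = 0}"
      then show "x \<in> W" using co[of x] by simp
    qed
  qed
qed

text \<open>The coordinate functionals of \<open>V\<close> modulo \<open>W\<close>, restricted to
  \<open>U\<close>, have common kernel \<open>W\<close>.\<close>

lemma has_qdim_sub:
  assumes q: "has_qdim scale V W n" and V: "subspace V" and W: "subspace W" and U: "subspace U"
    and "W \<subseteq> U" "U \<subseteq> V"
  shows "\<exists>k\<le>n. has_qdim scale U W k"
proof -
  from assms have WV: "W \<subseteq> V" by auto
  obtain l where l:
    "\<And>i x y. i < n \<Longrightarrow> x \<in> V \<Longrightarrow> y \<in> V \<Longrightarrow> l i (x + y) = l i x + l i y"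
    "\<And>i c x. i < n \<Longrightarrow> x \<in> V \<Longrightarrow> l i (scale c x) = c * l i x"
    "W = {x \<in> V. \<forall>i<n. l i x = 0}"
    using has_qdim_coordinates[OF q V W WV] by blast
  have "\<exists>k\<le>n. has_qdim scale U {x \<in> U. \<forall>i<n. l i x = 0} k"
    by (rule has_qdim_functionals[OF U]) (use l assms in blast)+
  moreover have "{x \<in> U. \<forall>i<n. l i x = 0} = W" using l(3) assms by auto
  ultimately show ?thesis by simp
qed

text \<open>By induction on the number of generators: \<open>U\<close> is generated by
  \<open>W\<close> and all but the last one, and the last one adds at most one dimension.\<close>

lemma has_qdim_spanning:
  assumes V: "subspace V" and W: "subspace W" "W \<subseteq> V"
    and b: "\<And>i. i < m \<Longrightarrow> b i \<in> V" "\<And>v. v \<in> V \<Longrightarrow> \<exists>c. v - (\<Sum>i<m. scale (c i) (b i)) \<in> W"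
  shows "\<exists>k\<le>m. has_qdim scale V W k"
  using V W b
proof (induction m arbitrary: V)
  case 0
  then have "V \<subseteq> W" by auto
  then show ?case using has_qdim_0 by blast
next
  case (Suc m)
  define U where "U = {v. \<exists>c. v - (\<Sum>i<m. scale (c i) (b i)) \<in> W}"
  have U: "subspace U"
  proof (rule subspaceI)
    show "0 \<in> U" unfolding U_def using subspace_0[OF W(1)] by (auto intro!: exI[of _ "\<lambda>_. 0"])
  next
    fix x y assume "x \<in> U" "y \<in> U"
    then obtain c d where "x - (\<Sum>i<m. scale (c i) (b i)) \<in> W" "y - (\<Sum>i<m. scale (d i) (b i)) \<in> W"
      unfolding U_def by blast
    from subspace_add[OF W(1) this] show "x + y \<in> U" unfolding U_def
      by (auto intro!: exI[of _ "\<lambda>i. c i + d i"] simp: scale_left_distrib sum.distrib algebra_simps)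
  next
    fix a x assume "x \<in> U"
    then obtain c where "x - (\<Sum>i<m. scale (c i) (b i)) \<in> W" unfolding U_def by blast
    from subspace_scale[OF W(1) this, of a] show "scale a x \<in> U" unfolding U_def
      by (auto intro!: exI[of _ "\<lambda>i. a * c i"] simp: scale_right_diff_distrib scale_sum_right)
  qed
  have bU: "b i \<in> U" if "i < m" for i
  proof -
    have "(\<Sum>j<m. scale (if j = i then 1 else 0) (b j)) = (\<Sum>j<m. if j = i then b j else 0)"
      by (rule sum.cong) auto
    also have "\<dots> = b i" using that by simp
    finally show ?thesis unfolding U_def using subspace_0[OF W(1)]
      by (auto intro!: exI[of _ "\<lambda>j. if j = i then 1 else 0"])
  qed
  have UV: "U \<subseteq> V"
  proof
    fix x assume "x \<in> U"
    then obtain c where "x - (\<Sum>i<m. scale (c i) (b i)) \<in> V" using Suc.prems(3) unfolding U_def by blast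
    moreover have "(\<Sum>i<m. scale (c i) (b i)) \<in> V"
      by (intro subspace_sum[OF Suc.prems(1)] subspace_scale[OF Suc.prems(1)] Suc.prems(4)) auto
    ultimately show "x \<in> V" using subspace_add[OF Suc.prems(1)] by fastforce
  qed
  have WU: "W \<subseteq> U" unfolding U_def by (auto intro!: exI[of _ "\<lambda>_. 0"])
  have "\<exists>k\<le>m. has_qdim scale U W k"
    by (rule Suc.IH[OF U W(1) WU bU]) (auto simp: U_def)
  then obtain k where k: "k \<le> m" "has_qdim scale U W k" by blast
  have dec: "\<exists>c. v - scale c (b m) \<in> U" if v: "v \<in> V" for v
  proof -
    obtain c where "v - (\<Sum>i<Suc m. scale (c i) (b i)) \<in> W" using Suc.prems(5)[OF v] by blast
    then have "v - scale (c m) (b m) - (\<Sum>i<m. scale (c i) (b i)) \<in> W" by (simp add: algebra_simps)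
    then show ?thesis unfolding U_def by blast
  qed
  show ?case
  proof (cases "b m \<in> U")
    case True
    have "V \<subseteq> U"
    proof
      fix v assume "v \<in> V"
      then obtain c where "v - scale c (b m) \<in> U" using dec by blast
      from subspace_add[OF U this subspace_scale[OF U True, of c]] show "v \<in> U" by simp
    qed
    with UV k show ?thesis by (metis le_SucI subset_antisym)
  next
    case False
    have "has_qdim scale V U 1" using Suc.prems(4)[of m] False U dec by (intro has_qdim_1) auto
    from has_qdim_add[OF this k(2) UV WU U] k show ?thesis by (intro exI[of _ "1 + k"]) auto
  qed
qed

text \<open>Nondegeneracy turns the pairing into injections both of \<open>U\<^sup>\<bottom> / Y0\<close> into the dual of
  \<open>X / U\<close> and of \<open>Y / U\<^sup>\<bottom>\<close> into the dual of \<open>U / X0\<close>; comparing dimensions, both are onto.\<close>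

lemma has_qdim_annihilator:
  fixes \<beta> :: "'b \<Rightarrow> 'b \<Rightarrow> 'a"
  assumes X: "subspace X" and Y: "subspace Y" and U: "subspace U"
    and addl: "\<And>x x' y. x \<in> X \<Longrightarrow> x' \<in> X \<Longrightarrow> y \<in> Y \<Longrightarrow> \<beta> (x + x') y = \<beta> x y + \<beta> x' y"
    and scll: "\<And>c x y. x \<in> X \<Longrightarrow> y \<in> Y \<Longrightarrow> \<beta> (scale c x) y = c * \<beta> x y"
    and addr: "\<And>x y y'. x \<in> X \<Longrightarrow> y \<in> Y \<Longrightarrow> y' \<in> Y \<Longrightarrow> \<beta> x (y + y') = \<beta> x y + \<beta> x y'"
    and sclr: "\<And>c x y. x \<in> X \<Longrightarrow> y \<in> Y \<Longrightarrow> \<beta> x (scale c y) = c * \<beta> x y"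
    and X0: "X0 = {x \<in> X. \<forall>y\<in>Y. \<beta> x y = 0}" and Y0: "Y0 = {y \<in> Y. \<forall>x\<in>X. \<beta> x y = 0}"
    and fin: "has_qdim scale X X0 p" and sub: "X0 \<subseteq> U" "U \<subseteq> X"
    and q: "has_qdim scale X U m"
  shows "has_qdim scale {y \<in> Y. \<forall>u\<in>U. \<beta> u y = 0} Y0 m"
proof -
  have zl: "\<beta> 0 y = 0" if "y \<in> Y" for y using scll[OF subspace_0[OF X] that, of 0] by simp
  have zr: "\<beta> x 0 = 0" if "x \<in> X" for x using sclr[OF that subspace_0[OF Y], of 0] by simp
  have sX0: "subspace X0" unfolding X0
    by (rule subspaceI) (use addl scll zl subspace_0[OF X] subspace_add[OF X] subspace_scale[OF X] in auto)
  have sperp: "subspace {y \<in> Y. \<forall>u\<in>A. \<beta> u y = 0}" if "A \<subseteq> X" for A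
    by (rule subspaceI) (use that addr sclr zr subspace_0[OF Y] subspace_add[OF Y] subspace_scale[OF Y] in \<open>auto simp: subset_iff\<close>)
  have sperpl: "subspace {x \<in> X. \<forall>y\<in>A. \<beta> x y = 0}" if "A \<subseteq> Y" for A
    by (rule subspaceI) (use that addl scll zl subspace_0[OF X] subspace_add[OF X] subspace_scale[OF X] in \<open>auto simp: subset_iff\<close>)
  let ?P = "{y \<in> Y. \<forall>u\<in>U. \<beta> u y = 0}"
  have sumz: "\<beta> (\<Sum>i<m. scale (c i) (b i)) y = (\<Sum>i<m. c i * \<beta> (b i) y)"
    if "\<And>i. i < m \<Longrightarrow> b i \<in> X" "y \<in> Y" for m :: nat and c b y
    using that
  proof (induction m)
    case (Suc m)
    have "(\<Sum>i<m. scale (c i) (b i)) \<in> X" using Suc.prems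
      by (intro subspace_sum[OF X] subspace_scale[OF X]) auto
    with Suc show ?case by (simp add: addl scll subspace_scale[OF X])
  qed (simp add: zl)
  have sumr: "\<beta> x (\<Sum>i<m. scale (c i) (b i)) = (\<Sum>i<m. c i * \<beta> x (b i))"
    if "\<And>i. i < m \<Longrightarrow> b i \<in> Y" "x \<in> X" for m :: nat and c b x
    using that
  proof (induction m)
    case (Suc m)
    have "(\<Sum>i<m. scale (c i) (b i)) \<in> Y" using Suc.prems
      by (intro subspace_sum[OF Y] subspace_scale[OF Y]) auto
    with Suc show ?case by (simp add: addr sclr subspace_scale[OF Y])
  qed (simp add: zr)
  have le: "\<exists>k\<le>r. has_qdim scale B {y \<in> B. \<forall>x\<in>A. \<beta> x y = 0} k"
    if A: "subspace A" "A \<subseteq> X" and B: "subspace B" "B \<subseteq> Y" and C: "C \<subseteq> A"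
      "\<And>x y. x \<in> C \<Longrightarrow> y \<in> B \<Longrightarrow> \<beta> x y = 0" and r: "has_qdim scale A C r" for A B C r
  proof -
    obtain b where b: "\<And>i. i < r \<Longrightarrow> b i \<in> A"
      "\<And>v. v \<in> A \<Longrightarrow> \<exists>c. v - (\<Sum>i<r. scale (c i) (b i)) \<in> C"
      using r by (rule has_qdimE) blast
    have "\<exists>k\<le>r. has_qdim scale B {y \<in> B. \<forall>i<r. \<beta> (b i) y = 0} k"
      by (rule has_qdim_functionals[OF B(1), where l = "\<lambda>i y. \<beta> (b i) y"])
        (simp_all add: addr sclr b(1) subsetD[OF A(2)] subsetD[OF B(2)])
    moreover have "{y \<in> B. \<forall>i<r. \<beta> (b i) y = 0} = {y \<in> B. \<forall>x\<in>A. \<beta> x y = 0}"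
    proof (intro set_eqI iffI)
      fix y assume y: "y \<in> {y \<in> B. \<forall>i<r. \<beta> (b i) y = 0}"
      have "\<beta> x y = 0" if xA: "x \<in> A" for x
      proof -
        obtain c where c: "x - (\<Sum>i<r. scale (c i) (b i)) \<in> C" using b(2)[OF xA] by blast
        let ?s = "\<Sum>i<r. scale (c i) (b i)"
        have s: "?s \<in> A" using b by (intro subspace_sum[OF A(1)] subspace_scale[OF A(1)]) auto
        have "x - ?s \<in> X" "?s \<in> X" "y \<in> Y" using c C(1) A(2) B(2) s y by blast+
        then have "\<beta> x y = \<beta> (x - ?s) y + \<beta> ?s y" using addl[of "x - ?s" ?s y] by simp
        also have "\<beta> ?s y = 0" using sumz[of r b y c] b A B y by auto
        also have "\<beta> (x - ?s) y = 0" using C(2)[OF c] y by blast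
        finally show ?thesis by simp
      qed
      then show "y \<in> {y \<in> B. \<forall>x\<in>A. \<beta> x y = 0}" using y by blast
    qed (use b in auto)
    ultimately show ?thesis by simp
  qed
  have lel: "\<exists>k\<le>r. has_qdim scale X {x \<in> X. \<forall>y\<in>Y. \<beta> x y = 0} k" if r: "has_qdim scale Y Y0 r" for r
  proof -
    obtain b where b: "\<And>i. i < r \<Longrightarrow> b i \<in> Y"
      "\<And>v. v \<in> Y \<Longrightarrow> \<exists>c. v - (\<Sum>i<r. scale (c i) (b i)) \<in> Y0"
      using r by (rule has_qdimE) blast
    have "\<exists>k\<le>r. has_qdim scale X {x \<in> X. \<forall>i<r. \<beta> x (b i) = 0} k"
      by (rule has_qdim_functionals[OF X, where l = "\<lambda>i x. \<beta> x (b i)"])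
        (simp_all add: addl scll b(1))
    moreover have "{x \<in> X. \<forall>i<r. \<beta> x (b i) = 0} = {x \<in> X. \<forall>y\<in>Y. \<beta> x y = 0}"
    proof (intro set_eqI iffI)
      fix x assume x: "x \<in> {x \<in> X. \<forall>i<r. \<beta> x (b i) = 0}"
      have "\<beta> x y = 0" if yY: "y \<in> Y" for y
      proof -
        obtain c where c: "y - (\<Sum>i<r. scale (c i) (b i)) \<in> Y0" using b(2)[OF yY] by blast
        let ?s = "\<Sum>i<r. scale (c i) (b i)"
        have s: "?s \<in> Y" using b by (intro subspace_sum[OF Y] subspace_scale[OF Y]) auto
        have "\<beta> x y = \<beta> x (y - ?s) + \<beta> x ?s" using addr[of x "y - ?s" ?s] c Y0 s x by simp
        also have "\<beta> x ?s = 0" using sumr[of r b x c] b x by auto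
        also have "\<beta> x (y - ?s) = 0" using c x Y0 by auto
        finally show ?thesis by simp
      qed
      then show "x \<in> {x \<in> X. \<forall>y\<in>Y. \<beta> x y = 0}" using x by blast
    qed (use b in auto)
    ultimately show ?thesis by simp
  qed
  have sP: "subspace ?P" using sperp[OF sub(2)] .
  have sY0: "subspace Y0" using sperp[of X] Y0 by simp
  obtain k1 where k1: "k1 \<le> m" "has_qdim scale ?P {y \<in> ?P. \<forall>x\<in>X. \<beta> x y = 0} k1"
    using le[OF X subset_refl sP _ sub(2) _ q] by blast
  have e1: "{y \<in> ?P. \<forall>x\<in>X. \<beta> x y = 0} = Y0" using Y0 sub by auto
  obtain s where s: "s \<le> p" "has_qdim scale U X0 s"
    using has_qdim_sub[OF fin X sX0 U sub] by blast
  obtain k2 where k2: "k2 \<le> s" "has_qdim scale Y ?P k2"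
    using le[OF U sub(2) Y subset_refl sub(1) _ s(2)] X0 by blast
  have pe: "m + s = p"
    using has_qdim_unique[OF has_qdim_add[OF q s(2) sub(2) sub(1) U] fin sX0] .
  have qY: "has_qdim scale Y Y0 (k2 + k1)"
    by (rule has_qdim_add[OF k2(2) k1(2)[unfolded e1] _ _ sP]) (use Y0 sub in auto)
  \<comment> \<open>Now \<open>m + s = p = k3 \<le> k2 + k1\<close> while \<open>k1 \<le> m\<close>
    and \<open>k2 \<le> s\<close>, so equality holds throughout.\<close>
  obtain k3 where k3: "k3 \<le> k2 + k1" "has_qdim scale X X0 k3" using lel[OF qY] X0 by blast
  have "k3 = p" using has_qdim_unique[OF k3(2) fin sX0] .
  with k1 k2 k3 pe have "k1 = m" by linarith
  with k1 e1 show ?thesis by simp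
qed

end

text \<open>The hypotheses say that \<open>L\<close> induces an isomorphism from
  \<open>V / W\<close> onto \<open>V' / W'\<close>. Both directions are useful: for the expansion at
  a singular point, finite dimension passes from forms to the Tjurina algebra.\<close>

lemma has_qdim_transfer:
  assumes L: "Vector_Spaces.linear s1 s2 L" and W': "module.subspace s2 W'"
    and LV: "\<And>v. v \<in> V \<Longrightarrow> L v \<in> V'"
    and LW: "\<And>v. v \<in> V \<Longrightarrow> L v \<in> W' \<longleftrightarrow> v \<in> W" and V: "module.subspace s1 V"
    and surj: "\<And>v'. v' \<in> V' \<Longrightarrow> \<exists>v\<in>V. v' - L v \<in> W'"
  shows "has_qdim s1 V W n \<longleftrightarrow> has_qdim s2 V' W' n"
proof
  interpret L: Vector_Spaces.linear s1 s2 L by (rule L)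
  have LS: "L (\<Sum>i<n. s1 (c i) (b i)) = (\<Sum>i<n. s2 (c i) (L (b i)))" for c b
    by (simp add: L.sum L.scale)
  have SV: "(\<Sum>i<n. s1 (c i) (b i)) \<in> V" if "\<And>i. i < n \<Longrightarrow> b i \<in> V" for c b
    using that by (intro L.vs1.subspace_sum[OF V] L.vs1.subspace_scale[OF V]) auto
  {
    assume "has_qdim s1 V W n"
    then obtain b where b: "\<And>i. i < n \<Longrightarrow> b i \<in> V"
      "\<And>c i. (\<Sum>i<n. s1 (c i) (b i)) \<in> W \<Longrightarrow> i < n \<Longrightarrow> c i = 0"
      "\<And>v. v \<in> V \<Longrightarrow> \<exists>c. v - (\<Sum>i<n. s1 (c i) (b i)) \<in> W"
      by (rule has_qdimE) blast
    show "has_qdim s2 V' W' n"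
    proof (rule has_qdimI[where b = "\<lambda>i. L (b i)"])
      fix i assume "i < n" then show "L (b i) \<in> V'" using b LV by blast
    next
      fix c i assume c: "(\<Sum>i<n. s2 (c i) (L (b i))) \<in> W'" "i < n"
      have "(\<Sum>i<n. s1 (c i) (b i)) \<in> W" using c(1) LW[OF SV[of b c]] b(1) by (simp add: LS)
      then show "c i = 0" using b(2) c by blast
    next
      fix v' assume "v' \<in> V'"
      then obtain v where v: "v \<in> V" "v' - L v \<in> W'" using surj by blast
      from b(3)[OF v(1)] obtain c where c: "v - (\<Sum>i<n. s1 (c i) (b i)) \<in> W" ..
      have "v - (\<Sum>i<n. s1 (c i) (b i)) \<in> V" using v SV[of b c] b(1) L.vs1.subspace_diff[OF V] by blast
      then have "L (v - (\<Sum>i<n. s1 (c i) (b i))) \<in> W'" using c LW by blast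
      then have "L v - (\<Sum>i<n. s2 (c i) (L (b i))) \<in> W'" by (simp add: L.diff LS)
      from L.vs2.subspace_add[OF W' v(2) this] show "\<exists>c. v' - (\<Sum>i<n. s2 (c i) (L (b i))) \<in> W'"
        by (intro exI[of _ c]) simp
    qed
  next
    assume "has_qdim s2 V' W' n"
    then obtain b where b: "\<And>i. i < n \<Longrightarrow> b i \<in> V'"
      "\<And>c i. (\<Sum>i<n. s2 (c i) (b i)) \<in> W' \<Longrightarrow> i < n \<Longrightarrow> c i = 0"
      "\<And>v. v \<in> V' \<Longrightarrow> \<exists>c. v - (\<Sum>i<n. s2 (c i) (b i)) \<in> W'"
      by (rule has_qdimE) blast
    have "\<forall>i. \<exists>a. i < n \<longrightarrow> a \<in> V \<and> b i - L a \<in> W'" using b surj by blast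
    then obtain a where a: "\<And>i. i < n \<Longrightarrow> a i \<in> V" "\<And>i. i < n \<Longrightarrow> b i - L (a i) \<in> W'"
      by metis
    have d: "(\<Sum>i<n. s2 (c i) (b i)) - L (\<Sum>i<n. s1 (c i) (a i)) \<in> W'" for c
    proof -
      have "(\<Sum>i<n. s2 (c i) (b i - L (a i))) \<in> W'" using a
        by (intro L.vs2.subspace_sum[OF W'] L.vs2.subspace_scale[OF W']) auto
      then show ?thesis by (simp add: LS L.vs2.scale_right_diff_distrib sum_subtractf)
    qed
    show "has_qdim s1 V W n"
    proof (rule has_qdimI[where b = a])
      fix c i assume c: "(\<Sum>i<n. s1 (c i) (a i)) \<in> W" "i < n"
      have "L (\<Sum>i<n. s1 (c i) (a i)) \<in> W'" using c(1) LW[OF SV[of a c]] a(1) by simp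
      from L.vs2.subspace_add[OF W' d[of c] this] have "(\<Sum>i<n. s2 (c i) (b i)) \<in> W'" by simp
      then show "c i = 0" using b(2) c by blast
    next
      fix v assume v: "v \<in> V"
      from b(3)[OF LV[OF v]] obtain c where c: "L v - (\<Sum>i<n. s2 (c i) (b i)) \<in> W'" ..
      have "L v - L (\<Sum>i<n. s1 (c i) (a i)) \<in> W'"
        using L.vs2.subspace_add[OF W' c d[of c]] by simp
      then have "L (v - (\<Sum>i<n. s1 (c i) (a i))) \<in> W'" by (simp add: L.diff)
      moreover have "v - (\<Sum>i<n. s1 (c i) (a i)) \<in> V"
        using v SV[of a c] a(1) L.vs1.subspace_diff[OF V] by blast
      ultimately show "\<exists>c. v - (\<Sum>i<n. s1 (c i) (a i)) \<in> W" using LW by blast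
    qed (use a in auto)
  }
qed

section \<open>Polynomials, forms and homogeneous ideals\<close>

abbreviation lkp :: "('a \<Rightarrow>\<^sub>0 'b::zero) \<Rightarrow> 'a \<Rightarrow> 'b" where "lkp \<equiv> Poly_Mapping.lookup"

abbreviation forms :: "nat \<Rightarrow> 'n::finite cpoly set" where "forms k \<equiv> hom_comp (int k)"

interpretation pid: module "(*) :: 'n::finite cpoly \<Rightarrow> 'n cpoly \<Rightarrow> 'n cpoly"
  by standard (simp_all add: algebra_simps)

text \<open>As a rewrite rule it would undo \<open>mult.assoc\<close>.\<close>

declare pid.scale_scale [simp del]

lemma pconst_0 [simp]: "pconst 0 = 0" and pconst_1 [simp]: "pconst 1 = 1"
  by (simp_all add: pconst_def)

lemma pconst_add: "pconst (a + b) = pconst a + pconst b"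
  by (simp add: pconst_def single_add)

lemma pconst_mult: "pconst (a * b) = pconst a * pconst b"
  by (simp add: pconst_def mult_single)

lemma pconst_minus: "pconst (- a) = - pconst a"
  by (simp add: pconst_def single_uminus)

interpretation pv: vector_space "pscale :: complex \<Rightarrow> 'n::finite cpoly \<Rightarrow> 'n cpoly"
  by standard (simp_all only: pscale_def pconst_add pconst_mult pconst_1 distrib_left distrib_right mult.assoc mult_1_left)

lemma linear_mult: "Vector_Spaces.linear pscale pscale ((*) (g :: 'n::finite cpoly))"
proof -
  have "module_hom pscale pscale ((*) g)"
    unfolding module_hom_iff
    by (intro conjI allI pv.module_axioms) (simp_all only: pscale_def distrib_left mult.left_commute)
  then show ?thesis unfolding Vector_Spaces.linear_def using pv.vector_space_axioms by blast
qed

lemma subspace_ideal: "pid.subspace I \<Longrightarrow> pv.subspace I"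
  by (rule pv.subspaceI) (simp_all add: pid.subspace_0 pid.subspace_add pid.subspace_scale pscale_def)

lemma subspace_pideal [simp]: "pid.subspace (pideal G)"
  by (simp add: pideal_def)

lemma subspacev_pideal [simp]: "pv.subspace (pideal G)"
  by (simp add: subspace_ideal)

lemma pideal_base: "g \<in> G \<Longrightarrow> g \<in> pideal G"
  by (simp add: pideal_def pid.span_base)

lemma pideal_0 [simp]: "0 \<in> pideal G"
  by (simp add: pideal_def pid.span_zero)

lemma pideal_add: "x \<in> pideal G \<Longrightarrow> y \<in> pideal G \<Longrightarrow> x + y \<in> pideal G"
  by (simp add: pideal_def pid.span_add)

lemma pideal_diff: "x \<in> pideal G \<Longrightarrow> y \<in> pideal G \<Longrightarrow> x - y \<in> pideal G"
  by (simp add: pideal_def pid.span_diff)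

lemma pideal_mult: "x \<in> pideal G \<Longrightarrow> a * x \<in> pideal G"
  by (simp add: pideal_def pid.span_scale)

lemma pideal_mult_right: "x \<in> pideal G \<Longrightarrow> x * a \<in> pideal G"
  by (metis pideal_mult mult.commute)

lemma pideal_sum: "(\<And>x. x \<in> A \<Longrightarrow> f x \<in> pideal G) \<Longrightarrow> sum f A \<in> pideal G"
  by (simp add: pideal_def pid.span_sum)

lemma pideal_mono: "G \<subseteq> H \<Longrightarrow> pideal G \<subseteq> pideal H"
  by (simp add: pideal_def pid.span_mono)

lemma pideal_le: "(\<And>g. g \<in> G \<Longrightarrow> g \<in> pideal H) \<Longrightarrow> pideal G \<subseteq> pideal H"
  unfolding pideal_def by (rule pid.span_minimal) auto

lemma pideal_insert: "x \<in> pideal (insert h G) \<longleftrightarrow> (\<exists>a. x - a * h \<in> pideal G)"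
  by (simp add: pideal_def pid.span_breakdown_eq)

lemma pideal_one: "1 \<in> pideal G \<Longrightarrow> pideal G = UNIV"
  using pideal_mult[of 1 G] by auto

lemma sum_monomials: "f = (\<Sum>m\<in>Poly_Mapping.keys f. Poly_Mapping.single m (lkp f m))"
  for f :: "'a \<Rightarrow>\<^sub>0 'b::comm_monoid_add"
  by (rule poly_mapping_eqI)
    (auto simp: lookup_sum lookup_single when_def sum.delta' in_keys_iff if_distrib cong: if_cong)

lemma cpoly_induct [case_names single add]:
  fixes f :: "'a \<Rightarrow>\<^sub>0 'b::comm_monoid_add"
  assumes "\<And>m c. P (Poly_Mapping.single m c)" "\<And>f g. P f \<Longrightarrow> P g \<Longrightarrow> P (f + g)"
  shows "P f"
proof -
  have "P (\<Sum>m\<in>A. Poly_Mapping.single m (lkp f m))" if "finite A" for A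
    using that by induction (use assms assms(1)[of _ 0] in auto)
  then show ?thesis by (subst sum_monomials) simp
qed

section \<open>Evaluation and substitution homomorphisms\<close>

text \<open>The common generalization of \<open>peval\<close> and \<open>psubst\<close>, which
  differ only in how scalars are embedded; the homomorphism laws are proved once for both.\<close>

definition psub :: "(complex \<Rightarrow> 'a::comm_ring_1) \<Rightarrow> ('n::finite \<Rightarrow> 'a) \<Rightarrow> 'n cpoly \<Rightarrow> 'a" where
  "psub \<iota> s f = (\<Sum>m\<in>Poly_Mapping.keys f. \<iota> (lkp f m) * (\<Prod>j\<in>UNIV. s j ^ lkp m j))"

locale scalar_map =
  fixes \<iota> :: "complex \<Rightarrow> 'a::comm_ring_1"
  assumes zero: "\<iota> 0 = 0" and one: "\<iota> 1 = 1"
    and add: "\<iota> (a + b) = \<iota> a + \<iota> b" and mult: "\<iota> (a * b) = \<iota> a * \<iota> b"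
begin

lemma psub_superset:
  assumes "finite A" "Poly_Mapping.keys f \<subseteq> A"
  shows "psub \<iota> s f = (\<Sum>m\<in>A. \<iota> (lkp f m) * (\<Prod>j\<in>UNIV. s j ^ lkp m j))"
  unfolding psub_def
  by (rule sum.mono_neutral_left) (use assms zero in \<open>auto simp: in_keys_iff\<close>)

lemma psub_add: "psub \<iota> s (f + g) = psub \<iota> s f + psub \<iota> s g"
proof -
  let ?A = "Poly_Mapping.keys f \<union> Poly_Mapping.keys g"
  have "Poly_Mapping.keys (f + g) \<subseteq> ?A" by (rule Poly_Mapping.keys_add)
  then show ?thesis
    using psub_superset[of ?A f s] psub_superset[of ?A g s] psub_superset[of ?A "f + g" s]
    by (simp add: lookup_add add distrib_right sum.distrib)
qed

lemma psub_single: "psub \<iota> s (Poly_Mapping.single m c) = \<iota> c * (\<Prod>j\<in>UNIV. s j ^ lkp m j)"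
  using psub_superset[of "{m}" "Poly_Mapping.single m c" s] by (simp add: lookup_single)

lemma psub_mult: "psub \<iota> s (f * g) = psub \<iota> s f * psub \<iota> s g"
proof (induction f rule: cpoly_induct)
  case (single m c)
  show ?case
  proof (induction g rule: cpoly_induct)
    case (single m' c')
    show ?case
      by (simp add: mult_single psub_single mult lookup_add power_add prod.distrib algebra_simps)
  qed (simp add: psub_add algebra_simps)
qed (simp add: psub_add algebra_simps)

lemma psub_0: "psub \<iota> s 0 = 0"
  by (simp add: psub_def)

lemma psub_pconst: "psub \<iota> s (pconst c) = \<iota> c"
  by (simp add: pconst_def psub_single)

lemma psub_1: "psub \<iota> s 1 = 1"
  using psub_pconst[of s 1] by (simp add: one)

lemma psub_uminus: "psub \<iota> s (- f) = - psub \<iota> s f"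
  using psub_add[of s f "- f"] by (simp add: psub_0 eq_neg_iff_add_eq_0 add.commute)

lemma psub_diff: "psub \<iota> s (f - g) = psub \<iota> s f - psub \<iota> s g"
  using psub_add[of s f "- g"] by (simp add: psub_uminus)

lemma psub_pvar: "psub \<iota> s (pvar j) = s j"
proof -
  have "(\<Prod>i\<in>UNIV. s i ^ lkp (Poly_Mapping.single j (1::nat)) i) = (\<Prod>i\<in>UNIV. if i = j then s i else 1)"
    by (rule prod.cong) (auto simp: lookup_single when_def)
  then show ?thesis by (simp add: pvar_def psub_single one)
qed

lemma psub_pscale: "psub \<iota> s (pscale c f) = \<iota> c * psub \<iota> s f"
  by (simp add: pscale_def psub_mult psub_pconst)

lemma psub_sum: "psub \<iota> s (\<Sum>x\<in>A. f x) = (\<Sum>x\<in>A. psub \<iota> s (f x))"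
  by (induction A rule: infinite_finite_induct) (simp_all add: psub_0 psub_add)

lemma psub_prod: "psub \<iota> s (\<Prod>x\<in>A. f x) = (\<Prod>x\<in>A. psub \<iota> s (f x))"
  by (induction A rule: infinite_finite_induct) (simp_all add: psub_1 psub_mult)

lemma psub_power: "psub \<iota> s (f ^ k) = psub \<iota> s f ^ k"
  by (induction k) (simp_all add: psub_1 psub_mult)

end

lemma peval_psub: "peval f v = psub (\<lambda>c. c) (\<lambda>j. v $ j) f"
  by (simp add: peval_def psub_def)

lemma psubst_psub: "psubst f s = psub pconst s f"
  by (simp add: psubst_def psub_def)

interpretation ev: scalar_map "\<lambda>c. c"
  by standard simp_all

interpretation su: scalar_map pconst
  by standard (simp_all add: pconst_add pconst_mult)

lemma peval_simps [simp]:
  "peval 0 v = 0" "peval 1 v = 1" "peval (f + g) v = peval f v + peval g v"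
  "peval (f - g) v = peval f v - peval g v" "peval (- f) v = - peval f v"
  "peval (f * g) v = peval f v * peval g v" "peval (f ^ k) v = peval f v ^ k"
  "peval (pconst c) v = c" "peval (pvar j) v = v $ j" "peval (pscale c f) v = c * peval f v"
  "peval (sum h A) v = (\<Sum>x\<in>A. peval (h x) v)" "peval (prod h A) v = (\<Prod>x\<in>A. peval (h x) v)"
  by (simp_all only: peval_psub ev.psub_0 ev.psub_1 ev.psub_add ev.psub_diff ev.psub_uminus
      ev.psub_mult ev.psub_power ev.psub_pconst ev.psub_pvar ev.psub_pscale ev.psub_sum ev.psub_prod)

lemma psubst_simps [simp]:
  "psubst 0 s = 0" "psubst 1 s = 1" "psubst (f + g) s = psubst f s + psubst g s"
  "psubst (f - g) s = psubst f s - psubst g s" "psubst (- f) s = - psubst f s"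
  "psubst (f * g) s = psubst f s * psubst g s" "psubst (f ^ k) s = psubst f s ^ k"
  "psubst (pconst c) s = pconst c" "psubst (pvar j) s = s j" "psubst (pscale c f) s = pscale c (psubst f s)"
  "psubst (sum h A) s = (\<Sum>x\<in>A. psubst (h x) s)" "psubst (prod h A) s = (\<Prod>x\<in>A. psubst (h x) s)"
  by (simp_all only: psubst_psub su.psub_0 su.psub_1 su.psub_add su.psub_diff su.psub_uminus
      su.psub_mult su.psub_power su.psub_pconst su.psub_pvar su.psub_pscale su.psub_sum su.psub_prod pscale_def)

lemma mono_single_prod: "Poly_Mapping.single m 1 = (\<Prod>j\<in>UNIV. pvar j ^ lkp m j)"
  for m :: "'n::finite mono"
proof -
  have pw: "pvar j ^ k = Poly_Mapping.single (Poly_Mapping.single j k) 1" for j :: 'n and k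
  proof (induction k)
    case (Suc k)
    then show ?case by (simp add: pvar_def mult_single single_add[symmetric])
  qed simp
  have pr: "(\<Prod>j\<in>A. Poly_Mapping.single (g j) (1::complex)) = Poly_Mapping.single (\<Sum>j\<in>A. g j) 1"
    if "finite A" for A :: "'n set" and g :: "'n \<Rightarrow> 'n mono"
    using that by induction (simp_all add: mult_single)
  have "(\<Sum>j\<in>UNIV. Poly_Mapping.single j (lkp m j)) = m"
    by (rule poly_mapping_eqI) (simp add: lookup_sum lookup_single when_def)
  then show ?thesis by (simp add: pw pr)
qed

lemma single_eq_prod: "Poly_Mapping.single m c = pconst c * (\<Prod>j\<in>UNIV. pvar j ^ lkp m j)"
  for m :: "'n::finite mono"
  by (simp add: mono_single_prod[symmetric] pconst_def mult_single)

text \<open>Used mainly to show that two ring homomorphisms agree modulo an ideal, which then has to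
  be checked on constants and variables only.\<close>

lemma cpoly_ring_induct [case_names const var add mult]:
  fixes f :: "'n::finite cpoly"
  assumes c: "\<And>c. P (pconst c)" and v: "\<And>j. P (pvar j)"
    and a: "\<And>f g. P f \<Longrightarrow> P g \<Longrightarrow> P (f + g)" and m: "\<And>f g. P f \<Longrightarrow> P g \<Longrightarrow> P (f * g)"
  shows "P f"
proof (induction f rule: cpoly_induct)
  case (single k c)
  have pw: "P (pvar j ^ k)" for j k
    by (induction k) (use c[of 1] v m in auto)
  have "P (\<Prod>j\<in>A. pvar j ^ lkp k j)" if "finite A" for A
    using that by induction (use pw c[of 1] m in auto)
  then show ?case by (simp add: single_eq_prod assms)
qed (rule a)

lemma lookup_pconst_mult: "lkp (pconst c * f) m = c * lkp f m"
proof (induction f rule: cpoly_induct)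
  case (single k y)
  then show ?case by (simp add: pconst_def mult_single lookup_single when_def)
qed (simp add: algebra_simps lookup_add)

section \<open>Total degree, homogeneous components and graded ideals\<close>

lemma mdeg_add [simp]: "mdeg (m + m') = mdeg m + mdeg m'"
  by (simp add: mdeg_def lookup_add sum.distrib)

lemma mdeg_0 [simp]: "mdeg 0 = 0"
  by (simp add: mdeg_def)

lemma mdeg_single [simp]: "mdeg (Poly_Mapping.single j k) = k"
  by (simp add: mdeg_def lookup_single when_def)

lemma mdeg_eq_0_iff: "mdeg m = 0 \<longleftrightarrow> m = 0"
  by (auto simp: mdeg_def intro!: poly_mapping_eqI)

lemma lookup_le_mdeg: "lkp m j \<le> mdeg m"
  unfolding mdeg_def by (rule member_le_sum) auto

lemma finite_mdeg_le: "finite {m :: 'n::finite mono. mdeg m \<le> k}"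
proof (rule finite_imageD)
  show "inj_on lkp {m :: 'n mono. mdeg m \<le> k}" by (auto intro!: inj_onI poly_mapping_eqI)
  have "lkp ` {m :: 'n mono. mdeg m \<le> k} \<subseteq> (\<Pi>\<^sub>E j\<in>UNIV. {..k})"
    using lookup_le_mdeg le_trans by (fastforce simp: PiE_def Pi_def)
  then show "finite (lkp ` {m :: 'n mono. mdeg m \<le> k})"
    by (rule finite_subset) (auto intro: finite_PiE)
qed

lemma hom_compI: "(\<And>m. lkp h m \<noteq> 0 \<Longrightarrow> int (mdeg m) = k) \<Longrightarrow> h \<in> hom_comp k"
  by (auto simp: hom_comp_def in_keys_iff)

lemma hom_compD: "h \<in> hom_comp k \<Longrightarrow> lkp h m \<noteq> 0 \<Longrightarrow> int (mdeg m) = k"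
  by (auto simp: hom_comp_def in_keys_iff)

lemma hom_comp_0 [simp]: "0 \<in> hom_comp k"
  by (simp add: hom_comp_def)

lemma hom_comp_add: "f \<in> hom_comp k \<Longrightarrow> g \<in> hom_comp k \<Longrightarrow> f + g \<in> hom_comp k"
  by (rule hom_compI) (metis add_0 hom_compD lookup_add)

lemma hom_comp_mult: "f \<in> hom_comp k \<Longrightarrow> g \<in> hom_comp l \<Longrightarrow> f * g \<in> hom_comp (k + l)"
  using keys_mult[of f g] by (force simp: hom_comp_def)

lemma hom_comp_pconst: "pconst c \<in> hom_comp 0"
  by (rule hom_compI) (auto simp: pconst_def lookup_single when_def split: if_splits)

lemma hom_comp_1 [simp]: "1 \<in> hom_comp 0"
  using hom_comp_pconst[of 1] by simp

lemma hom_comp_pvar: "pvar j \<in> hom_comp 1"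
  by (rule hom_compI) (auto simp: pvar_def lookup_single when_def split: if_splits)

lemma hom_comp_pscale: "f \<in> hom_comp k \<Longrightarrow> pscale c f \<in> hom_comp k"
  using hom_comp_mult[OF hom_comp_pconst] by (force simp: pscale_def)

lemma subspace_hom_comp [simp]: "pv.subspace (hom_comp k)"
  by (rule pv.subspaceI) (auto intro: hom_comp_add hom_comp_pscale)

lemma hom_comp_diff: "f \<in> hom_comp k \<Longrightarrow> g \<in> hom_comp k \<Longrightarrow> f - g \<in> hom_comp k"
  by (rule pv.subspace_diff) auto

lemma hom_comp_sum: "(\<And>x. x \<in> A \<Longrightarrow> f x \<in> hom_comp k) \<Longrightarrow> sum f A \<in> hom_comp k"
  by (rule pv.subspace_sum) auto

lemma hom_comp_power: "f \<in> hom_comp k \<Longrightarrow> f ^ i \<in> hom_comp (int i * k)"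
  by (induction i) (auto simp: algebra_simps dest: hom_comp_mult)

lemma hom_comp_neg: "k < 0 \<Longrightarrow> hom_comp k = {0}"
  using hom_compD by (fastforce intro!: poly_mapping_eqI)

lemma forms_mult: "f \<in> forms k \<Longrightarrow> g \<in> forms l \<Longrightarrow> f * g \<in> forms (k + l)"
  using hom_comp_mult by fastforce

lemma forms_power: "f \<in> forms k \<Longrightarrow> f ^ i \<in> forms (i * k)"
  using hom_comp_power by fastforce

lemma forms_pvar: "pvar j \<in> forms 1"
  using hom_comp_pvar by simp

lemma forms_0_const:
  assumes "f \<in> forms 0"
  obtains c where "f = pconst c"
proof (rule that[of "lkp f 0"], rule poly_mapping_eqI)
  fix m
  show "lkp f m = lkp (pconst (lkp f 0)) m"
    using hom_compD[OF assms, of m] by (auto simp: pconst_def lookup_single when_def mdeg_eq_0_iff)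
qed

definition hpart :: "nat \<Rightarrow> 'n::finite cpoly \<Rightarrow> 'n cpoly" where
  "hpart k h = (\<Sum>m\<in>{m \<in> Poly_Mapping.keys h. mdeg m = k}. Poly_Mapping.single m (lkp h m))"

lemma lookup_hpart: "lkp (hpart k h) m = (if mdeg m = k then lkp h m else 0)"
  unfolding hpart_def
  by (auto simp: lookup_sum lookup_single when_def sum.delta' in_keys_iff if_distrib cong: if_cong)

lemma hpart_in [simp]: "hpart k h \<in> forms k"
  by (rule hom_compI) (auto simp: lookup_hpart split: if_splits)

lemma hpart_add: "hpart k (f + g) = hpart k f + hpart k g"
  by (rule poly_mapping_eqI) (simp add: lookup_hpart lookup_add)

lemma hpart_0 [simp]: "hpart k 0 = 0"
  by (rule poly_mapping_eqI) (simp add: lookup_hpart)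

lemma hpart_diff: "hpart k (f - g) = hpart k f - hpart k g"
  by (rule poly_mapping_eqI) (simp add: lookup_hpart lookup_minus)

lemma hpart_sum: "hpart k (sum f A) = (\<Sum>x\<in>A. hpart k (f x))"
  by (induction A rule: infinite_finite_induct) (simp_all add: hpart_add)

lemma hpart_form: "f \<in> forms l \<Longrightarrow> hpart k f = (if k = l then f else 0)"
  by (rule poly_mapping_eqI) (auto simp: lookup_hpart dest: hom_compD)

definition pdeg :: "'n::finite cpoly \<Rightarrow> nat" where
  "pdeg h = (if h = 0 then 0 else Max (mdeg ` Poly_Mapping.keys h))"

lemma mdeg_le_pdeg: "m \<in> Poly_Mapping.keys h \<Longrightarrow> mdeg m \<le> pdeg h"
  unfolding pdeg_def by (auto intro!: Max_ge)

lemma hpart_eq_0: "pdeg h < k \<Longrightarrow> hpart k h = 0"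
  by (rule poly_mapping_eqI) (use mdeg_le_pdeg in \<open>fastforce simp: lookup_hpart in_keys_iff\<close>)

lemma sum_hpart:
  assumes "pdeg h \<le> n"
  shows "(\<Sum>k\<le>n. hpart k h) = h"
proof (rule poly_mapping_eqI)
  fix m
  have "(\<Sum>k\<le>n. if mdeg m = k then lkp h m else 0) = (if mdeg m \<le> n then lkp h m else 0)"
    by (simp add: sum.delta')
  moreover have "lkp h m = 0" if "\<not> mdeg m \<le> n"
    using that assms mdeg_le_pdeg[of m h] by (auto simp: in_keys_iff)
  ultimately show "lkp (\<Sum>k\<le>n. hpart k h) m = lkp h m" by (auto simp: lookup_sum lookup_hpart)
qed

lemma hpart_mult_form:
  assumes "g \<in> forms a"
  shows "hpart k (f * g) = (if a \<le> k then hpart (k - a) f * g else 0)"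
proof -
  let ?n = "max (pdeg f) k"
  have "f * g = (\<Sum>i\<le>?n. hpart i f * g)"
    using sum_hpart[of f ?n] by (simp flip: sum_distrib_right)
  then have "hpart k (f * g) = (\<Sum>i\<le>?n. hpart k (hpart i f * g))"
    by (simp add: hpart_sum)
  also have "\<dots> = (\<Sum>i\<le>?n. if k = i + a then hpart i f * g else 0)"
    using hpart_form[OF forms_mult[OF hpart_in assms]] by simp
  also have "\<dots> = (\<Sum>i\<in>{..?n}. if a \<le> k \<and> i = k - a then hpart i f * g else 0)"
    by (rule sum.cong) auto
  also have "\<dots> = (if a \<le> k then hpart (k - a) f * g else 0)"
    by auto
  finally show ?thesis .
qed

definition graded :: "'n::finite cpoly set \<Rightarrow> bool" where
  "graded I \<longleftrightarrow> pid.subspace I \<and> (\<forall>h\<in>I. \<forall>k. hpart k h \<in> I)"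

lemma graded_hpart: "graded I \<Longrightarrow> h \<in> I \<Longrightarrow> hpart k h \<in> I"
  by (simp add: graded_def)

lemma graded_pideal:
  assumes "\<And>g. g \<in> G \<Longrightarrow> \<exists>a. g \<in> forms a"
  shows "graded (pideal G)"
  unfolding graded_def
proof (intro conjI ballI allI)
  fix h k assume "h \<in> pideal G"
  then show "hpart k h \<in> pideal G"
    unfolding pideal_def
  proof (induction h rule: pid.span_induct_alt)
    case (step c g y)
    then obtain a where "g \<in> forms a" using assms by blast
    then have "hpart k (c * g) = (if a \<le> k then hpart (k - a) c else 0) * g"
      by (simp add: hpart_mult_form)
    with step show ?case by (simp add: hpart_add pid.span_add pid.span_scale pid.span_base)
  qed (simp add: pid.span_zero)
qed simp

text \<open>Taking the component of degree \<open>k\<close> of a relation \<open>x - b * h\<close>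
  makes the coefficient a form; below degree \<open>e\<close> there is no room for a multiple of
  \<open>h\<close>.\<close>

lemma form_pideal_insert:
  assumes G: "graded (pideal G)" and h: "h \<in> forms e" and x: "x \<in> forms k" "x \<in> pideal (insert h G)"
  obtains a where "e \<le> k" "a \<in> forms (k - e)" "x - a * h \<in> pideal G"
  | "k < e" "x \<in> pideal G"
proof -
  obtain b where "x - b * h \<in> pideal G" using x pideal_insert by blast
  from graded_hpart[OF G this, of k]
  have *: "x - (if e \<le> k then hpart (k - e) b * h else 0) \<in> pideal G"
    by (simp add: hpart_diff hpart_form[OF x(1)] hpart_mult_form[OF h])
  show ?thesis
  proof (cases "e \<le> k")
    case True
    from * show ?thesis using True by (intro that(1)[OF True hpart_in[of "k - e" b]]) simp
  next
    case False
    then show ?thesis using * that(2) by simp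
  qed
qed

lemma has_qdim_forms:
  assumes W: "pv.subspace W" "W \<subseteq> hom_comp k"
  shows "\<exists>n. has_qdim pscale (hom_comp k :: 'n::finite cpoly set) W n"
proof -
  let ?M = "{m :: 'n mono. int (mdeg m) = k}"
  have fin: "finite ?M" by (rule finite_subset[OF _ finite_mdeg_le[of "nat k"]]) auto
  obtain e :: "nat \<Rightarrow> 'n mono" where e: "bij_betw e {..<card ?M} ?M"
    using ex_bij_betw_nat_finite[OF fin] by (auto simp: atLeast0LessThan)
  have "\<exists>n\<le>card ?M. has_qdim pscale (hom_comp k) W n"
  proof (rule pv.has_qdim_spanning[OF subspace_hom_comp W, where b = "\<lambda>i. Poly_Mapping.single (e i) 1"])
    fix i assume "i < card ?M"
    then have "int (mdeg (e i)) = k" using e bij_betwE by blast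
    then show "Poly_Mapping.single (e i) 1 \<in> hom_comp k"
      by (intro hom_compI) (auto simp: lookup_single when_def split: if_splits)
  next
    fix f :: "'n cpoly" assume f: "f \<in> hom_comp k"
    have "(\<Sum>i<card ?M. pscale (lkp f (e i)) (Poly_Mapping.single (e i) 1)) =
        (\<Sum>m\<in>?M. Poly_Mapping.single m (lkp f m))"
      using sum.reindex_bij_betw[OF e, of "\<lambda>m. Poly_Mapping.single m (lkp f m)"]
      by (simp add: pscale_def pconst_def mult_single)
    also have "\<dots> = f"
      by (subst (2) sum_monomials, rule sum.mono_neutral_right[OF fin])
        (use f in \<open>auto simp: hom_comp_def in_keys_iff\<close>)
    finally show "\<exists>c. f - (\<Sum>i<card ?M. pscale (c i) (Poly_Mapping.single (e i) 1)) \<in> W"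
      using pv.subspace_0[OF W(1)] by (intro exI[of _ "\<lambda>i. lkp f (e i)"]) simp
  qed
  then show ?thesis by blast
qed

lemma peval_form_scale:
  assumes "f \<in> forms k"
  shows "peval f (c *s v) = c ^ k * peval f v"
proof -
  have "lkp f m * (\<Prod>j\<in>UNIV. (c *s v) $ j ^ lkp m j) = c ^ k * (lkp f m * (\<Prod>j\<in>UNIV. v $ j ^ lkp m j))"
    if "m \<in> Poly_Mapping.keys f" for m
  proof -
    have "mdeg m = k" using assms that by (auto simp: hom_comp_def)
    then have "(\<Prod>j\<in>UNIV. c ^ lkp m j) = c ^ k" by (simp add: mdeg_def flip: power_sum)
    then show ?thesis by (simp add: power_mult_distrib prod.distrib)
  qed
  then show ?thesis unfolding peval_def sum_distrib_left by (rule sum.cong[OF refl])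
qed

lemma peval_ideal:
  assumes "h \<in> pideal G" "\<And>g. g \<in> G \<Longrightarrow> peval g v = 0"
  shows "peval h v = 0"
  using assms(1) unfolding pideal_def
  by (induction h rule: pid.span_induct_alt) (simp_all add: assms(2))

section \<open>The Nullstellensatz for forms\<close>

text \<open>Modulo \<open>J\<close> the components of \<open>c\<close> vanish below degree \<open>t\<close> and then satisfy
  \<open>c\<^sub>t = - p\<close> and \<open>c\<^sub>k = g c\<^bsub>k-b\<^esub>\<close>, so that \<open>c\<close> being a polynomial forces \<open>g\<^sup>M p \<in> J\<close>.\<close>

lemma dehomogenize:
  fixes J :: "'n::finite cpoly set"
  assumes J: "graded J" and g: "g \<in> forms b" "b \<ge> 1" and p: "p \<in> forms t"
    and eq: "p - c * (g - 1) \<in> J"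
  shows "\<exists>M. g ^ M * p \<in> J"
proof -
  have sJ: "pid.subspace J" using J by (simp add: graded_def)
  have comp: "hpart k p - (if b \<le> k then hpart (k - b) c * g else 0) + hpart k c \<in> J" for k
  proof -
    have "p - c * (g - 1) = p - c * g + c" by (simp add: algebra_simps)
    with graded_hpart[OF J eq, of k] show ?thesis
      by (simp add: hpart_diff hpart_add hpart_mult_form[OF g(1)])
  qed
  have low: "hpart k c \<in> J" if "k < t" for k
    using that
  proof (induction k rule: less_induct)
    case (less k)
    have *: "(if b \<le> k then hpart (k - b) c * g else 0) \<in> J"
      using less g(2) pid.subspace_scale[OF sJ, of "hpart (k - b) c" g] pid.subspace_0[OF sJ]
      by (auto simp: mult.commute)
    from pid.subspace_add[OF sJ comp[of k] *] show ?case
      using less.prems by (simp add: hpart_form[OF p])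
  qed
  have high: "hpart (t + M * b) c + g ^ M * p \<in> J" for M
  proof (induction M)
    case 0
    have *: "(if b \<le> t then hpart (t - b) c * g else 0) \<in> J"
      using low[of "t - b"] g(2) pid.subspace_scale[OF sJ, of "hpart (t - b) c" g] pid.subspace_0[OF sJ]
      by (auto simp: mult.commute)
    from pid.subspace_add[OF sJ comp[of t] *] show ?case
      by (simp add: hpart_form[OF p] add.commute)
  next
    case (Suc M)
    have "t + Suc M * b - b = t + M * b" by simp
    with comp[of "t + Suc M * b"] g(2) have "hpart (t + Suc M * b) c - hpart (t + M * b) c * g \<in> J"
      by (simp add: hpart_form[OF p])
    from pid.subspace_add[OF sJ this pid.subspace_scale[OF sJ Suc, of g]] show ?case
      by (simp add: algebra_simps)
  qed
  have "pdeg c < t + Suc (pdeg c) * b" using g(2) by (cases b) auto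
  then have "g ^ Suc (pdeg c) * p \<in> J" using high[of "Suc (pdeg c)"] by (simp only: hpart_eq_0 add_0)
  then show ?thesis by blast
qed

lemma dehomogenize_pideal:
  fixes J :: "'n::finite cpoly set"
  assumes J: "graded J" and g: "g \<in> forms b" "b \<ge> 1" and p: "p \<in> forms t"
    and eq: "p \<in> pideal (insert (g - 1) J)"
  shows "\<exists>M. g ^ M * p \<in> J"
proof -
  have "pideal J = J" using J by (simp add: graded_def pideal_def)
  with eq obtain c where "p - c * (g - 1) \<in> J" by (auto simp: pideal_insert)
  with dehomogenize[OF J g p] show ?thesis by blast
qed

section \<open>Maximal ideals and the weak Nullstellensatz\<close>

lemma maximal_ideal_exists:
  fixes I :: "'n::finite cpoly set"
  assumes "pid.subspace I" "1 \<notin> I"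
  obtains M where "pid.subspace M" "I \<subseteq> M" "1 \<notin> M" "\<And>a. a \<notin> M \<Longrightarrow> \<exists>r. r * a - 1 \<in> M"
proof -
  define \<A> where "\<A> = {M. pid.subspace M \<and> I \<subseteq> M \<and> 1 \<notin> M}"
  have "\<exists>M\<in>\<A>. \<forall>X\<in>\<A>. M \<subseteq> X \<longrightarrow> X = M"
  proof (rule subset_Zorn_nonempty)
    show "\<A> \<noteq> {}" using assms by (auto simp: \<A>_def)
    fix C assume C: "C \<noteq> {}" "subset.chain \<A> C"
    have CA: "X \<in> \<A>" if "X \<in> C" for X using C(2) that by (auto simp: subset_chain_def)
    have sub: "pid.subspace X" if "X \<in> C" for X using CA[OF that] by (simp add: \<A>_def)
    have "pid.subspace (\<Union>C)"
    proof (rule pid.subspaceI)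
      show "0 \<in> \<Union>C" using C(1) sub pid.subspace_0 by blast
      show "c * x \<in> \<Union>C" if "x \<in> \<Union>C" for c x using that sub pid.subspace_scale by blast
      fix x y assume "x \<in> \<Union>C" "y \<in> \<Union>C"
      then obtain X Y where XY: "X \<in> C" "Y \<in> C" "x \<in> X" "y \<in> Y" by blast
      then have "X \<subseteq> Y \<or> Y \<subseteq> X" using C(2) by (auto simp: subset_chain_def)
      then show "x + y \<in> \<Union>C" using XY sub pid.subspace_add by blast
    qed
    then show "\<Union>C \<in> \<A>" using C CA by (auto simp: \<A>_def)
  qed
  then obtain M where M: "M \<in> \<A>" "\<And>X. X \<in> \<A> \<Longrightarrow> M \<subseteq> X \<Longrightarrow> X = M" by blast
  have sM: "pid.subspace M" using M(1) by (simp add: \<A>_def)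
  have "\<exists>r. r * a - 1 \<in> M" if a: "a \<notin> M" for a
  proof -
    let ?X = "pideal (insert a M)"
    have MX: "M \<subseteq> ?X" "a \<in> ?X" by (auto intro: pideal_base)
    have "1 \<in> ?X"
    proof (rule ccontr)
      assume "1 \<notin> ?X"
      then have "?X \<in> \<A>" using MX M(1) by (auto simp: \<A>_def)
      with M(2) MX a show False by blast
    qed
    then obtain r where "1 - r * a \<in> pideal M" by (auto simp: pideal_insert)
    moreover have "pideal M = M" using sM by (simp add: pideal_def)
    ultimately have "1 - r * a \<in> M" by simp
    from pid.subspace_neg[OF sM this] show ?thesis by auto
  qed
  with M(1) show ?thesis by (intro that[of M]) (auto simp: \<A>_def)
qed

definition upoly :: "'n::finite \<Rightarrow> complex poly \<Rightarrow> 'n cpoly" where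
  "upoly j p = poly (map_poly pconst p) (pvar j)"

lemma upoly_pCons: "upoly j (pCons a p) = pconst a + pvar j * upoly j p"
  by (simp add: upoly_def map_poly_pCons)

lemma upoly_0 [simp]: "upoly j 0 = 0"
  by (simp add: upoly_def)

lemma upoly_add: "upoly j (p + q) = upoly j p + upoly j q"
  by (induction p q rule: poly_induct2) (simp_all add: upoly_pCons pconst_add algebra_simps)

lemma upoly_smult: "upoly j (smult a p) = pconst a * upoly j p"
  by (induction p) (simp_all add: upoly_pCons pconst_mult algebra_simps)

lemma upoly_mult: "upoly j (p * q) = upoly j p * upoly j q"
  by (induction p) (simp_all add: upoly_pCons upoly_add upoly_smult algebra_simps)

lemma upoly_1: "upoly j 1 = 1"
  unfolding one_pCons upoly_pCons by simp

lemma upoly_sum: "upoly j (\<Sum>x\<in>A. f x) = (\<Sum>x\<in>A. upoly j (f x))"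
  by (induction A rule: infinite_finite_induct) (simp_all add: upoly_add)

lemma upoly_prod: "upoly j (\<Prod>x\<in>A. f x) = (\<Prod>x\<in>A. upoly j (f x))"
  by (induction A rule: infinite_finite_induct) (simp_all add: upoly_mult upoly_1)

lemma upoly_linear: "upoly j [:-c, 1:] = pvar j - pconst c"
  by (simp add: upoly_pCons pconst_minus)

text \<open>A field of countable dimension over the uncountable field of complex numbers is algebraic:
  otherwise the inverses of the elements \<open>x\<^sub>j - c\<close> would be linearly independent.\<close>

lemma maximal_ideal_coordinate:
  fixes M :: "'n::finite cpoly set"
  assumes M: "pid.subspace M" "1 \<notin> M" and max: "\<And>a. a \<notin> M \<Longrightarrow> \<exists>r. r * a - 1 \<in> M"
  shows "\<exists>c. pvar j - pconst c \<in> M"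
proof (rule ccontr)
  assume no: "\<not> ?thesis"
  have prime: "b \<in> M" if "a * b \<in> M" "a \<notin> M" for a b
  proof -
    obtain r where "r * a - 1 \<in> M" using max \<open>a \<notin> M\<close> by blast
    from pid.subspace_diff[OF M(1) pid.subspace_scale[OF M(1) that(1), of r] pid.subspace_scale[OF M(1) this, of b]]
    show ?thesis by (simp add: algebra_simps)
  qed
  \<comment> \<open>By the fundamental theorem of algebra \<open>p\<close> splits into linear
    factors, none of which lies in the prime ideal \<open>M\<close>.\<close>
  have nz: "upoly j p \<notin> M" if "p \<noteq> 0" for p
    using that
  proof (induction "degree p" arbitrary: p)
    case 0
    then obtain a where a: "p = [:a:]" "a \<noteq> 0" by (metis degree_eq_zeroE pCons_eq_0_iff)
    show ?case
    proof
      assume "upoly j p \<in> M"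
      from pid.subspace_scale[OF M(1) this, of "pconst (inverse a)"] M(2) a show False
        by (simp add: upoly_pCons flip: pconst_mult)
    qed
  next
    case (Suc n)
    have "\<not> constant (poly p)" using Suc.hyps(2) by (simp add: constant_degree)
    then obtain z where "poly p z = 0" using fundamental_theorem_of_algebra by blast
    then obtain q where q: "p = [:-z, 1:] * q" by (metis poly_eq_0_iff_dvd dvdE)
    with Suc.prems have "q \<noteq> 0" by auto
    then have "degree p = Suc (degree q)" unfolding q by (subst degree_mult_eq) auto
    with Suc \<open>q \<noteq> 0\<close> have "upoly j q \<notin> M" by simp
    moreover have "upoly j p = (pvar j - pconst z) * upoly j q"
      unfolding q upoly_mult upoly_linear ..
    ultimately show ?case using prime no by metis
  qed
  have "\<forall>c. \<exists>r. r * (pvar j - pconst c) - 1 \<in> M" using no max by blast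
  then obtain r where r: "\<And>c. r c * (pvar j - pconst c) - 1 \<in> M" by metis
  \<comment> \<open>Uncountably many inverses are distributed over countably many degrees, so
    infinitely many lie in one finite-dimensional space of polynomials of bounded degree and some of
    them are linearly dependent.\<close>
  have "\<exists>N. infinite {c. pdeg (r c) = N}"
  proof (rule ccontr)
    assume "\<not> ?thesis"
    then have "countable (\<Union>N. {c. pdeg (r c) = N})" by (auto intro: countable_finite)
    moreover have "(\<Union>N. {c. pdeg (r c) = N}) = UNIV" by auto
    ultimately show False using uncountable_UNIV_complex by simp
  qed
  then obtain N where N: "infinite {c. pdeg (r c) = N}" by blast
  let ?B = "{m :: 'n mono. mdeg m \<le> N}"
  obtain e :: "nat \<Rightarrow> 'n mono" where e: "bij_betw e {..<card ?B} ?B"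
    using ex_bij_betw_nat_finite[OF finite_mdeg_le[of N]] by (auto simp: atLeast0LessThan)
  obtain F where F: "finite F" "card F = Suc (card ?B)" "F \<subseteq> {c. pdeg (r c) = N}"
    using infinite_arbitrarily_large[OF N] by metis
  obtain a where a: "\<exists>c\<in>F. a c \<noteq> 0" "\<And>i. i < card ?B \<Longrightarrow> (\<Sum>c\<in>F. a c * lkp (r c) (e i)) = 0"
    using homogeneous_system_solution[OF F(1), of "card ?B" "\<lambda>c i. lkp (r c) (e i)"] F(2) by auto
  have r0: "(\<Sum>c\<in>F. pconst (a c) * r c) = 0"
  proof (rule poly_mapping_eqI)
    fix m
    have "(\<Sum>c\<in>F. a c * lkp (r c) m) = 0"
    proof (cases "mdeg m \<le> N")
      case True
      then obtain i where "i < card ?B" "e i = m" using e unfolding bij_betw_def by force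
      with a(2) show ?thesis by blast
    next
      case False
      have "lkp (r c) m = 0" if "c \<in> F" for c
        using False F(3) that mdeg_le_pdeg[of m "r c"] by (auto simp: in_keys_iff)
      then show ?thesis by simp
    qed
    then show "lkp (\<Sum>c\<in>F. pconst (a c) * r c) m = lkp 0 m" by (simp add: lookup_sum lookup_pconst_mult)
  qed
  \<comment> \<open>\<open>P\<close> is the numerator obtained by clearing denominators in the
    relation with coefficients \<open>a c\<close> between the fractions \<open>1 / (x - c)\<close>;
    since \<open>r c\<close> inverts \<open>x - c\<close> modulo \<open>M\<close>,
    \<open>upoly j P\<close> lies in \<open>M\<close>.\<close>
  define P where "P = (\<Sum>c\<in>F. smult (a c) (\<Prod>c'\<in>F - {c}. [:-c', 1:]))"
  define X where "X A = (\<Prod>c\<in>A. pvar j - pconst c :: 'n cpoly)" for A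
  have "upoly j P = (\<Sum>c\<in>F. pconst (a c) * X (F - {c}))"
    by (simp only: P_def X_def upoly_sum upoly_smult upoly_prod upoly_linear)
  also have "\<dots> = (\<Sum>c\<in>F. pconst (a c) * X (F - {c})) - (\<Sum>c\<in>F. pconst (a c) * r c) * X F"
    by (simp add: r0)
  also have "\<dots> = (\<Sum>c\<in>F. - (pconst (a c) * X (F - {c})) * (r c * (pvar j - pconst c) - 1))"
  proof -
    have XF: "X F = (pvar j - pconst c) * X (F - {c})" if "c \<in> F" for c
      unfolding X_def using prod.remove[OF F(1) that] by simp
    show ?thesis
      unfolding sum_distrib_right sum_subtractf[symmetric]
      by (rule sum.cong[OF refl], subst XF, assumption) (simp add: algebra_simps)
  qed
  also have "\<dots> \<in> M"
    by (intro pid.subspace_sum[OF M(1)] pid.subspace_scale[OF M(1)] r)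
  finally have "P = 0" using nz by blast
  obtain c where c: "c \<in> F" "a c \<noteq> 0" using a(1) by blast
  \<comment> \<open>At \<open>c\<close> only the summand belonging to \<open>c\<close> survives, so
    \<open>P\<close> is not zero.\<close>
  have "poly P c = (\<Sum>c'\<in>F. if c' = c then a c * (\<Prod>c'\<in>F - {c}. c - c') else 0)"
    unfolding P_def poly_sum
  proof (rule sum.cong[OF refl])
    fix c' assume "c' \<in> F"
    show "poly (smult (a c') (\<Prod>c'\<in>F - {c'}. [:-c', 1:])) c = (if c' = c then a c * (\<Prod>c'\<in>F - {c}. c - c') else 0)"
    proof (cases "c' = c")
      case False
      then have "(\<Prod>x\<in>F - {c'}. c - x) = 0" using c F(1) by (intro prod_zero) auto
      then show ?thesis using False by (simp add: poly_prod)
    qed (simp add: poly_prod)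
  qed
  also have "\<dots> = a c * (\<Prod>c'\<in>F - {c}. c - c')" using c F(1) by simp
  also have "\<dots> \<noteq> 0" using c F(1) by auto
  finally show False using \<open>P = 0\<close> by simp
qed

text \<open>Modulo a maximal ideal each variable is a constant; these constants are the coordinates
  of a zero \<open>v\<close>, and every \<open>p\<close> is congruent to its value at
  \<open>v\<close>.\<close>

lemma weak_nullstellensatz:
  fixes I :: "'n::finite cpoly set"
  assumes "pid.subspace I" "1 \<notin> I"
  shows "\<exists>v. \<forall>p\<in>I. peval p v = 0"
proof -
  obtain M where M: "pid.subspace M" "I \<subseteq> M" "1 \<notin> M" and max: "\<And>a. a \<notin> M \<Longrightarrow> \<exists>r. r * a - 1 \<in> M"
    using maximal_ideal_exists[OF assms] by blast
  have "\<forall>j. \<exists>c. pvar j - pconst c \<in> M"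
    using maximal_ideal_coordinate[OF M(1,3) max] by blast
  then obtain c where c: "\<And>j. pvar j - pconst (c j) \<in> M" by metis
  define v where "v = (\<chi> j. c j)"
  have red: "p - pconst (peval p v) \<in> M" for p
  proof (induction p rule: cpoly_ring_induct)
    case (const a)
    then show ?case using pid.subspace_0[OF M(1)] by simp
  next
    case (var j)
    then show ?case using c by (simp add: v_def)
  next
    case (add f g)
    from pid.subspace_add[OF M(1) add] show ?case by (simp add: pconst_add algebra_simps)
  next
    case (mult f g)
    from pid.subspace_add[OF M(1) pid.subspace_scale[OF M(1) mult(1), of g]
        pid.subspace_scale[OF M(1) mult(2), of "pconst (peval f v)"]]
    show ?case by (simp add: pconst_mult algebra_simps)
  qed
  have "peval p v = 0" if "p \<in> I" for p
  proof (rule ccontr)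
    assume nz: "peval p v \<noteq> 0"
    have "pconst (peval p v) \<in> M"
      using pid.subspace_diff[OF M(1) _ red[of p], of p] that M(2) by auto
    from pid.subspace_scale[OF M(1) this, of "pconst (inverse (peval p v))"] nz M(3)
    show False by (simp flip: pconst_mult)
  qed
  then show ?thesis by blast
qed

text \<open>A graded version of Rabinowitsch's trick: the relation \<open>g = 1\<close> is adjoined
  to \<open>J\<close>, which leaves no zeros, and \<open>dehomogenize_pideal\<close> with
  \<open>p = 1\<close> converts the resulting unit ideal into a power of \<open>g\<close>.\<close>

lemma nullstellensatz_form:
  fixes J :: "'n::finite cpoly set"
  assumes J: "graded J" and g: "g \<in> forms b" "b \<ge> 1"
    and van: "\<And>v. (\<And>p. p \<in> J \<Longrightarrow> peval p v = 0) \<Longrightarrow> peval g v = 0"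
  shows "\<exists>M. g ^ M \<in> J"
proof -
  have "1 \<in> pideal (insert (g - 1) J)"
  proof (rule ccontr)
    assume "1 \<notin> pideal (insert (g - 1) J)"
    then obtain v where v: "\<And>p. p \<in> pideal (insert (g - 1) J) \<Longrightarrow> peval p v = 0"
      using weak_nullstellensatz[OF subspace_pideal] by blast
    have "peval (g - 1) v = 0" by (rule v) (simp add: pideal_base)
    moreover have "peval g v = 0" by (rule van, rule v) (simp add: pideal_base)
    ultimately show False by simp
  qed
  from dehomogenize_pideal[OF J g _ this, of 0] show ?thesis by simp
qed

text \<open>Pigeonhole: some exponent reaches \<open>M\<close>. The \<open>y j\<close> are general
  because they are taken to be the variables as well as products of a separating form with local
  coordinates.\<close>

lemma monomials_cofinite:
  fixes J :: "'n::finite cpoly set" and y :: "'n \<Rightarrow> 'n cpoly"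
  assumes J: "pid.subspace J" and y: "\<And>j. y j ^ M \<in> J" and m: "mdeg m \<ge> CARD('n) * M"
  shows "(\<Prod>j\<in>UNIV. y j ^ lkp m j) \<in> J"
proof -
  have "\<exists>j. lkp m j \<ge> M"
  proof (rule ccontr)
    assume "\<not> ?thesis"
    then have lt: "\<And>j. lkp m j < M" by (auto simp: not_le)
    have "mdeg m < (\<Sum>j\<in>(UNIV :: 'n set). M)"
      unfolding mdeg_def by (rule sum_strict_mono) (use lt in auto)
    with m show False by simp
  qed
  then obtain j where j: "lkp m j \<ge> M" by blast
  have "(\<Prod>j\<in>UNIV. y j ^ lkp m j) = y j ^ lkp m j * (\<Prod>i\<in>UNIV - {j}. y i ^ lkp m i)"
    by (rule prod.remove) auto
  also have "\<dots> = (y j ^ (lkp m j - M) * (\<Prod>i\<in>UNIV - {j}. y i ^ lkp m i)) * y j ^ M"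
  proof -
    have "y j ^ lkp m j = y j ^ (lkp m j - M) * y j ^ M" using j by (simp flip: power_add)
    then show ?thesis by (simp only: mult_ac)
  qed
  also have "\<dots> \<in> J" by (rule pid.subspace_scale[OF J y])
  finally show ?thesis .
qed

text \<open>Every variable has a power in \<open>J\<close> by the Nullstellensatz, and a maximum
  over the variables gives a common exponent.\<close>

lemma cofinite_if_no_zeros:
  fixes J :: "'n::finite cpoly set"
  assumes J: "graded J" and van: "\<And>v. (\<And>p. p \<in> J \<Longrightarrow> peval p v = 0) \<Longrightarrow> v = 0"
  shows "\<exists>N. \<forall>k\<ge>N. forms k \<subseteq> J"
proof -
  have sJ: "pid.subspace J" using J by (simp add: graded_def)
  have "\<exists>M. pvar j ^ M \<in> J" for j :: 'n
    by (rule nullstellensatz_form[OF J forms_pvar]) (use van in force)+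
  then obtain M where M: "\<And>j :: 'n. pvar j ^ M j \<in> J" by metis
  define M0 where "M0 = Max (range M)"
  have M0: "pvar j ^ M0 \<in> J" for j :: 'n
  proof -
    have "M j \<le> M0" unfolding M0_def by (rule Max_ge) auto
    then have "pvar j ^ M0 = pvar j ^ (M0 - M j) * pvar j ^ M j" by (simp flip: power_add)
    then show ?thesis using pid.subspace_scale[OF sJ M] by metis
  qed
  have "forms k \<subseteq> J" if k: "k \<ge> CARD('n) * M0" for k
  proof
    fix f :: "'n cpoly" assume f: "f \<in> forms k"
    have "Poly_Mapping.single m (lkp f m) \<in> J" if "m \<in> Poly_Mapping.keys f" for m
    proof -
      have "mdeg m = k" using f that by (auto simp: hom_comp_def)
      then have "(\<Prod>j\<in>UNIV. pvar j ^ lkp m j) \<in> J" using monomials_cofinite[of J pvar M0 m, OF sJ M0] k by simp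
      then show ?thesis unfolding single_eq_prod by (rule pid.subspace_scale[OF sJ])
    qed
    then show "f \<in> J" by (subst sum_monomials) (rule pid.subspace_sum[OF sJ])
  qed
  then show ?thesis by blast
qed

section \<open>Complete intersections\<close>

definition hilb :: "'n::finite cpoly set \<Rightarrow> int \<Rightarrow> nat" where
  "hilb I k = quot_dim pscale (hom_comp k) (I \<inter> hom_comp k)"

lemma has_qdim_hilb:
  assumes "pv.subspace I"
  shows "has_qdim pscale (hom_comp k) (I \<inter> hom_comp k) (hilb I k)"
proof -
  have s: "pv.subspace (I \<inter> hom_comp k)" using assms by (intro pv.subspace_inter) auto
  obtain n where n: "has_qdim pscale (hom_comp k) (I \<inter> hom_comp k) n" using has_qdim_forms[OF s] by auto
  from pv.quot_dim_eq[OF this s] n show ?thesis by (simp add: hilb_def)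
qed

lemma hilb_eqI: "has_qdim pscale (hom_comp k) (I \<inter> hom_comp k) n \<Longrightarrow> pv.subspace I \<Longrightarrow> hilb I k = n"
  unfolding hilb_def by (rule pv.quot_dim_eq) (auto intro: pv.subspace_inter)

lemma has_qdim_mult:
  assumes "pv.subspace V" "pv.subspace W'"
    and "\<And>v. v \<in> V \<Longrightarrow> p * v \<in> V'" "\<And>v. v \<in> V \<Longrightarrow> p * v \<in> W' \<longleftrightarrow> v \<in> W"
    and "\<And>v'. v' \<in> V' \<Longrightarrow> \<exists>v\<in>V. v' - p * v \<in> W'"
  shows "has_qdim pscale V W n \<longleftrightarrow> has_qdim pscale V' W' n"
  using assms by (intro has_qdim_transfer[OF linear_mult[of p]]) auto

definition cofinite_ideal :: "'n::finite cpoly set \<Rightarrow> bool" where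
  "cofinite_ideal I \<longleftrightarrow> (\<exists>N. \<forall>k\<ge>N. forms k \<subseteq> I)"

definition nonzerodivisor :: "'n::finite cpoly \<Rightarrow> 'n cpoly set \<Rightarrow> bool" where
  "nonzerodivisor p I \<longleftrightarrow> (\<forall>y. p * y \<in> I \<longrightarrow> y \<in> I)"

text \<open>For a cofinite ideal this is the Gorenstein property, with socle degree
  \<open>s\<close>. Only homogeneous \<open>y\<close> are tested, but in every degree.\<close>

definition simple_socle :: "'n::finite cpoly set \<Rightarrow> nat \<Rightarrow> bool" where
  "simple_socle I s \<longleftrightarrow> (\<exists>u\<in>forms s. u \<notin> I \<and> (\<forall>i. pvar i * u \<in> I) \<and>
     (\<forall>k. \<forall>y\<in>forms k. (\<forall>i. pvar i * y \<in> I) \<longrightarrow> (\<exists>c. y - pscale c u \<in> I)))"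

text \<open>A regular sequence in any order, with any subset of the members; this symmetric form
  allows a member to be exchanged at an arbitrary position.\<close>

definition regular_family :: "('n::finite \<Rightarrow> 'n cpoly) \<Rightarrow> bool" where
  "regular_family q \<longleftrightarrow> (\<forall>R r. r \<notin> R \<longrightarrow> nonzerodivisor (q r) (pideal (q ` R)))"

definition complete_intersection :: "('n::finite \<Rightarrow> 'n cpoly) \<Rightarrow> nat \<Rightarrow> bool" where
  "complete_intersection q s \<longleftrightarrow> (\<forall>i. \<exists>a\<ge>1. q i \<in> forms a) \<and> regular_family q \<and>
     cofinite_ideal (pideal (range q)) \<and> simple_socle (pideal (range q)) s"

lemma nonzerodivisorD: "nonzerodivisor p I \<Longrightarrow> p * y \<in> I \<Longrightarrow> y \<in> I"
  by (simp add: nonzerodivisor_def)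

lemma nonzerodivisor_power: "nonzerodivisor p I \<Longrightarrow> nonzerodivisor (p ^ k) I"
proof (induction k)
  case (Suc k)
  show ?case unfolding nonzerodivisor_def
  proof (intro allI impI)
    fix y assume "p ^ Suc k * y \<in> I"
    then have "p * (p ^ k * y) \<in> I" by (simp add: mult.assoc)
    from nonzerodivisorD[OF Suc.prems this] show "y \<in> I"
      using nonzerodivisorD[OF Suc.IH[OF Suc.prems]] by blast
  qed
qed (simp add: nonzerodivisor_def)

lemma form_pideal_insertE:
  assumes "graded (pideal G)" "h \<in> forms e" "x \<in> forms k" "x \<in> pideal (insert h G)" "e \<le> k"
  obtains a where "a \<in> forms (k - e)" "x - h * a \<in> pideal G"
  using form_pideal_insert[OF assms(1-4)]
proof cases
  case (1 a)
  show ?thesis by (rule that[OF 1(2)]) (use 1(3) in \<open>simp add: mult.commute\<close>)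
qed (use assms(5) in simp)

section \<open>Exchange of a non-zero-divisor by Hilbert functions\<close>

text \<open>Multiplication by \<open>p\<close> is injective on the quotient, and onto in degree
  \<open>m + b\<close> because all forms of that degree lie in the larger ideal.\<close>

lemma hilb_add_nonzerodivisor:
  assumes G: "graded (pideal G)" and p: "p \<in> forms b" "nonzerodivisor p (pideal G)"
    and m: "forms (m + b) \<subseteq> pideal (insert p G)"
  shows "hilb (pideal G) (int (m + b)) = hilb (pideal G) (int m)"
proof (rule hilb_eqI)
  have "has_qdim pscale (forms m) (pideal G \<inter> forms m) n \<longleftrightarrow>
    has_qdim pscale (forms (m + b)) (pideal G \<inter> forms (m + b)) n" for n
  proof (rule has_qdim_mult[where p = p])
    fix v :: "'a cpoly" assume v: "v \<in> forms m"
    show pv: "p * v \<in> forms (m + b)" using forms_mult[OF p(1) v] by (simp add: add.commute)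
    show "p * v \<in> pideal G \<inter> forms (m + b) \<longleftrightarrow> v \<in> pideal G \<inter> forms m"
      using pv v p(2) pideal_mult by (auto simp: nonzerodivisor_def)
  next
    fix x :: "'a cpoly" assume x: "x \<in> forms (m + b)"
    with m have "x \<in> pideal (insert p G)" by blast
    from form_pideal_insertE[OF G p(1) x this le_add2] obtain a where a: "a \<in> forms m" "x - p * a \<in> pideal G"
      unfolding add_diff_cancel_right' .
    have "x - p * a \<in> forms (m + b)"
      using hom_comp_diff[OF x] forms_mult[OF p(1) a(1)] by (simp add: add.commute)
    with a show "\<exists>v\<in>forms m. x - p * v \<in> pideal G \<inter> forms (m + b)" by blast
  qed (auto intro: pv.subspace_inter)
  then show "has_qdim pscale (forms (m + b)) (pideal G \<inter> forms (m + b)) (hilb (pideal G) (int m))"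
    using has_qdim_hilb[of "pideal G"] by auto
qed simp

lemma hilb_periodic:
  assumes G: "graded (pideal G)" and p: "p \<in> forms b" "nonzerodivisor p (pideal G)"
    and N: "\<And>k. k \<ge> N \<Longrightarrow> forms k \<subseteq> pideal (insert p G)" and m: "m \<ge> N"
  shows "hilb (pideal G) (int (m + t * b)) = hilb (pideal G) (int m)"
proof (induction t)
  case (Suc t)
  have "hilb (pideal G) (int (m + t * b + b)) = hilb (pideal G) (int (m + t * b))"
    by (rule hilb_add_nonzerodivisor[OF G p N]) (use m in simp)
  with Suc show ?case by (simp add: add_ac)
qed simp

lemma nonzerodivisor_on_forms:
  assumes G: "graded (pideal G)" and g: "g \<in> forms a"
    and nz: "\<And>k y. y \<in> forms k \<Longrightarrow> g * y \<in> pideal G \<Longrightarrow> y \<in> pideal G"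
  shows "nonzerodivisor g (pideal G)"
  unfolding nonzerodivisor_def
proof (intro allI impI)
  fix y assume y: "g * y \<in> pideal G"
  have "hpart k y \<in> pideal G" for k
  proof (rule nz[OF hpart_in])
    show "g * hpart k y \<in> pideal G"
      using graded_hpart[OF G y, of "k + a"] hpart_mult_form[OF g, of "k + a" y] by (simp add: mult.commute)
  qed
  then have "(\<Sum>k\<le>pdeg y. hpart k y) \<in> pideal G" by (rule pideal_sum)
  then show "y \<in> pideal G" by (simp add: sum_hpart)
qed

text \<open>In high degree multiplication by \<open>p\<close> is bijective and multiplication by \<open>g\<close> is surjective
  modulo the ideal, so the Hilbert function is periodic and nonincreasing, hence constant, along the
  degree of \<open>g\<close>; then \<open>g\<close> is injective in high degree.\<close>

lemma nonzerodivisor_exchange: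
  assumes G: "graded (pideal G)" and p: "p \<in> forms b" "b \<ge> 1" "nonzerodivisor p (pideal G)"
    and cp: "cofinite_ideal (pideal (insert p G))"
    and g: "g \<in> forms a" "a \<ge> 1" and cg: "cofinite_ideal (pideal (insert g G))"
  shows "nonzerodivisor g (pideal G)"
proof -
  let ?I = "pideal G"
  let ?H = "\<lambda>m. hilb ?I (int m)"
  obtain N1 N2 where N1: "\<And>k. k \<ge> N1 \<Longrightarrow> forms k \<subseteq> pideal (insert p G)"
    and N2: "\<And>k. k \<ge> N2 \<Longrightarrow> forms k \<subseteq> pideal (insert g G)"
    using cp cg unfolding cofinite_ideal_def by metis
  let ?W = "\<lambda>m. {y \<in> forms m. g * y \<in> ?I}"
  have qW: "has_qdim pscale (forms m) (?W m) (?H (m + a))" if m: "m \<ge> N2" for m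
  proof -
    have "has_qdim pscale (forms m) (?W m) n \<longleftrightarrow>
      has_qdim pscale (forms (m + a)) (?I \<inter> forms (m + a)) n" for n
    proof (rule has_qdim_mult[where p = g])
      fix v :: "'a cpoly" assume v: "v \<in> forms m"
      show gv: "g * v \<in> forms (m + a)" using forms_mult[OF g(1) v] by (simp add: add.commute)
      show "g * v \<in> ?I \<inter> forms (m + a) \<longleftrightarrow> v \<in> ?W m" using gv v by auto
    next
      fix x :: "'a cpoly" assume x: "x \<in> forms (m + a)"
      have "x \<in> pideal (insert g G)" using N2[of "m + a"] m x by auto
      from form_pideal_insertE[OF G g(1) x this le_add2] obtain y where y: "y \<in> forms m" "x - g * y \<in> ?I"
        unfolding add_diff_cancel_right' .
      have "x - g * y \<in> forms (m + a)"
        using hom_comp_diff[OF x] forms_mult[OF g(1) y(1)] by (simp add: add.commute)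
      with y show "\<exists>v\<in>forms m. x - g * v \<in> ?I \<inter> forms (m + a)" by blast
    qed (auto intro: pv.subspace_inter)
    then show ?thesis using has_qdim_hilb[of ?I] by auto
  qed
  have sW: "pv.subspace (?W m)" for m
  proof (rule pv.subspaceI)
    show "0 \<in> ?W m" by simp
    show "x + y \<in> ?W m" if "x \<in> ?W m" "y \<in> ?W m" for x y
      using that by (auto simp: distrib_left intro: hom_comp_add pideal_add)
    show "pscale c x \<in> ?W m" if "x \<in> ?W m" for c x
    proof -
      have "g * pscale c x = pconst c * (g * x)" by (simp add: pscale_def mult_ac)
      with that show ?thesis by (auto intro: hom_comp_pscale pideal_mult)
    qed
  qed
  have sI: "pv.subspace (?I \<inter> forms m)" for m by (intro pv.subspace_inter) auto
  have IW: "?I \<inter> forms m \<subseteq> ?W m" for m by (auto intro: pideal_mult)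
  \<comment> \<open>The number \<open>k\<close> is the dimension of the kernel of \<open>g\<close>
    on the quotient in degree \<open>m\<close>; it is what the Hilbert function loses from
    \<open>m\<close> to \<open>m + a\<close>.\<close>
  have split: "\<exists>k. has_qdim pscale (?W m) (?I \<inter> forms m) k \<and> ?H m = ?H (m + a) + k" if m: "m \<ge> N2" for m
  proof -
    have "\<exists>k\<le>?H m. has_qdim pscale (?W m) (?I \<inter> forms m) k"
      by (rule pv.has_qdim_sub[OF has_qdim_hilb subspace_hom_comp sI sW IW]) auto
    then obtain k where k: "has_qdim pscale (?W m) (?I \<inter> forms m) k" by blast
    have "has_qdim pscale (forms m) (?I \<inter> forms m) (?H (m + a) + k)"
      by (rule pv.has_qdim_add[OF qW[OF m] k _ IW sW]) auto
    from hilb_eqI[OF this] k show ?thesis by auto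
  qed
  have inj: "y \<in> ?I" if m: "m \<ge> max N1 N2" and y: "y \<in> forms m" "g * y \<in> ?I" for m y
  proof -
    have dec: "?H (m + t * a) \<le> ?H (m + a)" if "t \<ge> 1" for t
      using that
    proof (induction t rule: dec_induct)
      case (step t)
      obtain k where "?H (m + t * a) = ?H (m + t * a + a) + k"
        using split[of "m + t * a"] m by auto
      with step show ?case by (simp add: add_ac)
    qed simp
    \<comment> \<open>The \<open>b\<close> steps of length \<open>a\<close> are also
      \<open>a\<close> steps of length \<open>b\<close>, the period of the Hilbert function.\<close>
    have "?H (m + b * a) = ?H m"
      using hilb_periodic[OF G p(1,3) N1, where m = m and t = a] m by (simp add: mult.commute)
    with dec[of b] p(2) have le: "?H m \<le> ?H (m + a)" by simp
    obtain k where k: "has_qdim pscale (?W m) (?I \<inter> forms m) k" "?H m = ?H (m + a) + k"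
      using split[of m] m by auto
    with le have "k = 0" by simp
    with k have "?W m \<subseteq> ?I \<inter> forms m" using pv.has_qdim_0D by blast
    with y show ?thesis by blast
  qed
  show ?thesis
  proof (rule nonzerodivisor_on_forms[OF G g(1)])
    fix k y assume y: "y \<in> forms k" "g * y \<in> ?I"
    \<comment> \<open>A power of \<open>p\<close> lifts \<open>y\<close> to the degrees where
      injectivity of \<open>g\<close> is known, and can be cancelled afterwards.\<close>
    let ?t = "max N1 N2"
    have "p ^ ?t * y \<in> forms (?t * b + k)" by (rule forms_mult[OF forms_power[OF p(1)] y(1)])
    moreover have "g * (p ^ ?t * y) \<in> ?I" using pideal_mult[OF y(2), of "p ^ ?t"] by (simp add: mult_ac)
    moreover have "?t * b + k \<ge> ?t" using p(2) by (cases b) auto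
    ultimately have "p ^ ?t * y \<in> ?I" using inj by blast
    then show "y \<in> ?I" using nonzerodivisorD[OF nonzerodivisor_power[OF p(3)]] by blast
  qed
qed

lemma forms_in_max_ideal: "p \<in> forms b \<Longrightarrow> b \<ge> 1 \<Longrightarrow> p \<in> pideal (range pvar)"
proof -
  assume p: "p \<in> forms b" "b \<ge> 1"
  have "f - pconst (peval f 0) \<in> pideal (range pvar)" for f :: "'a::finite cpoly"
  proof (induction f rule: cpoly_ring_induct)
    case (var j)
    then show ?case by (simp add: pideal_base)
  next
    case (add f g)
    from pideal_add[OF add] show ?case by (simp add: pconst_add algebra_simps)
  next
    case (mult f g)
    from pideal_add[OF pideal_mult[OF mult(1), of g] pideal_mult[OF mult(2), of "pconst (peval f 0)"]]
    show ?case by (simp add: pconst_mult algebra_simps)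
  qed simp
  from this[of p] show ?thesis using p(2) peval_form_scale[OF p(1), of 0 0] by (cases b) auto
qed

section \<open>Exchange of the socle\<close>

lemma socle_multiple:
  assumes y: "\<And>i. pvar i * y \<in> pideal G" and p: "p \<in> forms b" "b \<ge> 1"
  shows "p * y \<in> pideal G"
proof -
  have "pideal (range pvar) \<subseteq> {r. r * y \<in> pideal G}"
    unfolding pideal_def
  proof (rule pid.span_minimal)
    show "range pvar \<subseteq> {r. r * y \<in> pid.span G}" using y by (auto simp: pideal_def)
    show "pid.subspace {r. r * y \<in> pid.span G}"
      by (rule pid.subspaceI) (auto simp: distrib_right mult.assoc pid.span_add pid.span_zero pid.span_scale)
  qed
  with forms_in_max_ideal[OF p] show ?thesis by blast
qed

text \<open>Write \<open>A\<close> for the quotient by \<open>pideal G\<close>. The socles of \<open>A/p\<close> and of \<open>A/g\<close> are both identified with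
  the socle of \<open>A/pg\<close>, by multiplication with \<open>g\<close> and with \<open>p\<close>.\<close>

lemma socle_transfer_aux:
  assumes G: "graded (pideal G)" and p: "p \<in> forms b" "b \<ge> 1" "nonzerodivisor p (pideal G)"
    and g: "g \<in> forms a" "a \<ge> 1" "nonzerodivisor g (pideal G)"
    and y: "y \<in> forms k" "\<And>i. pvar i * y \<in> pideal (insert p G)"
  shows "g * y \<in> pideal (insert p G)"
    and "g * y - p * w \<in> pideal G \<Longrightarrow> pvar i * w \<in> pideal (insert g G)"
proof -
  show "g * y \<in> pideal (insert p G)" by (rule socle_multiple[OF y(2) g(1,2)])
  assume w: "g * y - p * w \<in> pideal G"
  obtain z where z: "pvar i * y - z * p \<in> pideal G" using y(2) by (auto simp: pideal_insert)
  from pideal_diff[OF pideal_mult[OF z, of g] pideal_mult[OF w, of "pvar i"]]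
  have "p * (pvar i * w - z * g) \<in> pideal G" by (simp add: algebra_simps)
  from nonzerodivisorD[OF p(3) this] show "pvar i * w \<in> pideal (insert g G)"
    by (auto simp: pideal_insert)
qed

text \<open>The new generator \<open>w\<close> is determined by \<open>g * u = p * w\<close> modulo
  \<open>pideal G\<close>; comparing degrees gives \<open>s + a - b\<close>.\<close>

lemma simple_socle_exchange:
  assumes G: "graded (pideal G)" and p: "p \<in> forms b" "b \<ge> 1" "nonzerodivisor p (pideal G)"
    and g: "g \<in> forms a" "a \<ge> 1" "nonzerodivisor g (pideal G)"
    and s: "simple_socle (pideal (insert p G)) s"
  shows "b \<le> s + a \<and> simple_socle (pideal (insert g G)) (s + a - b)"
proof -
  obtain u where u: "u \<in> forms s" "u \<notin> pideal (insert p G)" "\<And>i. pvar i * u \<in> pideal (insert p G)"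
    and umax: "\<And>k y. y \<in> forms k \<Longrightarrow> (\<And>i. pvar i * y \<in> pideal (insert p G)) \<Longrightarrow>
      \<exists>c. y - pscale c u \<in> pideal (insert p G)"
    using s unfolding simple_socle_def by blast
  have gu: "g * u \<in> forms (a + s)" by (rule forms_mult[OF g(1) u(1)])
  have guI: "g * u \<notin> pideal G"
    using nonzerodivisorD[OF g(3), of u] u(2) pideal_mono[of G "insert p G"] by blast
  note A = socle_transfer_aux[OF G p g u(1) u(3)]
  note B = socle_transfer_aux[OF G g p]
  obtain w where ble: "b \<le> a + s" and w: "w \<in> forms (a + s - b)" "g * u - p * w \<in> pideal G"
    using form_pideal_insert[OF G p(1) gu A(1)]
  proof cases
    case (1 w)
    show ?thesis by (rule that[OF 1(1,2)]) (use 1(3) in \<open>simp add: mult.commute\<close>)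
  qed (use guI in simp)
  have "simple_socle (pideal (insert g G)) (a + s - b)"
    unfolding simple_socle_def
  proof (intro bexI[of _ w] conjI allI ballI impI)
    show "w \<notin> pideal (insert g G)"
    proof
      assume "w \<in> pideal (insert g G)"
      then obtain t where t: "w - t * g \<in> pideal G" by (auto simp: pideal_insert)
      from pideal_add[OF w(2) pideal_mult[OF t, of p]]
      have "g * (u - t * p) \<in> pideal G" by (simp add: algebra_simps)
      from nonzerodivisorD[OF g(3) this] u(2) show False by (auto simp: pideal_insert)
    qed
    show "pvar i * w \<in> pideal (insert g G)" for i by (rule A(2)[OF w(2)])
    fix k y assume y: "y \<in> forms k" "\<forall>i. pvar i * y \<in> pideal (insert g G)"
    have py: "p * y \<in> forms (b + k)" by (rule forms_mult[OF p(1) y(1)])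
    have pg: "p * y \<in> pideal (insert g G)" using B(1) y by blast
    show "\<exists>c. y - pscale c w \<in> pideal (insert g G)"
      using form_pideal_insert[OF G g(1) py pg]
    proof cases
      \<comment> \<open>Here \<open>t\<close> corresponds to \<open>y\<close> in the opposite
        direction, so it is a multiple of \<open>u\<close> modulo \<open>insert p G\<close>;
        cancelling \<open>p\<close> carries this multiple back to \<open>w\<close>.\<close>
      case (1 t)
      have t: "p * y - g * t \<in> pideal G" using 1 by (simp add: mult.commute)
      have "pvar i * t \<in> pideal (insert p G)" for i using B(2)[OF y(1) _ t] y(2) by blast
      then obtain c where "t - pscale c u \<in> pideal (insert p G)" using umax[OF 1(2)] by blast
      then obtain r where r: "t - pscale c u - r * p \<in> pideal G" by (auto simp: pideal_insert)
      from pideal_add[OF pideal_add[OF t pideal_mult[OF r, of g]] pideal_mult[OF w(2), of "pconst c"]]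
      have "p * (y - pscale c w - r * g) \<in> pideal G" by (simp add: algebra_simps pscale_def)
      from nonzerodivisorD[OF p(3) this] show ?thesis by (auto simp: pideal_insert)
    next
      case 2
      then have "y \<in> pideal G" using nonzerodivisorD[OF p(3)] by blast
      then have "y - pscale 0 w \<in> pideal (insert g G)" using pideal_mono[of G "insert g G"] by auto
      then show ?thesis by blast
    qed
  qed (rule w(1))
  with ble show ?thesis by (simp add: add.commute)
qed

section \<open>Permutation and exchange in regular families\<close>

text \<open>A form \<open>y\<close> annihilated by \<open>q\<close> is \<open>z * r\<close> modulo
  \<open>pideal G\<close>, where \<open>q\<close> again annihilates \<open>z\<close>. As
  \<open>r\<close> has positive degree, \<open>z\<close> has smaller degree and induction
  applies.\<close>

lemma nonzerodivisor_descend: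
  assumes G: "graded (pideal G)" and r: "r \<in> forms a" "a \<ge> 1" "nonzerodivisor r (pideal G)"
    and q: "q \<in> forms b" "nonzerodivisor q (pideal (insert r G))"
  shows "nonzerodivisor q (pideal G)"
proof (rule nonzerodivisor_on_forms[OF G q(1)])
  show "y \<in> pideal G" if "y \<in> forms k" "q * y \<in> pideal G" for k y
    using that
  proof (induction k arbitrary: y rule: less_induct)
    case (less k)
    have "y \<in> pideal (insert r G)"
      using nonzerodivisorD[OF q(2)] less.prems(2) pideal_mono[of G "insert r G"] by blast
    from form_pideal_insert[OF G r(1) less.prems(1) this] show ?case
    proof cases
      case (1 z)
      have "r * (q * z) = q * y - q * (y - z * r)" by (simp add: algebra_simps)
      also have "\<dots> \<in> pideal G" by (intro pideal_diff less.prems pideal_mult 1)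
      finally have "q * z \<in> pideal G" by (rule nonzerodivisorD[OF r(3)])
      moreover have "k - a < k" using 1(1) r(2) by simp
      ultimately have "z \<in> pideal G" using less.IH 1(2) by blast
      from pideal_add[OF 1(3) pideal_mult_right[OF this, of r]] show ?thesis by simp
    qed simp
  qed
qed

text \<open>The usual swap of two neighbours in a regular sequence: a relation between
  \<open>r * y\<close> and \<open>z * q\<close> forces \<open>z\<close> to be a multiple of
  \<open>r\<close>, which can then be cancelled.\<close>

lemma nonzerodivisor_swap:
  assumes r: "nonzerodivisor r (pideal G)" and q: "nonzerodivisor q (pideal (insert r G))"
  shows "nonzerodivisor r (pideal (insert q G))"
  unfolding nonzerodivisor_def
proof (intro allI impI)
  fix y assume "r * y \<in> pideal (insert q G)"
  then obtain z where z: "r * y - z * q \<in> pideal G" by (auto simp: pideal_insert)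
  have "q * z - y * r \<in> pideal G" using pideal_mult[OF z, of "-1"] by (simp add: algebra_simps)
  then have "q * z \<in> pideal (insert r G)" by (auto simp: pideal_insert)
  then have "z \<in> pideal (insert r G)" by (rule nonzerodivisorD[OF q])
  then obtain t where t: "z - t * r \<in> pideal G" by (auto simp: pideal_insert)
  from pideal_add[OF z pideal_mult[OF t, of q]]
  have "r * (y - t * q) \<in> pideal G" by (simp add: algebra_simps)
  from nonzerodivisorD[OF r this] show "y \<in> pideal (insert q G)" by (auto simp: pideal_insert)
qed

text \<open>Regularity of \<open>g\<close> is given modulo all other members. It descends to subsets
  by removing members one at a time; the other members remain regular modulo sets containing
  \<open>g\<close> by a swap.\<close>

lemma regular_family_update:
  assumes q: "regular_family q" "\<And>j. \<exists>a\<ge>1. q j \<in> forms a"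
    and g: "g \<in> forms a" "nonzerodivisor g (pideal (q ` (- {i})))"
  shows "regular_family (q(i := g))"
proof -
  have gr: "graded (pideal (q ` R))" for R
    by (rule graded_pideal) (use q(2) in blast)
  have reg: "nonzerodivisor (q r) (pideal (q ` R))" if "r \<notin> R" for r R
    using q(1) that by (simp add: regular_family_def)
  have gR: "nonzerodivisor g (pideal (q ` (- insert i B)))" if "finite B" for B
    using that
  proof induction
    case (insert r B)
    show ?case
    proof (cases "r = i \<or> r \<in> B")
      case True
      then have "- insert i (insert r B) = - insert i B" by auto
      with insert show ?thesis by simp
    next
      case False
      then have *: "insert (q r) (q ` (- insert i (insert r B))) = q ` (- insert i B)" by auto
      obtain c where c: "c \<ge> 1" "q r \<in> forms c" using q(2) by blast
      show ?thesis
        by (rule nonzerodivisor_descend[OF gr c(2,1) reg g(1)]) (use insert * in auto)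
    qed
  qed (use g in simp)
  have gR: "nonzerodivisor g (pideal (q ` R))" if "i \<notin> R" for R
  proof -
    have "- insert i (- R) = R" using that by auto
    with gR[of "- R"] show ?thesis by simp
  qed
  show ?thesis
    unfolding regular_family_def
  proof (intro allI impI)
    fix R and r :: 'a assume r: "r \<notin> R"
    show "nonzerodivisor ((q(i := g)) r) (pideal ((q(i := g)) ` R))"
    proof (cases "r = i")
      case True
      then have "(q(i := g)) ` R = q ` R" using r by auto
      with gR[of R] True r show ?thesis by simp
    next
      case False
      show ?thesis
      proof (cases "i \<in> R")
        case True
        have e: "(q(i := g)) ` R = insert g (q ` (R - {i}))" using True by auto
        have "nonzerodivisor g (pideal (insert (q r) (q ` (R - {i}))))"
          using gR[of "insert r (R - {i})"] False by simp
        from nonzerodivisor_swap[OF reg this] r False show ?thesis unfolding e by simp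
      next
        case iR: False
        then have "(q(i := g)) ` R = q ` R" by auto
        with reg[OF r] False show ?thesis by simp
      qed
    qed
  qed
qed

lemma range_family: "range q = insert (q i) (q ` (- {i}))"
  by auto

lemma range_family_update: "range (q(i := g)) = insert g (q ` (- {i}))"
  by auto

lemma complete_intersection_graded:
  assumes "complete_intersection q s"
  shows "graded (pideal (q ` R))"
  by (rule graded_pideal) (use assms in \<open>auto simp: complete_intersection_def\<close>)

lemma complete_intersection_nonzerodivisor:
  "complete_intersection q s \<Longrightarrow> r \<notin> R \<Longrightarrow> nonzerodivisor (q r) (pideal (q ` R))"
  by (simp add: complete_intersection_def regular_family_def)

text \<open>The algebra is reduced to a geometric condition: the new family has no common zero
  besides the origin.\<close>

lemma complete_intersection_update:
  assumes q: "complete_intersection q s" and b: "q i \<in> forms b" "b \<ge> 1" and g: "g \<in> forms a" "a \<ge> 1"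
    and van: "\<And>v. (\<And>j. j \<noteq> i \<Longrightarrow> peval (q j) v = 0) \<Longrightarrow> peval g v = 0 \<Longrightarrow> v = 0"
  shows "complete_intersection (q(i := g)) (s + a - b)"
proof -
  let ?G = "q ` (- {i})"
  have G: "graded (pideal ?G)" using complete_intersection_graded[OF q] .
  have fq: "\<exists>a\<ge>1. q j \<in> forms a" for j using q by (simp add: complete_intersection_def)
  have Gg: "graded (pideal (insert g ?G))"
    by (rule graded_pideal) (use fq g in blast)
  have cg: "cofinite_ideal (pideal (insert g ?G))"
    unfolding cofinite_ideal_def
    by (rule cofinite_if_no_zeros[OF Gg]) (auto intro!: van pideal_base)
  have cp: "cofinite_ideal (pideal (insert (q i) ?G))" and sp: "simple_socle (pideal (insert (q i) ?G)) s"
    using q by (simp_all add: complete_intersection_def range_family[of q i, symmetric])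
  have np: "nonzerodivisor (q i) (pideal ?G)" by (rule complete_intersection_nonzerodivisor[OF q]) simp
  have ng: "nonzerodivisor g (pideal ?G)" by (rule nonzerodivisor_exchange[OF G b np cp g cg])
  have "simple_socle (pideal (insert g ?G)) (s + a - b)"
    using simple_socle_exchange[OF G b np g ng sp] by simp
  moreover have "regular_family (q(i := g))"
    by (rule regular_family_update[OF _ fq g(1) ng]) (use q in \<open>simp add: complete_intersection_def\<close>)
  ultimately show ?thesis
    unfolding complete_intersection_def range_family_update
    using cg fq g by (auto simp: fun_upd_def)
qed

lemma lookup_pvar_mult: "lkp (pvar r * f) (Poly_Mapping.single r 1 + m) = lkp f m"
  by (induction f rule: cpoly_induct)
    (simp_all add: pvar_def mult_single lookup_single when_def algebra_simps lookup_add)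

text \<open>The starting point of all exchanges: the quotient by the variables is the field of
  constants, so the socle degree is 0.\<close>

lemma complete_intersection_pvar: "complete_intersection pvar 0"
proof -
  have gr: "graded (pideal (range (pvar :: 'a \<Rightarrow> _)))"
    by (rule graded_pideal) (use forms_pvar in blast)
  have reg: "regular_family (pvar :: 'a \<Rightarrow> _)"
    unfolding regular_family_def nonzerodivisor_def
  proof (intro allI impI)
    fix R and r :: 'a and y assume r: "r \<notin> R" and y: "pvar r * y \<in> pideal (pvar ` R)"
    define \<sigma> where "\<sigma> f = psubst f (\<lambda>j. if j \<in> R then 0 else pvar j)" for f :: "'a cpoly"
    have \<sigma>0: "\<sigma> f = 0" if "f \<in> pideal (pvar ` R)" for f
      using that unfolding pideal_def
      by (induction f rule: pid.span_induct_alt) (auto simp: \<sigma>_def)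
    have "pvar r * \<sigma> y = 0" using \<sigma>0[OF y] r by (simp add: \<sigma>_def)
    then have "\<sigma> y = 0"
      by (intro poly_mapping_eqI) (metis lookup_pvar_mult lookup_zero)
    moreover have "f - \<sigma> f \<in> pideal (pvar ` R)" for f
    proof (induction f rule: cpoly_ring_induct)
      case (var j)
      then show ?case by (auto simp: \<sigma>_def pideal_base)
    next
      case (add f g)
      from pideal_add[OF add] show ?case by (simp add: \<sigma>_def algebra_simps)
    next
      case (mult f g)
      from pideal_add[OF pideal_mult[OF mult(1), of g] pideal_mult[OF mult(2), of "\<sigma> f"]]
      show ?case by (simp add: \<sigma>_def algebra_simps)
    qed (simp add: \<sigma>_def)
    ultimately show "y \<in> pideal (pvar ` R)" by (metis diff_zero)
  qed
  have cof: "cofinite_ideal (pideal (range (pvar :: 'a \<Rightarrow> _)))"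
    unfolding cofinite_ideal_def
  proof (rule cofinite_if_no_zeros[OF gr])
    fix v :: "complex ^ 'a" assume z: "\<And>p. p \<in> pideal (range pvar) \<Longrightarrow> peval p v = 0"
    have "peval (pvar j) v = 0" for j by (rule z) (simp add: pideal_base)
    then show "v = 0" by (simp add: vec_eq_iff)
  qed
  have "simple_socle (pideal (range (pvar :: 'a \<Rightarrow> _))) 0"
    unfolding simple_socle_def
  proof (intro bexI[of _ 1] conjI allI ballI impI)
    show "1 \<notin> pideal (range (pvar :: 'a \<Rightarrow> _))"
    proof
      assume "1 \<in> pideal (range (pvar :: 'a \<Rightarrow> _))"
      then have "peval 1 (0 :: complex ^ 'a) = 0" by (rule peval_ideal) auto
      then show False by simp
    qed
    show "pvar i * 1 \<in> pideal (range (pvar :: 'a \<Rightarrow> _))" for i by (simp add: pideal_base)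
    fix k and y :: "'a cpoly" assume y: "y \<in> forms k" 
    show "\<exists>c. y - pscale c 1 \<in> pideal (range pvar)"
    proof (cases "k = 0")
      case True
      then obtain c where "y = pconst c" using y forms_0_const by blast
      then show ?thesis by (intro exI[of _ c]) (simp add: pscale_def)
    next
      case False
      then have "y \<in> pideal (range pvar)" using forms_in_max_ideal[OF y] by simp
      then show ?thesis by (intro exI[of _ 0]) simp
    qed
  qed simp
  moreover have "\<exists>a\<ge>1. pvar i \<in> forms a" for i :: 'a
    by (intro exI[of _ 1] conjI forms_pvar order_refl)
  ultimately show ?thesis using reg cof by (simp add: complete_intersection_def)
qed


section \<open>Finite zero sets and general position\<close>

lemma linear_form_separating:
  fixes v w :: "complex ^ 'n::finite"
  assumes "w \<noteq> 0" "\<And>c. v \<noteq> c *s w"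
  obtains l where "l \<in> forms 1" "peval l w = 0" "peval l v \<noteq> 0"
proof -
  obtain i where i: "w $ i \<noteq> 0" using assms(1) by (auto simp: vec_eq_iff)
  \<comment> \<open>These 2 by 2 minors vanish at \<open>w\<close>, and their common zeros are
    exactly the multiples of \<open>w\<close>.\<close>
  define l where "l j = pconst (w $ i) * pvar j - pconst (w $ j) * pvar i" for j
  have "\<exists>j. peval (l j) v \<noteq> 0"
  proof (rule ccontr)
    assume "\<not> ?thesis"
    then have "w $ i * v $ j = w $ j * v $ i" for j by (simp add: l_def)
    then have "v = (v $ i / w $ i) *s w" using i by (auto simp: vec_eq_iff field_simps)
    with assms(2) show False by blast
  qed
  then obtain j where j: "peval (l j) v \<noteq> 0" by blast
  have "pconst (w $ a) * pvar b \<in> forms 1" for a b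
    using hom_comp_mult[OF hom_comp_pconst hom_comp_pvar] by simp
  then have "l j \<in> forms 1" unfolding l_def by (intro hom_comp_diff)
  with j show ?thesis by (intro that[of "l j"]) (simp_all add: l_def)
qed

lemma forms_prod:
  assumes "finite A" "\<And>x. x \<in> A \<Longrightarrow> f x \<in> forms (k x)"
  shows "(\<Prod>x\<in>A. f x) \<in> forms (\<Sum>x\<in>A. k x)"
  using assms
proof (induction A)
  case (insert x A)
  then have "f x * (\<Prod>x\<in>A. f x) \<in> forms (k x + (\<Sum>x\<in>A. k x))" by (intro forms_mult) auto
  with insert show ?case by simp
qed simp

lemma separating_form:
  fixes V :: "(complex ^ 'n::finite) set"
  assumes V: "finite V" "0 \<notin> V" "\<And>v w c. v \<in> V \<Longrightarrow> w \<in> V \<Longrightarrow> v \<noteq> w \<Longrightarrow> v \<noteq> c *s w"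
    and v: "v \<noteq> 0" "\<And>w c. w \<in> V \<Longrightarrow> v \<noteq> c *s w" and k: "card V \<le> k"
  obtains s where "s \<in> forms k" "peval s v \<noteq> 0" "\<And>w. w \<in> V \<Longrightarrow> peval s w = 0"
proof -
  have "\<forall>w\<in>V. \<exists>l\<in>forms 1. peval l w = 0 \<and> peval l v \<noteq> 0"
    by (metis linear_form_separating V(2) v(2))
  then obtain l where l: "\<And>w. w \<in> V \<Longrightarrow> l w \<in> forms 1" "\<And>w. w \<in> V \<Longrightarrow> peval (l w) w = 0"
    "\<And>w. w \<in> V \<Longrightarrow> peval (l w) v \<noteq> 0" by metis
  obtain i where i: "v $ i \<noteq> 0" using v(1) by (auto simp: vec_eq_iff)
  \<comment> \<open>One linear factor kills each point of \<open>V\<close>; a power of a coordinate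
    that is nonzero at \<open>v\<close> raises the degree to \<open>k\<close>.\<close>
  let ?s = "(\<Prod>w\<in>V. l w) * pvar i ^ (k - card V)"
  have "(\<Prod>w\<in>V. l w) \<in> forms (\<Sum>w\<in>V. 1)" by (rule forms_prod[OF V(1) l(1)])
  from forms_mult[OF this forms_power[OF forms_pvar[of i], of "k - card V"]] k
  have "?s \<in> forms k" by simp
  moreover have "peval ?s v \<noteq> 0" using V(1) l(3) i by simp
  moreover have "peval ?s w = 0" if "w \<in> V" for w
    using prod_zero[OF V(1), of "\<lambda>x. peval (l x) w"] l(2) that by auto
  ultimately show ?thesis by (intro that)
qed

text \<open>Separating forms of pairwise nonproportional zeros are independent modulo the ideal.
  Their number is therefore bounded by the Hilbert function, which is periodic in high degree, and a
  largest set of such zeros meets every line of zeros.\<close>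

lemma finite_zeros:
  fixes q :: "'n::finite \<Rightarrow> 'n cpoly"
  assumes q: "complete_intersection q s"
  obtains V where "finite V" "0 \<notin> V" "\<And>w j. w \<in> V \<Longrightarrow> j \<noteq> i \<Longrightarrow> peval (q j) w = 0"
    "\<And>v. v \<noteq> 0 \<Longrightarrow> (\<And>j. j \<noteq> i \<Longrightarrow> peval (q j) v = 0) \<Longrightarrow> \<exists>w\<in>V. \<exists>c. v = c *s w"
proof -
  let ?G = "q ` (- {i})"
  obtain b where b: "q i \<in> forms b" "b \<ge> 1" using q unfolding complete_intersection_def by blast
  have G: "graded (pideal ?G)" using complete_intersection_graded[OF q] .
  have np: "nonzerodivisor (q i) (pideal ?G)" by (rule complete_intersection_nonzerodivisor[OF q]) simp
  obtain N where N: "\<And>k. k \<ge> N \<Longrightarrow> forms k \<subseteq> pideal (insert (q i) ?G)"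
    using q unfolding complete_intersection_def cofinite_ideal_def range_family[of q i] by blast
  let ?H = "hilb (pideal ?G) (int N)"
  define Z where "Z = {v. v \<noteq> 0 \<and> (\<forall>j. j \<noteq> i \<longrightarrow> peval (q j) v = 0)}"
  define P where "P V \<longleftrightarrow> finite V \<and> V \<subseteq> Z \<and> (\<forall>v\<in>V. \<forall>w\<in>V. v \<noteq> w \<longrightarrow> (\<forall>c. v \<noteq> c *s w))" for V
  have bound: "card V \<le> ?H" if "P V" for V
  proof -
    \<comment> \<open>Large enough for separating forms, and differing from \<open>N\<close> by a
      multiple of the period \<open>b\<close>, so that the bound does not depend on
      \<open>V\<close>.\<close>
    let ?k = "N + card V * b"
    have fin: "finite V" and Z0: "0 \<notin> V" using that by (auto simp: P_def Z_def)
    have "\<exists>s\<in>forms ?k. peval s v \<noteq> 0 \<and> (\<forall>w\<in>V - {v}. peval s w = 0)" if v: "v \<in> V" for v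
    proof -
      have "card (V - {v}) \<le> card V" using fin by (intro card_mono) auto
      also have "\<dots> \<le> ?k" using b(2) by (cases b) auto
      finally have k: "card (V - {v}) \<le> ?k" .
      have np: "v' \<noteq> c *s w" if "v' \<in> V" "w \<in> V" "v' \<noteq> w" for v' w c
        using \<open>P V\<close> that unfolding P_def by blast
      have "v \<noteq> 0" "finite (V - {v})" "0 \<notin> V - {v}" using fin Z0 v by auto
      then obtain s where "s \<in> forms ?k" "peval s v \<noteq> 0" "\<And>w. w \<in> V - {v} \<Longrightarrow> peval s w = 0"
        using separating_form[of "V - {v}" v ?k] np v k by (metis DiffD1 DiffD2 singletonI)
      then show ?thesis by blast
    qed
    then obtain s where s: "\<And>v. v \<in> V \<Longrightarrow> s v \<in> forms ?k" "\<And>v. v \<in> V \<Longrightarrow> peval (s v) v \<noteq> 0"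
      "\<And>v w. v \<in> V \<Longrightarrow> w \<in> V - {v} \<Longrightarrow> peval (s v) w = 0" by metis
    have "card V \<le> hilb (pideal ?G) (int ?k)"
    proof (rule pv.has_qdim_indep_le[OF has_qdim_hilb _ fin])
      show "pv.subspace (pideal ?G \<inter> forms ?k)" by (intro pv.subspace_inter) auto
      show "s v \<in> forms ?k" if "v \<in> V" for v by (rule s(1)[OF that])
      fix a assume a: "(\<Sum>v\<in>V. pscale (a v) (s v)) \<in> pideal ?G \<inter> forms ?k"
      show "\<forall>v\<in>V. a v = 0"
      proof
        fix v assume v: "v \<in> V"
        have "peval (\<Sum>v\<in>V. pscale (a v) (s v)) v = 0"
          by (rule peval_ideal[of _ ?G]) (use a v \<open>P V\<close> in \<open>auto simp: P_def Z_def\<close>)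
        then have "(\<Sum>w\<in>V. a w * peval (s w) v) = 0" by simp
        also have "(\<Sum>w\<in>V. a w * peval (s w) v) = a v * peval (s v) v"
        proof -
          have "a w * peval (s w) v = 0" if "w \<in> V - {v}" for w using s(3)[of w v] v that by auto
          then have "(\<Sum>w\<in>V - {v}. a w * peval (s w) v) = 0" by (rule sum.neutral[OF ballI])
          then show ?thesis by (subst sum.remove[OF fin v]) simp
        qed
        finally show "a v = 0" using s(2)[OF v] by simp
      qed
    qed simp
    also have "hilb (pideal ?G) (int ?k) = ?H"
      by (rule hilb_periodic[OF G b(1) np N order_refl])
    finally show ?thesis .
  qed
  have "P {}" by (simp add: P_def)
  moreover have "\<forall>V. P V \<longrightarrow> card V < Suc ?H" using bound by (simp add: less_Suc_eq_le)
  ultimately obtain V where V: "P V" "\<And>V'. P V' \<Longrightarrow> card V' \<le> card V"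
    using ex_has_greatest_nat[of P "{}" card "Suc ?H"] by auto
  show ?thesis
  proof (rule that[of V])
    show "finite V" "0 \<notin> V" using V(1) by (auto simp: P_def Z_def)
    show "peval (q j) w = 0" if "w \<in> V" "j \<noteq> i" for w j using V(1) that by (auto simp: P_def Z_def)
    fix v assume v: "v \<noteq> 0" "\<And>j. j \<noteq> i \<Longrightarrow> peval (q j) v = 0"
    show "\<exists>w\<in>V. \<exists>c. v = c *s w"
    proof (rule ccontr)
      assume no: "\<not> ?thesis"
      then have vV: "v \<notin> V" by (metis vector_smult_lid)
      have "w \<noteq> c *s v" if "w \<in> V" for w c
      proof
        assume w: "w = c *s v"
        have "c \<noteq> 0" using w that V(1) by (auto simp: P_def Z_def)
        then have "v = inverse c *s w" using w by (simp add: vector_smult_assoc)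
        with no that show False by blast
      qed
      then have "P (insert v V)" using V(1) v no by (auto simp: P_def Z_def)
      from V(2)[OF this] show False using vV V(1) by (simp add: P_def)
    qed
  qed
qed

text \<open>Moving \<open>b\<close> along a coordinate \<open>j\<close> with
  \<open>a j \<noteq> 0\<close>, each hyperplane either excludes one parameter value
  \<open>t\<close> or is unaffected by the motion.\<close>

lemma avoid_hyperplanes:
  fixes \<Lambda> :: "('n::finite \<Rightarrow> complex) set"
  assumes "finite \<Lambda>" "\<And>a. a \<in> \<Lambda> \<Longrightarrow> \<exists>j\<in>D. a j \<noteq> 0"
  shows "\<exists>b. \<forall>a\<in>\<Lambda>. (\<Sum>j\<in>D. b j * a j) \<noteq> 0"
  using assms
proof (induction \<Lambda>)
  case (insert a \<Lambda>)
  then obtain b where b: "\<And>x. x \<in> \<Lambda> \<Longrightarrow> (\<Sum>j\<in>D. b j * x j) \<noteq> 0" by auto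
  obtain j where j: "j \<in> D" "a j \<noteq> 0" using insert.prems by auto
  let ?v = "\<lambda>x. \<Sum>j\<in>D. b j * x j"
  have "\<exists>t. t \<notin> (\<lambda>x. - ?v x / x j) ` insert a \<Lambda>"
    by (rule ex_new_if_finite) (use insert.hyps infinite_UNIV_char_0 in auto)
  then obtain t where t: "\<And>x. x \<in> insert a \<Lambda> \<Longrightarrow> t \<noteq> - ?v x / x j" by blast
  define b' where "b' = b(j := b j + t)"
  have v': "(\<Sum>k\<in>D. b' k * x k) = ?v x + t * x j" for x
  proof -
    have "(\<Sum>k\<in>D. b' k * x k) = (\<Sum>k\<in>D. b k * x k + (if k = j then t * x j else 0))"
      by (rule sum.cong) (auto simp: b'_def algebra_simps)
    then show ?thesis using j by (simp add: sum.distrib)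
  qed
  have "(\<Sum>k\<in>D. b' k * x k) \<noteq> 0" if x: "x \<in> insert a \<Lambda>" for x
  proof (cases "x j = 0")
    case True
    then show ?thesis using x j b by (auto simp: v')
  next
    case False
    show ?thesis
    proof
      assume "(\<Sum>k\<in>D. b' k * x k) = 0"
      then have "t * x j = - ?v x" by (simp add: v' eq_neg_iff_add_eq_0 add.commute)
      then have "t = - ?v x / x j" using False by (metis nonzero_mult_div_cancel_right)
      with t[OF x] show False by blast
    qed
  qed
  then show ?case by blast
qed simp

lemma linear_combination_forms:
  assumes "\<And>j. F j \<in> forms e"
  shows "(\<Sum>j\<in>D. pconst (b j) * F j) \<in> forms e"
  using assms hom_comp_mult[OF hom_comp_pconst] by (intro hom_comp_sum) force

lemma exchange_generator:
  fixes F :: "'n::finite \<Rightarrow> 'n cpoly"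
  assumes i: "i \<in> D" "b i \<noteq> 0" and g: "g = (\<Sum>j\<in>D. pconst (b j) * F j)"
  shows "pideal (range (F(i := g))) = pideal (range F)"
proof
  show "pideal (range (F(i := g))) \<subseteq> pideal (range F)"
  proof (rule pideal_le)
    fix h assume "h \<in> range (F(i := g))"
    then have "h = g \<or> h \<in> range F" by auto
    then show "h \<in> pideal (range F)" by (auto simp: g intro: pideal_base intro!: pideal_sum pideal_mult)
  qed
  let ?J = "pideal (range (F(i := g)))"
  have gJ: "g \<in> ?J" by (rule pideal_base) (metis fun_upd_same rangeI)
  have FJ: "F j \<in> ?J" if "j \<noteq> i" for j by (rule pideal_base) (metis fun_upd_other rangeI that)
  have "pconst (b i) * F i = g - (\<Sum>j\<in>D - {i}. pconst (b j) * F j)"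
    unfolding g using sum.remove[OF _ i(1), of "\<lambda>j. pconst (b j) * F j"] by simp
  also have "\<dots> \<in> ?J" by (intro pideal_diff gJ pideal_sum pideal_mult FJ) auto
  finally have "pconst (inverse (b i)) * (pconst (b i) * F i) \<in> ?J" by (rule pideal_mult)
  then have "F i \<in> ?J" using i(2) by (simp add: mult.assoc[symmetric] pconst_mult[symmetric])
  then have "F j \<in> ?J" for j using FJ by (cases "j = i") auto
  then show "pideal (range F) \<subseteq> ?J" by (intro pideal_le) auto
qed

text \<open>The set \<open>D\<close> collects the indices already treated: \<open>q\<close> is
  \<open>l\<close> at \<open>i0\<close>, agrees with \<open>F\<close> on \<open>D\<close> and is
  still a variable elsewhere. The next member has to avoid only the finitely many lines on which the
  members that stay vanish.\<close>

theorem general_position: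
  fixes f :: "'n::finite \<Rightarrow> 'n cpoly" and Z :: "(complex ^ 'n) set" and i0 :: 'n
  assumes f: "\<And>j. f j \<in> forms e" "e \<ge> 1"
    and Z: "finite Z" "0 \<notin> Z" "\<And>v. v \<noteq> 0 \<Longrightarrow> (\<And>j. peval (f j) v = 0) \<Longrightarrow> \<exists>w\<in>Z. \<exists>c. v = c *s w"
  obtains l F where "l \<in> forms 1" "\<And>w. w \<in> Z \<Longrightarrow> peval l w \<noteq> 0"
    "\<And>j. F j \<in> forms e" "pideal (range F) = pideal (range f)"
    "complete_intersection (F(i0 := l)) ((CARD('n) - 1) * (e - 1))"
proof -
  \<comment> \<open>The extra functional makes the coefficient of \<open>pvar i0\<close> in
    \<open>l\<close> nonzero, so that \<open>l\<close> may replace that variable.\<close>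
  let ?\<Lambda> = "insert (\<lambda>j. if j = i0 then 1 else 0) ((\<lambda>w j. w $ j) ` Z)"
  have "\<exists>b. \<forall>a\<in>?\<Lambda>. (\<Sum>j\<in>UNIV. b j * a j) \<noteq> 0"
  proof (rule avoid_hyperplanes)
    fix a assume "a \<in> ?\<Lambda>"
    moreover have "\<exists>j. w $ j \<noteq> 0" if "w \<in> Z" for w using that Z(2) by (metis vec_eq_iff zero_index)
    ultimately show "\<exists>j\<in>UNIV. a j \<noteq> 0" by auto
  qed (use Z(1) in simp)
  then obtain b where b: "\<And>a. a \<in> ?\<Lambda> \<Longrightarrow> (\<Sum>j\<in>UNIV. b j * a j) \<noteq> 0" by metis
  define l :: "'n cpoly" where "l = (\<Sum>j\<in>UNIV. pconst (b j) * pvar j)"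
  have l1: "l \<in> forms 1" unfolding l_def by (rule linear_combination_forms[OF forms_pvar])
  have lZ: "peval l w \<noteq> 0" if "w \<in> Z" for w using b[of "\<lambda>j. w $ j"] that by (simp add: l_def)
  have bi0: "b i0 \<noteq> 0" using b[of "\<lambda>j. if j = i0 then 1 else 0"] by (simp add: if_distrib cong: if_cong)
  have "complete_intersection (pvar(i0 := l)) (0 + 1 - 1)"
  proof (rule complete_intersection_update[OF complete_intersection_pvar forms_pvar _ l1])
    fix v :: "complex ^ 'n" assume v: "\<And>j. j \<noteq> i0 \<Longrightarrow> peval (pvar j) v = 0" "peval l v = 0"
    have "peval l v = (\<Sum>j\<in>UNIV. if j = i0 then b i0 * v $ i0 else 0)"
      unfolding l_def peval_simps by (rule sum.cong) (use v(1) in auto)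
    with v(2) bi0 have "v $ i0 = 0" by simp
    with v(1) have "v $ j = 0" for j by (cases "j = i0") auto
    then show "v = 0" by (simp add: vec_eq_iff)
  qed auto
  then have base: "complete_intersection (pvar(i0 := l)) 0" by simp
  have "\<exists>F q. q i0 = l \<and> (\<forall>j\<in>D. q j = F j) \<and> (\<forall>j. j \<notin> D \<longrightarrow> j \<noteq> i0 \<longrightarrow> q j = pvar j) \<and>
      (\<forall>j. F j \<in> forms e) \<and> pideal (range F) = pideal (range f) \<and>
      complete_intersection q (card D * (e - 1))" if "finite D" "i0 \<notin> D" for D
    using that
  proof (induction D)
    case empty
    show ?case by (rule exI[of _ f], rule exI[of _ "pvar(i0 := l)"], intro conjI)
        (use base f in \<open>simp_all add: fun_upd_def\<close>)
  next
    case (insert i D)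
    then obtain F q where Fq: "q i0 = l" "\<And>j. j \<in> D \<Longrightarrow> q j = F j"
      "\<And>j. j \<notin> D \<Longrightarrow> j \<noteq> i0 \<Longrightarrow> q j = pvar j" "\<And>j. F j \<in> forms e"
      "pideal (range F) = pideal (range f)" "complete_intersection q (card D * (e - 1))" by auto
    have i: "i \<notin> D" "i \<noteq> i0" using insert by auto
    obtain V where V: "finite V" "0 \<notin> V" "\<And>w j. w \<in> V \<Longrightarrow> j \<noteq> i \<Longrightarrow> peval (q j) w = 0"
      "\<And>v. v \<noteq> 0 \<Longrightarrow> (\<And>j. j \<noteq> i \<Longrightarrow> peval (q j) v = 0) \<Longrightarrow> \<exists>w\<in>V. \<exists>c. v = c *s w"
      using finite_zeros[OF Fq(6), of i] by metis
    \<comment> \<open>If all \<open>F j\<close> vanished at \<open>w\<close>, then \<open>w\<close>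
      would be proportional to a point of \<open>Z\<close>; but \<open>l\<close>, one of the members
      kept, is nonzero on \<open>Z\<close>.\<close>
    have ex: "\<exists>j\<in>-D. peval (F j) w \<noteq> 0" if w: "w \<in> V" for w
    proof (rule ccontr)
      assume "\<not> ?thesis"
      then have "peval (F j) w = 0" for j using V(3)[OF w, of j] Fq(2) i by (cases "j \<in> D") auto
      then have z: "peval h w = 0" if "h \<in> pideal (range F)" for h
        using peval_ideal[OF that, of w] by auto
      then have "peval (f j) w = 0" for j using z[unfolded Fq(5)] by (simp add: pideal_base)
      moreover have "w \<noteq> 0" using w V(2) by auto
      ultimately obtain z c where z: "z \<in> Z" "w = c *s z" using Z(3) by blast
      have "c \<noteq> 0" using z \<open>w \<noteq> 0\<close> by auto
      moreover have "peval l w = 0" using V(3)[OF w, of i0] i Fq(1) by auto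
      ultimately show False using lZ[OF z(1)] peval_form_scale[OF l1, of c z] z(2) by simp
    qed
    \<comment> \<open>The extra functional forces \<open>b i \<noteq> 0\<close>, so that replacing
      \<open>F i\<close> by \<open>g\<close> leaves the ideal unchanged. Summing outside
      \<open>D\<close> suffices since the \<open>F j\<close> with \<open>j\<close> in
      \<open>D\<close> vanish on \<open>V\<close>.\<close>
    let ?\<Lambda> = "insert (\<lambda>j. if j = i then 1 else 0) ((\<lambda>w j. peval (F j) w) ` V)"
    have "\<exists>b. \<forall>a\<in>?\<Lambda>. (\<Sum>j\<in>-D. b j * a j) \<noteq> 0"
      by (rule avoid_hyperplanes) (use V(1) ex i in auto)
    then obtain b where b: "\<And>a. a \<in> ?\<Lambda> \<Longrightarrow> (\<Sum>j\<in>-D. b j * a j) \<noteq> 0" by metis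
    define g where "g = (\<Sum>j\<in>-D. pconst (b j) * F j)"
    have ge: "g \<in> forms e" unfolding g_def by (rule linear_combination_forms[OF Fq(4)])
    have gV: "peval g w \<noteq> 0" if "w \<in> V" for w using b[of "\<lambda>j. peval (F j) w"] that by (simp add: g_def)
    have bi: "b i \<noteq> 0" using b[of "\<lambda>j. if j = i then 1 else 0"] by (auto simp: if_distrib cong: if_cong)
    have "complete_intersection (q(i := g)) (card D * (e - 1) + e - 1)"
    proof (rule complete_intersection_update[OF Fq(6) _ _ ge f(2)])
      show "q i \<in> forms 1" using Fq(3) i forms_pvar by simp
      fix v assume v: "\<And>j. j \<noteq> i \<Longrightarrow> peval (q j) v = 0" "peval g v = 0"
      show "v = 0"
      proof (rule ccontr)
        assume "v \<noteq> 0"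
        then obtain w c where w: "w \<in> V" "v = c *s w" using V(4) v(1) by blast
        have "c \<noteq> 0" using w \<open>v \<noteq> 0\<close> by auto
        then show False using gV[OF w(1)] v(2) peval_form_scale[OF ge, of c w] w(2) by simp
      qed
    qed simp
    \<comment> \<open>Replacing a variable by a form of degree \<open>e\<close> raises the socle
      degree by \<open>e - 1\<close>.\<close>
    moreover have "card D * (e - 1) + e - 1 = card (insert i D) * (e - 1)"
      using insert.hyps f(2) by simp
    moreover have "pideal (range (F(i := g))) = pideal (range f)"
      using exchange_generator[OF _ bi g_def] i Fq(5) by simp
    ultimately have new: "complete_intersection (q(i := g)) (card (insert i D) * (e - 1))"
      "pideal (range (F(i := g))) = pideal (range f)" by simp_all
    show ?case
    proof (rule exI[of _ "F(i := g)"], rule exI[of _ "q(i := g)"], intro conjI)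
      show "(q(i := g)) i0 = l" using i Fq(1) by simp
      show "\<forall>j\<in>insert i D. (q(i := g)) j = (F(i := g)) j" using Fq(2) by simp
      show "\<forall>j. j \<notin> insert i D \<longrightarrow> j \<noteq> i0 \<longrightarrow> (q(i := g)) j = pvar j" using Fq(3) by simp
      show "\<forall>j. (F(i := g)) j \<in> forms e" using Fq(4) ge by simp
    qed (rule new)+
  qed
  from this[of "- {i0}"] obtain F q where Fq: "q i0 = l" "\<And>j. j \<noteq> i0 \<Longrightarrow> q j = F j"
      "\<And>j. F j \<in> forms e" "pideal (range F) = pideal (range f)"
      "complete_intersection q (card (- {i0}) * (e - 1))" by auto
  have "card (- {i0}) = CARD('n) - 1" by (simp add: Compl_eq_Diff_UNIV card_Diff_subset)
  moreover have "q = F(i0 := l)" using Fq(1,2) by auto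
  ultimately show ?thesis using Fq l1 lZ that by metis
qed

section \<open>Hilbert functions\<close>

lemma int_degree_cases [case_names neg nat]:
  fixes k :: int
  assumes "k < 0 \<Longrightarrow> P" "\<And>m. k = int m \<Longrightarrow> P"
  shows P
  using assms by (cases k) auto

lemma subspace_mult_preimage: "pv.subspace {y \<in> hom_comp k. h * y \<in> pideal G}"
proof (rule pv.subspaceI)
  fix c x assume "x \<in> {y \<in> hom_comp k. h * y \<in> pideal G}"
  moreover have "h * pscale c x = pconst c * (h * x)" by (simp add: pscale_def mult_ac)
  ultimately show "pscale c x \<in> {y \<in> hom_comp k. h * y \<in> pideal G}"
    by (auto intro: hom_comp_pscale pideal_mult)
qed (auto simp: distrib_left intro: hom_comp_add pideal_add)

text \<open>Dimension count for multiplication by \<open>h\<close> from degree \<open>j\<close> to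
  degree \<open>j + e\<close>, with kernel of dimension \<open>m\<close>. The degree is an integer
  because the dual degree may be negative.\<close>

lemma hilb_insert:
  assumes G: "graded (pideal G)" and h: "h \<in> forms e"
    and m: "has_qdim pscale {y \<in> hom_comp j. h * y \<in> pideal G} (pideal G \<inter> hom_comp j) m"
  shows "hilb (pideal (insert h G)) (j + int e) + hilb (pideal G) j = hilb (pideal G) (j + int e) + m"
proof -
  let ?I = "pideal G" and ?J = "pideal (insert h G)"
  let ?A = "{y \<in> hom_comp j. h * y \<in> ?I}"
  have IJ: "?I \<subseteq> ?J" by (rule pideal_mono) auto
  have sI: "pv.subspace (?I \<inter> hom_comp k)" and sJ: "pv.subspace (?J \<inter> hom_comp k)" for k
    by (auto intro: pv.subspace_inter)
  have IA: "?I \<inter> hom_comp j \<subseteq> ?A" by (auto intro: pideal_mult)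
  obtain r where r: "has_qdim pscale (hom_comp j) ?A r"
    using has_qdim_forms[OF subspace_mult_preimage] by blast
  have 1: "hilb ?I j = r + m"
    by (rule hilb_eqI[OF pv.has_qdim_add[OF r m _ IA subspace_mult_preimage]]) auto
  have "has_qdim pscale (hom_comp j) ?A r \<longleftrightarrow> has_qdim pscale (?J \<inter> hom_comp (j + e)) (?I \<inter> hom_comp (j + e)) r"
  proof (rule has_qdim_mult[where p = h])
    fix v :: "'a cpoly" assume v: "v \<in> hom_comp j"
    show hv: "h * v \<in> ?J \<inter> hom_comp (j + e)"
      using hom_comp_mult[OF h v] by (auto simp: add.commute intro: pideal_mult_right pideal_base)
    then show "h * v \<in> ?I \<inter> hom_comp (j + e) \<longleftrightarrow> v \<in> ?A" using v by auto
  next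
    fix x assume x: "x \<in> ?J \<inter> hom_comp (j + e)"
    have key: "\<exists>v\<in>hom_comp j. x - h * v \<in> ?I"
    proof (cases "j + e" rule: int_degree_cases)
      case neg
      then show ?thesis using x by (intro bexI[of _ 0]) (auto simp: hom_comp_neg)
    next
      case (nat k)
      have "x \<in> forms k" "x \<in> ?J" using x nat by auto
      from form_pideal_insert[OF G h this] show ?thesis
      proof cases
        case (1 a)
        have "int (k - e) = j" using nat 1(1) by simp
        then show ?thesis using 1 by (intro bexI[of _ a]) (auto simp: mult.commute)
      next
        case 2
        then show ?thesis by (intro bexI[of _ 0]) auto
      qed
    qed
    then obtain v where v: "v \<in> hom_comp j" "x - h * v \<in> ?I" by blast
    have "x - h * v \<in> hom_comp (j + e)"
      using x hom_comp_mult[OF h v(1)] by (auto simp: add.commute intro: hom_comp_diff)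
    with v show "\<exists>v\<in>hom_comp j. x - h * v \<in> ?I \<inter> hom_comp (j + e)" by blast
  qed (auto intro: pv.subspace_inter)
  with r have "has_qdim pscale (?J \<inter> hom_comp (j + e)) (?I \<inter> hom_comp (j + e)) r" by simp
  from pv.has_qdim_add[OF has_qdim_hilb this _ _ sJ] IJ
  have "hilb ?I (j + e) = hilb ?J (j + e) + r"
    by (intro hilb_eqI) auto
  with 1 show ?thesis by simp
qed

lemma hilb_insert_nonzerodivisor:
  assumes "graded (pideal G)" "h \<in> forms e" "nonzerodivisor h (pideal G)"
  shows "hilb (pideal (insert h G)) (j + int e) + hilb (pideal G) j = hilb (pideal G) (j + int e)"
proof -
  have "has_qdim pscale {y \<in> hom_comp j. h * y \<in> pideal G} (pideal G \<inter> hom_comp j) 0"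
    by (rule pv.has_qdim_0) (use assms(3) in \<open>auto simp: nonzerodivisor_def\<close>)
  from hilb_insert[OF assms(1,2) this] show ?thesis by simp
qed

text \<open>Adjoining a regular member of degree \<open>e\<close> replaces \<open>H(k)\<close> by
  \<open>H(k) - H(k - e)\<close>, a recursion that involves only degrees.\<close>

lemma hilb_regular_unique:
  assumes q: "regular_family q" "\<And>j. j \<in> R \<Longrightarrow> q j \<in> forms e"
    and q': "regular_family q'" "\<And>j. j \<in> R \<Longrightarrow> q' j \<in> forms e"
  shows "hilb (pideal (q ` R)) k = hilb (pideal (q' ` R)) k"
proof -
  have "finite R" by simp
  then show ?thesis using assms
  proof (induction R arbitrary: k)
    case (insert r R)
    have step: "hilb (pideal (p ` insert r R)) k + hilb (pideal (p ` R)) (k - e) = hilb (pideal (p ` R)) k"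
      if p: "regular_family p" "\<And>j. j \<in> insert r R \<Longrightarrow> p j \<in> forms e" for p
    proof -
      have "graded (pideal (p ` R))" by (rule graded_pideal) (use p(2) in auto)
      moreover have "nonzerodivisor (p r) (pideal (p ` R))"
        using p(1) insert.hyps by (simp add: regular_family_def)
      ultimately show ?thesis
        using hilb_insert_nonzerodivisor[of "p ` R" "p r" e "k - e"] p(2) by simp
    qed
    from step[OF insert.prems(1,2)] step[OF insert.prems(3,4)] insert.IH[of k] insert.IH[of "k - e"] insert.prems
    show ?case by simp
  qed simp
qed

section \<open>Duality modulo a regular sequence\<close>

text \<open>Removing \<open>l\<close> from the complete intersection \<open>q\<close> leaves the
  one-dimensional ring \<open>A\<close> modulo \<open>G\<close>, on which \<open>l\<close> is a
  non-zero-divisor; \<open>s\<close> is the socle degree of the Artinian quotient by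
  \<open>l\<close>.\<close>

locale one_dim_ci =
  fixes q :: "'n::finite \<Rightarrow> 'n cpoly" and s :: nat and i0 :: 'n and l :: "'n cpoly" and G :: "'n cpoly set"
  assumes ci: "complete_intersection q s" and l: "l \<in> forms 1" and ql: "q i0 = l"
    and G: "G = q ` (- {i0})"
begin

lemma gr: "graded (pideal G)"
  unfolding G by (rule complete_intersection_graded[OF ci])

lemma forms_G: "g \<in> G \<Longrightarrow> \<exists>a. g \<in> forms a"
  using ci unfolding G complete_intersection_def by blast

lemma nz: "nonzerodivisor l (pideal G)"
  using complete_intersection_nonzerodivisor[OF ci, of i0 "- {i0}"] by (simp add: ql G)

lemma lpow: "l ^ k \<in> forms k"
  using forms_power[OF l, of k] by simp

lemma nzp: "l ^ k * y \<in> pideal G \<Longrightarrow> y \<in> pideal G"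
  using nonzerodivisorD[OF nonzerodivisor_power[OF nz]] .

lemma range_q: "range q = insert l G"
  unfolding G ql[symmetric] by auto

lemma grQ: "graded (pideal (insert l G))"
  using complete_intersection_graded[OF ci, of UNIV] by (simp add: range_q)

lemma socle_generator:
  obtains u where "u \<in> forms s" "u \<notin> pideal (insert l G)"
    "\<And>k y. y \<in> forms k \<Longrightarrow> (\<And>i. pvar i * y \<in> pideal (insert l G)) \<Longrightarrow> \<exists>c. y - pscale c u \<in> pideal (insert l G)"
  using ci unfolding complete_intersection_def simple_socle_def range_q by blast

text \<open>Downward induction from a degree where the ideal contains all forms: a form of degree
  \<open>m > s\<close> lies in the socle by the induction hypothesis, and the socle lives in degree
  \<open>s\<close>.\<close>

lemma top_degree: "s < k \<Longrightarrow> forms k \<subseteq> pideal (insert l G)"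
proof -
  assume k: "s < k"
  obtain u where u: "u \<in> forms s"
    "\<And>k y. y \<in> forms k \<Longrightarrow> (\<And>i. pvar i * y \<in> pideal (insert l G)) \<Longrightarrow> \<exists>c. y - pscale c u \<in> pideal (insert l G)"
    using socle_generator by metis
  obtain N where N: "\<And>k. k \<ge> N \<Longrightarrow> forms k \<subseteq> pideal (insert l G)"
    using ci unfolding complete_intersection_def cofinite_ideal_def range_q by blast
  have "k \<le> max k N" by simp
  then show ?thesis using k
  proof (induction rule: inc_induct)
    case base
    then show ?case using N[of "max k N"] by simp
  next
    case (step m)
    show ?case
    proof
      fix y :: "'n cpoly" assume y: "y \<in> forms m"
      have "pvar i * y \<in> forms (Suc m)" for i using forms_mult[OF forms_pvar y] by simp
      then have "pvar i * y \<in> pideal (insert l G)" for i using step by auto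
      then obtain c where c: "y - pscale c u \<in> pideal (insert l G)" using u(2)[OF y] by blast
      \<comment> \<open>The component of degree \<open>m\<close> contains no contribution of
        \<open>u\<close>, which has degree \<open>s \<noteq> m\<close>.\<close>
      from graded_hpart[OF grQ c, of m] hom_comp_pscale[OF u(1), of c] step.prems step.hyps
      show "y \<in> pideal (insert l G)" by (simp add: hpart_diff hpart_form[OF y] hpart_form)
    qed
  qed
qed

lemma socle_spans:
  assumes u: "u \<in> forms s" "\<And>k y. y \<in> forms k \<Longrightarrow> (\<And>i. pvar i * y \<in> pideal (insert l G)) \<Longrightarrow> \<exists>c. y - pscale c u \<in> pideal (insert l G)"
    and y: "y \<in> forms s"
  shows "\<exists>c. y - pscale c u \<in> pideal (insert l G)"
proof (rule u(2)[OF y])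
  fix i
  have "pvar i * y \<in> forms (Suc s)" using forms_mult[OF forms_pvar y] by simp
  then show "pvar i * y \<in> pideal (insert l G)" using top_degree[of "Suc s"] by auto
qed

text \<open>Nondegeneracy of the pairing on an Artinian Gorenstein ring: as long as some variable
  does not kill \<open>y\<close>, multiply by it; the process stops in the socle, since degrees are
  bounded by \<open>s\<close>.\<close>

lemma socle_pairing:
  assumes u: "u \<in> forms s" "\<And>k y. y \<in> forms k \<Longrightarrow> (\<And>i. pvar i * y \<in> pideal (insert l G)) \<Longrightarrow> \<exists>c. y - pscale c u \<in> pideal (insert l G)"
    and y: "y \<in> forms j" "y \<notin> pideal (insert l G)"
  shows "j \<le> s \<and> (\<exists>z\<in>forms (s - j). \<exists>c. c \<noteq> 0 \<and> y * z - pscale c u \<in> pideal (insert l G))"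
  using y
proof (induction "Suc s - j" arbitrary: j y rule: less_induct)
  case less
  let ?Q = "pideal (insert l G)"
  have js: "j \<le> s" using top_degree[of j] less.prems by (meson not_le subsetD)
  show ?case
  proof (cases "\<forall>i. pvar i * y \<in> ?Q")
    case True
    then obtain c where c: "y - pscale c u \<in> ?Q" using u(2)[OF less.prems(1)] by blast
    have "j = s"
    proof (rule ccontr)
      assume "j \<noteq> s"
      with graded_hpart[OF grQ c, of j] hom_comp_pscale[OF u(1), of c] less.prems
      show False by (simp add: hpart_diff hpart_form[OF less.prems(1)] hpart_form)
    qed
    moreover have "c \<noteq> 0" using c less.prems(2) by auto
    ultimately show ?thesis using c js by (intro conjI bexI[of _ 1] exI[of _ c]) auto
  next
    case False
    then obtain i where i: "pvar i * y \<notin> ?Q" by blast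
    have "pvar i * y \<in> forms (Suc j)" using forms_mult[OF forms_pvar less.prems(1)] by simp
    moreover have "Suc s - Suc j < Suc s - j" using js by simp
    ultimately obtain z c where z: "Suc j \<le> s" "z \<in> forms (s - Suc j)" "c \<noteq> 0"
      "pvar i * y * z - pscale c u \<in> ?Q" using less.hyps i by blast
    have "pvar i * z \<in> forms (Suc 0 + (s - Suc j))" using forms_mult[OF forms_pvar z(2)] by simp
    moreover have "Suc 0 + (s - Suc j) = s - j" using z(1) by simp
    moreover have "y * (pvar i * z) - pscale c u \<in> ?Q" using z(4) by (simp add: mult_ac)
    ultimately show ?thesis using js z(3) by metis
  qed
qed

text \<open>Above degree \<open>s\<close> every form is a multiple of \<open>l\<close> modulo
  \<open>G\<close>, so degree \<open>s\<close> exhausts the localization at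
  \<open>l\<close>.\<close>

lemma divide_l_power: "s \<le> m \<Longrightarrow> x \<in> forms m \<Longrightarrow> \<exists>y\<in>forms s. x - l ^ (m - s) * y \<in> pideal G"
proof (induction m arbitrary: x rule: dec_induct)
  case base
  then show ?case by (intro bexI[of _ x]) simp_all
next
  case (step m)
  have "x \<in> pideal (insert l G)" using top_degree[of "Suc m"] step by auto
  from form_pideal_insertE[OF gr l step.prems this] obtain a where a: "a \<in> forms m" "x - l * a \<in> pideal G"
    by auto
  then obtain y where y: "y \<in> forms s" "a - l ^ (m - s) * y \<in> pideal G" using step.IH by blast
  from pideal_add[OF a(2) pideal_mult[OF y(2), of l]]
  have "x - l ^ (Suc m - s) * y \<in> pideal G" using step.hyps by (simp add: Suc_diff_le algebra_simps)
  with y show ?case by blast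
qed

text \<open>The functional \<open>\<phi>\<close> reads off the coefficient of the socle generator, modulo multiples of \<open>l\<close>.\<close>

lemma residue_functional:
  assumes L: "s \<le> L"
  obtains \<phi> :: "'n cpoly \<Rightarrow> complex" where
    "\<And>x y. x \<in> forms L \<Longrightarrow> y \<in> forms L \<Longrightarrow> \<phi> (x + y) = \<phi> x + \<phi> y"
    "\<And>c x. x \<in> forms L \<Longrightarrow> \<phi> (pscale c x) = c * \<phi> x"
    "\<And>x. x \<in> forms L \<Longrightarrow> \<phi> x = 0 \<longleftrightarrow> x \<in> pideal (insert (l ^ Suc (L - s)) G)"
proof -
  obtain u where u: "u \<in> forms s" "u \<notin> pideal (insert l G)"
    "\<And>k y. y \<in> forms k \<Longrightarrow> (\<And>i. pvar i * y \<in> pideal (insert l G)) \<Longrightarrow> \<exists>c. y - pscale c u \<in> pideal (insert l G)"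
    using socle_generator by metis
  let ?W = "pideal (insert (l ^ Suc (L - s)) G)"
  have sW: "pv.subspace (?W \<inter> forms L)" by (intro pv.subspace_inter) auto
  have "has_qdim pscale (forms L) (?W \<inter> forms L) 1"
  proof (rule pv.has_qdim_1[where b = "l ^ (L - s) * u"])
    show "l ^ (L - s) * u \<in> forms L" using forms_mult[OF lpow u(1), of "L - s"] L by simp
    show "l ^ (L - s) * u \<notin> ?W \<inter> forms L"
    proof
      assume "l ^ (L - s) * u \<in> ?W \<inter> forms L"
      then obtain a where "l ^ (L - s) * u - a * l ^ Suc (L - s) \<in> pideal G" by (auto simp: pideal_insert)
      then have "l ^ (L - s) * (u - a * l) \<in> pideal G" by (simp add: algebra_simps)
      with u(2) nzp show False by (auto simp: pideal_insert)
    qed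
    fix x :: "'n cpoly" assume x: "x \<in> forms L"
    then obtain y where y: "y \<in> forms s" "x - l ^ (L - s) * y \<in> pideal G" using divide_l_power[OF L] by blast
    have "\<exists>c. y - pscale c u \<in> pideal (insert l G)"
      by (rule socle_spans[OF u(1) _ y(1)]) (use u(3) in blast)
    then obtain c where "y - pscale c u \<in> pideal (insert l G)" by blast
    then obtain a where a: "y - pscale c u - a * l \<in> pideal G" by (auto simp: pideal_insert)
    from pideal_add[OF y(2) pideal_mult[OF a, of "l ^ (L - s)"]]
    have "x - pscale c (l ^ (L - s) * u) - a * l ^ Suc (L - s) \<in> pideal G"
      by (simp add: algebra_simps pscale_def)
    moreover have "pscale c (l ^ (L - s) * u) \<in> forms L"
      using hom_comp_pscale[OF forms_mult[OF lpow u(1), of "L - s"]] L by simp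
    ultimately show "\<exists>c. x - pscale c (l ^ (L - s) * u) \<in> ?W \<inter> forms L"
      using x by (auto simp: pideal_insert intro!: exI[of _ c] hom_comp_diff)
  qed (rule sW)
  then show ?thesis
  proof (rule pv.has_qdim_coordinates[OF _ subspace_hom_comp sW inf_le2])
    fix \<phi> :: "nat \<Rightarrow> 'n cpoly \<Rightarrow> complex"
    assume \<phi>: "\<And>i x y. i < 1 \<Longrightarrow> x \<in> forms L \<Longrightarrow> y \<in> forms L \<Longrightarrow> \<phi> i (x + y) = \<phi> i x + \<phi> i y"
      "\<And>i c x. i < 1 \<Longrightarrow> x \<in> forms L \<Longrightarrow> \<phi> i (pscale c x) = c * \<phi> i x"
      "?W \<inter> forms L = {x \<in> forms L. \<forall>i<1. \<phi> i x = 0}"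
    show ?thesis
    proof (rule that[of "\<phi> 0"])
      fix x :: "'n cpoly" assume "x \<in> forms L"
      with \<phi>(3) show "\<phi> 0 x = 0 \<longleftrightarrow> x \<in> ?W" by auto
    qed (use \<phi> in auto)
  qed
qed

text \<open>The annihilator of \<open>A_k\<close>, embedded in degree \<open>K\<close> by a power of
  \<open>l\<close>, under the residue pairing with degree \<open>b\<close>. With
  \<open>t = b + k + 1 - s\<close>, an element \<open>l^t * a\<close> of degree \<open>b\<close> has
  \<open>a\<close> of degree \<open>s - 1 - k\<close>, which is the duality between
  \<open>A_k\<close> and \<open>A_(s-1-k)\<close> inside the localization. The other exponent,
  \<open>Suc (K + b - s)\<close>, describes the kernel of the residue in degree
  \<open>K + b\<close>.\<close>

lemma annihilator_step:
  assumes K: "k \<le> K" "s \<le> b" and y: "y \<in> forms b"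
  shows "(\<forall>x\<in>forms k. l ^ (K - k) * x * y \<in> pideal (insert (l ^ Suc (K + b - s)) G)) \<longleftrightarrow>
    y \<in> pideal (insert (l ^ (b + k + 1 - s)) G)"
proof
  let ?t = "b + k + 1 - s"
  assume "y \<in> pideal (insert (l ^ ?t) G)"
  then obtain a where a: "y - a * l ^ ?t \<in> pideal G" by (auto simp: pideal_insert)
  have e: "Suc (K + b - s) = (K - k) + ?t" using K by simp
  have "l ^ (K - k) * x * y - (x * a) * l ^ Suc (K + b - s) \<in> pideal G" for x
    using pideal_mult[OF a, of "l ^ (K - k) * x"] unfolding e power_add by (simp add: algebra_simps)
  then show "\<forall>x\<in>forms k. l ^ (K - k) * x * y \<in> pideal (insert (l ^ Suc (K + b - s)) G)"
    unfolding pideal_insert by blast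
next
  let ?t = "b + k + 1 - s"
  assume ann: "\<forall>x\<in>forms k. l ^ (K - k) * x * y \<in> pideal (insert (l ^ Suc (K + b - s)) G)"
  show "y \<in> pideal (insert (l ^ ?t) G)"
  proof (rule ccontr)
    assume no: "y \<notin> pideal (insert (l ^ ?t) G)"
    obtain u where u: "u \<in> forms s" "u \<notin> pideal (insert l G)"
      "\<And>k y. y \<in> forms k \<Longrightarrow> (\<And>i. pvar i * y \<in> pideal (insert l G)) \<Longrightarrow> \<exists>c. y - pscale c u \<in> pideal (insert l G)"
      using socle_generator by metis
    have "y \<in> pideal (insert (l ^ 0) G)"
      using pideal_mult[OF pideal_base, of 1 "insert 1 G" y] by simp
    moreover have "\<exists>r<?t. y \<in> pideal (insert (l ^ r) G) \<and> y \<notin> pideal (insert (l ^ Suc r) G)"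
      if "y \<in> pideal (insert (l ^ 0) G)"
    proof (rule ccontr)
      assume H: "\<not> ?thesis"
      have "r \<le> ?t \<Longrightarrow> y \<in> pideal (insert (l ^ r) G)" for r
      proof (induction r)
        case 0
        show ?case by (rule that)
      next
        case (Suc r)
        then have "r < ?t" "y \<in> pideal (insert (l ^ r) G)" by simp_all
        with H show ?case by blast
      qed
      with no show False by blast
    qed
    \<comment> \<open>\<open>r\<close> is the exact power of \<open>l\<close> dividing
      \<open>y\<close> modulo \<open>G\<close>, assumed to be less than required.\<close>
    ultimately obtain r where r: "r < ?t" "y \<in> pideal (insert (l ^ r) G)" "y \<notin> pideal (insert (l ^ Suc r) G)"
      by blast
    have "y \<notin> pideal G" using no pideal_mono[of G "insert (l ^ ?t) G"] by blast
    with form_pideal_insert[OF gr lpow y r(2)]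
    obtain y' where y': "r \<le> b" "y' \<in> forms (b - r)" "y - y' * l ^ r \<in> pideal G" by blast
    have "y' \<notin> pideal (insert l G)"
    proof
      assume "y' \<in> pideal (insert l G)"
      then obtain a where a: "y' - a * l \<in> pideal G" by (auto simp: pideal_insert)
      from pideal_add[OF y'(3) pideal_mult[OF a, of "l ^ r"]]
      have "y - a * l ^ Suc r \<in> pideal G" by (simp add: algebra_simps)
      with r(3) show False unfolding pideal_insert by blast
    qed
    then have "b - r \<le> s \<and> (\<exists>z\<in>forms (s - (b - r)). \<exists>c. c \<noteq> 0 \<and> y' * z - pscale c u \<in> pideal (insert l G))"
      by (intro socle_pairing[OF u(1) _ y'(2)]) (use u(3) in blast)+
    then obtain z c where
      z: "b - r \<le> s" "z \<in> forms (s - (b - r))" "c \<noteq> 0" "y' * z - pscale c u \<in> pideal (insert l G)" by blast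
    \<comment> \<open>The partner \<open>z\<close> of \<open>y'\<close> has degree
      \<open>s - (b - r)\<close>, at most \<open>k\<close> because \<open>r\<close> is below the
      required exponent; a power of \<open>l\<close> fills it up to degree \<open>k\<close>.\<close>
    define t' where "t' = k - (s - (b - r))"
    have kt: "t' + (s - (b - r)) = k" using r(1) z(1) y'(1) K by (simp add: t'_def)
    have "l ^ t' * z \<in> forms k" using forms_mult[OF lpow z(2), of t'] unfolding kt .
    with ann have "l ^ (K - k) * (l ^ t' * z) * y \<in> pideal (insert (l ^ Suc (K + b - s)) G)" by blast
    then obtain a where a: "l ^ (K - k) * (l ^ t' * z) * y - a * l ^ Suc (K + b - s) \<in> pideal G"
      by (auto simp: pideal_insert)
    \<comment> \<open>This total power of \<open>l\<close> can be cancelled, which puts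
      \<open>y' * z\<close>, a nonzero multiple of the socle generator, into the ideal of
      \<open>l\<close> and \<open>G\<close>.\<close>
    have e: "K + b - s = (K - k) + (t' + r)" using kt z(1) y'(1) K by simp
    from pideal_diff[OF a pideal_mult[OF y'(3), of "l ^ (K - k) * l ^ t' * z"]]
    have "l ^ (K + b - s) * (y' * z - a * l) \<in> pideal G"
      unfolding power_Suc e power_add by (simp add: algebra_simps)
    then have 1: "y' * z - a * l \<in> pideal G" by (rule nzp)
    obtain d where d: "y' * z - pscale c u - d * l \<in> pideal G" using z(4) by (auto simp: pideal_insert)
    from pideal_diff[OF 1 d] have "pscale c u - (a - d) * l \<in> pideal G" by (simp add: algebra_simps)
    then have "pconst (inverse c) * pscale c u - pconst (inverse c) * ((a - d) * l) \<in> pideal G"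
      by (metis pideal_mult right_diff_distrib)
    moreover have "pconst (inverse c) * pscale c u = u"
      using z(3) by (simp add: pscale_def mult.assoc[symmetric] pconst_mult[symmetric])
    ultimately have "u - (pconst (inverse c) * (a - d)) * l \<in> pideal G" by (simp add: mult.assoc)
    with u(2) show False unfolding pideal_insert by blast
  qed
qed

lemma form_high_power:
  assumes "y \<in> forms b" "b < t" shows "y \<in> pideal (insert (l ^ t) G) \<longleftrightarrow> y \<in> pideal G"
  using form_pideal_insert[OF gr lpow assms(1), of t] assms(2) pideal_mono[of G "insert (l ^ t) G"] by auto

text \<open>An instance of \<open>has_qdim_annihilator\<close> in which degrees \<open>K\<close> and
  \<open>s\<close> both represent the localization, paired by the residue of the product. The
  subspace \<open>?U\<close> is \<open>A_k + h A\<close> seen in degree \<open>K\<close>; its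
  annihilator is the annihilator of \<open>h\<close> in degree \<open>j\<close>, multiplied by a
  power of \<open>l\<close>.\<close>

theorem duality:
  assumes h: "h \<in> forms e" and j: "j = int s - 1 - int k" and K: "s + e + k \<le> K"
    and m: "has_qdim pscale (forms K) {x \<in> forms K. x \<in> pideal (insert (l ^ (K - k)) (insert h G))} m"
  shows "has_qdim pscale {y \<in> hom_comp j. h * y \<in> pideal G} (pideal G \<inter> hom_comp j) m"
proof -
  \<comment> \<open>The least degree allowed in \<open>annihilator_step\<close>, and by
    \<open>divide_l_power\<close> already large enough to represent the localization.\<close>
  define b where "b = s"
  let ?I = "pideal G" and ?L = "K + b"
  let ?U = "{x \<in> forms K. x \<in> pideal (insert (l ^ (K - k)) (insert h G))}"
  have "s \<le> ?L" using K by simp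
  from residue_functional[OF this] obtain \<phi> :: "'n cpoly \<Rightarrow> complex" where
    \<phi>: "\<And>x y. x \<in> forms ?L \<Longrightarrow> y \<in> forms ?L \<Longrightarrow> \<phi> (x + y) = \<phi> x + \<phi> y"
    "\<And>c x. x \<in> forms ?L \<Longrightarrow> \<phi> (pscale c x) = c * \<phi> x"
    "\<And>x. x \<in> forms ?L \<Longrightarrow> \<phi> x = 0 \<longleftrightarrow> x \<in> pideal (insert (l ^ Suc (?L - s)) G)"
    by blast
  let ?W = "pideal (insert (l ^ Suc (?L - s)) G)"
  have IW: "?I \<subseteq> ?W" by (rule pideal_mono) auto
  have xy: "x * y \<in> forms ?L" if "x \<in> forms K" "y \<in> forms b" for x y using forms_mult[OF that] .
  have Y0: "?I \<inter> forms b = {y \<in> forms b. \<forall>x\<in>forms K. \<phi> (x * y) = 0}"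
  proof -
    have "(\<forall>x\<in>forms K. \<phi> (x * y) = 0) \<longleftrightarrow> y \<in> ?I" if y: "y \<in> forms b" for y
    proof -
      have "(\<forall>x\<in>forms K. \<phi> (x * y) = 0) \<longleftrightarrow> (\<forall>x\<in>forms K. x * y \<in> ?W)"
        by (rule ball_cong[OF refl], rule \<phi>(3), rule xy[OF _ y])
      also have "\<dots> \<longleftrightarrow> y \<in> pideal (insert (l ^ (b + K + 1 - s)) G)"
        using annihilator_step[of K K b y] y by (simp add: b_def)
      also have "\<dots> \<longleftrightarrow> y \<in> ?I" by (rule form_high_power[OF y]) (use K in \<open>simp add: b_def\<close>)
      finally show ?thesis .
    qed
    then show ?thesis by auto
  qed
  have X0: "?I \<inter> forms K = {x \<in> forms K. \<forall>y\<in>forms b. \<phi> (x * y) = 0}"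
  proof -
    have "(\<forall>y\<in>forms b. \<phi> (x * y) = 0) \<longleftrightarrow> x \<in> ?I" if x: "x \<in> forms K" for x
    proof -
      have "(\<forall>y\<in>forms b. \<phi> (x * y) = 0) \<longleftrightarrow> (\<forall>y\<in>forms b. y * x \<in> ?W)"
        unfolding mult.commute[of _ x] by (rule ball_cong[OF refl], rule \<phi>(3), rule xy[OF x])
      also have "\<dots> \<longleftrightarrow> x \<in> pideal (insert (l ^ (K + b + 1 - s)) G)"
        using annihilator_step[of b b K x] x K by (simp add: b_def add.commute[of s K])
      also have "\<dots> \<longleftrightarrow> x \<in> ?I" by (rule form_high_power[OF x]) (use K in \<open>simp add: b_def\<close>)
      finally show ?thesis .
    qed
    then show ?thesis by auto
  qed
  have lin: "\<phi> ((x + x') * y) = \<phi> (x * y) + \<phi> (x' * y)" "\<phi> (pscale c x * y) = c * \<phi> (x * y)"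
    if "x \<in> forms K" "x' \<in> forms K" "y \<in> forms b" for x x' y c
  proof -
    show "\<phi> ((x + x') * y) = \<phi> (x * y) + \<phi> (x' * y)"
      unfolding distrib_right by (rule \<phi>(1)[OF xy[OF that(1,3)] xy[OF that(2,3)]])
    have "pscale c x * y = pscale c (x * y)" by (simp add: pscale_def mult.assoc)
    with \<phi>(2)[OF xy[OF that(1,3)]] show "\<phi> (pscale c x * y) = c * \<phi> (x * y)" by simp
  qed
  have lin': "\<phi> (x * (y + y')) = \<phi> (x * y) + \<phi> (x * y')" "\<phi> (x * pscale c y) = c * \<phi> (x * y)"
    if "x \<in> forms K" "y \<in> forms b" "y' \<in> forms b" for x y y' c
  proof -
    show "\<phi> (x * (y + y')) = \<phi> (x * y) + \<phi> (x * y')"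
      unfolding distrib_left by (rule \<phi>(1)[OF xy[OF that(1,2)] xy[OF that(1,3)]])
    have "x * pscale c y = pscale c (x * y)" by (simp add: pscale_def mult.left_commute)
    with \<phi>(2)[OF xy[OF that(1,2)]] show "\<phi> (x * pscale c y) = c * \<phi> (x * y)" by simp
  qed
  have "has_qdim pscale {y \<in> forms b. \<forall>u\<in>?U. \<phi> (u * y) = 0} (?I \<inter> forms b) m"
  proof (rule pv.has_qdim_annihilator[OF _ _ _ _ _ _ _ X0 Y0 has_qdim_hilb _ _ m])
    show "pv.subspace ?U"
      using pv.subspace_inter[OF subspace_hom_comp[of "int K"] subspacev_pideal[of "insert (l ^ (K - k)) (insert h G)"]]
      by (simp add: Int_def)
    show "?I \<inter> forms K \<subseteq> ?U" using pideal_mono[of G "insert (l ^ (K - k)) (insert h G)"] by auto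
  qed (use lin lin' in auto)
  moreover have "{y \<in> forms b. \<forall>u\<in>?U. \<phi> (u * y) = 0} =
      {y \<in> forms b. y \<in> pideal (insert (l ^ (b + k + 1 - s)) G) \<and> h * y \<in> ?I}"
  proof -
    have "(\<forall>u\<in>?U. \<phi> (u * y) = 0) \<longleftrightarrow> y \<in> pideal (insert (l ^ (b + k + 1 - s)) G) \<and> h * y \<in> ?I"
      if y: "y \<in> forms b" for y
    proof -
      have hy: "h * y \<in> forms (b + e)" using forms_mult[OF h y] by (simp add: add.commute)
      have a1: "(\<forall>x\<in>forms k. l ^ (K - k) * x * y \<in> ?W) \<longleftrightarrow> y \<in> pideal (insert (l ^ (b + k + 1 - s)) G)"
        by (rule annihilator_step) (use y K in \<open>auto simp: b_def\<close>)
      \<comment> \<open>A full degree is paired with \<open>h * y\<close>. The exponent equals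
        \<open>K + 1\<close>, beyond the degree \<open>b + e\<close>, so only membership in
        \<open>?I\<close> remains.\<close>
      have "(\<forall>x\<in>forms (K - e). x * (h * y) \<in> ?W) \<longleftrightarrow> h * y \<in> pideal (insert (l ^ (b + e + (K - e) + 1 - s)) G)"
        using annihilator_step[of "K - e" "K - e" "b + e" "h * y"] hy K by (simp add: b_def)
      also have "\<dots> \<longleftrightarrow> h * y \<in> ?I" by (rule form_high_power[OF hy]) (use K in \<open>simp add: b_def\<close>)
      finally have a2: "(\<forall>x\<in>forms (K - e). x * (h * y) \<in> ?W) \<longleftrightarrow> h * y \<in> ?I" .
      \<comment> \<open>In degree \<open>K\<close>, \<open>?U\<close> consists of sums of
        \<open>l ^ (K - k) * x1\<close>, \<open>h * x2\<close> and an element of \<open>?I\<close>,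
        so the condition splits into two.\<close>
      have "(\<forall>u\<in>?U. u * y \<in> ?W) \<longleftrightarrow> (\<forall>x\<in>forms k. l ^ (K - k) * x * y \<in> ?W) \<and> (\<forall>x\<in>forms (K - e). x * (h * y) \<in> ?W)"
      proof (intro iffI conjI ballI)
        fix x :: "'n cpoly" assume U: "\<forall>u\<in>?U. u * y \<in> ?W" and x: "x \<in> forms k"
        have "l ^ (K - k) * x \<in> forms K" using forms_mult[OF lpow x, of "K - k"] K by simp
        moreover have "l ^ (K - k) * x \<in> pideal (insert (l ^ (K - k)) (insert h G))"
          by (intro pideal_mult_right pideal_base) auto
        ultimately show "l ^ (K - k) * x * y \<in> ?W" using U by blast
      next
        fix x :: "'n cpoly" assume U: "\<forall>u\<in>?U. u * y \<in> ?W" and x: "x \<in> forms (K - e)"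
        have "x * h \<in> forms K" using forms_mult[OF x h] K by simp
        moreover have "x * h \<in> pideal (insert (l ^ (K - k)) (insert h G))"
          by (intro pideal_mult pideal_base) auto
        ultimately have "x * h * y \<in> ?W" using U by blast
        then show "x * (h * y) \<in> ?W" by (simp add: mult.assoc)
      next
        fix x assume a: "(\<forall>x\<in>forms k. l ^ (K - k) * x * y \<in> ?W) \<and> (\<forall>x\<in>forms (K - e). x * (h * y) \<in> ?W)"
          and x: "x \<in> ?U"
        have grh: "graded (pideal (insert h G))"
          by (rule graded_pideal) (use forms_G h in blast)
        have "K - k \<le> K" by simp
        from form_pideal_insertE[OF grh lpow _ _ this, of x] x
        obtain x1 where x1: "x1 \<in> forms (K - (K - k))" "x - l ^ (K - k) * x1 \<in> pideal (insert h G)" by blast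
        have kk: "K - (K - k) = k" using K by simp
        have "x - l ^ (K - k) * x1 \<in> forms K"
          using x forms_mult[OF lpow x1(1), of "K - k"] K by (intro hom_comp_diff) auto
        from form_pideal_insertE[OF gr h this x1(2)] K
        obtain x2 where x2: "x2 \<in> forms (K - e)" "x - l ^ (K - k) * x1 - h * x2 \<in> ?I" by auto
        have "x * y = (x - l ^ (K - k) * x1 - h * x2) * y + l ^ (K - k) * x1 * y + x2 * (h * y)"
          by (simp add: algebra_simps)
        also have "\<dots> \<in> ?W"
          using a x1(1) x2(1) IW pideal_mult_right[OF x2(2), of y] unfolding kk by (intro pideal_add) auto
        finally show "x * y \<in> ?W" .
      qed
      moreover have "(\<forall>u\<in>?U. \<phi> (u * y) = 0) \<longleftrightarrow> (\<forall>u\<in>?U. u * y \<in> ?W)"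
        using \<phi>(3) xy y by (metis (no_types, lifting) mem_Collect_eq)
      ultimately show ?thesis using a1 a2 by simp
    qed
    then show ?thesis by blast
  qed
  ultimately have q: "has_qdim pscale {y \<in> forms b. y \<in> pideal (insert (l ^ (b + k + 1 - s)) G) \<and> h * y \<in> ?I} (?I \<inter> forms b) m"
    by simp
  show ?thesis
  proof (cases j rule: int_degree_cases)
    case neg
    \<comment> \<open>For negative \<open>j\<close> the required power of \<open>l\<close> exceeds
      the degree \<open>b\<close>, so the annihilator is trivial and \<open>m = 0\<close>.\<close>
    then have "b < b + k + 1 - s" using j by (simp add: b_def)
    then have "{y \<in> forms b. y \<in> pideal (insert (l ^ (b + k + 1 - s)) G) \<and> h * y \<in> ?I} \<subseteq> ?I \<inter> forms b"
      using form_high_power by blast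
    moreover have "pv.subspace (?I \<inter> forms b)" by (intro pv.subspace_inter) auto
    ultimately have "m = 0" using pv.has_qdim_unique[OF q pv.has_qdim_0] by blast
    then show ?thesis using neg by (auto intro!: pv.has_qdim_0 simp: hom_comp_neg)
  next
    case (nat j')
    then have e: "b + k + 1 - s = b - j'" "j' \<le> b" using j by (auto simp: b_def)
    \<comment> \<open>Cancelling \<open>l ^ (b - j')\<close> moves the annihilator down to its
      natural degree \<open>j'\<close>.\<close>
    have "has_qdim pscale {y \<in> forms j'. h * y \<in> ?I} (?I \<inter> forms j') m \<longleftrightarrow>
      has_qdim pscale {y \<in> forms b. y \<in> pideal (insert (l ^ (b + k + 1 - s)) G) \<and> h * y \<in> ?I} (?I \<inter> forms b) m"
      unfolding e(1)
    proof (rule has_qdim_mult[where p = "l ^ (b - j')"])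
      show "pv.subspace {y \<in> forms j'. h * y \<in> ?I}" by (rule subspace_mult_preimage)
      fix v assume v: "v \<in> {y \<in> forms j'. h * y \<in> ?I}"
      have lv: "l ^ (b - j') * v \<in> forms b" using forms_mult[OF lpow, of v j' "b - j'"] v e by simp
      have "h * (l ^ (b - j') * v) \<in> ?I"
        by (subst mult.left_commute, rule pideal_mult) (use v in simp)
      then show "l ^ (b - j') * v \<in> {y \<in> forms b. y \<in> pideal (insert (l ^ (b - j')) G) \<and> h * y \<in> ?I}"
        using lv by (auto intro: pideal_mult_right pideal_base)
      show "l ^ (b - j') * v \<in> ?I \<inter> forms b \<longleftrightarrow> v \<in> ?I \<inter> forms j'"
        using lv v nzp by (auto intro: pideal_mult)
    next
      fix x assume x: "x \<in> {y \<in> forms b. y \<in> pideal (insert (l ^ (b - j')) G) \<and> h * y \<in> ?I}"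
      have "b - j' \<le> b" by simp
      from form_pideal_insertE[OF gr lpow _ _ this, of x] x
      obtain v where v: "v \<in> forms (b - (b - j'))" "x - l ^ (b - j') * v \<in> ?I" by blast
      have bb: "b - (b - j') = j'" using e(2) by simp
      have "l ^ (b - j') * (h * v) = h * x - h * (x - l ^ (b - j') * v)" by (simp add: algebra_simps)
      also have "\<dots> \<in> ?I" by (rule pideal_diff[OF _ pideal_mult[OF v(2)]]) (use x in simp)
      finally have "h * v \<in> ?I" by (rule nzp)
      moreover have "x - l ^ (b - j') * v \<in> forms b"
        using x forms_mult[OF lpow v(1), of "b - j'"] e(2) by (intro hom_comp_diff) auto
      ultimately show "\<exists>v\<in>{y \<in> forms j'. h * y \<in> ?I}. x - l ^ (b - j') * v \<in> ?I \<inter> forms b"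
        using v unfolding bb by blast
    qed (auto intro: pv.subspace_inter)
    with q nat show ?thesis by simp
  qed
qed

text \<open>The image of \<open>S_k\<close> in degree \<open>K\<close> of the quotient by
  \<open>insert h G\<close>, under multiplication by a power of \<open>l\<close>, has dimension
  \<open>r\<close>. What remains of that degree has dimension \<open>m\<close>, which
  \<open>duality\<close> identifies with the annihilator of \<open>h\<close> and
  \<open>hilb_insert\<close> turns into Hilbert functions.\<close>

theorem hilb_duality:
  assumes h: "h \<in> forms e" and j: "j = int s - 1 - int k" and K: "s + e + k \<le> K"
    and r: "has_qdim pscale (forms k) {y \<in> forms k. l ^ (K - k) * y \<in> pideal (insert h G)} r"
  shows "hilb (pideal (insert h G)) (j + int e) + hilb (pideal G) j + r =
    hilb (pideal G) (j + int e) + hilb (pideal (insert h G)) (int K)"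
proof -
  let ?J = "pideal (insert h G)"
  let ?U = "{x \<in> forms K. x \<in> pideal (insert (l ^ (K - k)) (insert h G))}"
  have grh: "graded ?J" by (rule graded_pideal) (use forms_G h in blast)
  have sU: "pv.subspace ?U"
    using pv.subspace_inter[OF subspace_hom_comp[of "int K"] subspacev_pideal[of "insert (l ^ (K - k)) (insert h G)"]]
    by (simp add: Int_def)
  obtain m where m: "has_qdim pscale (forms K) ?U m"
    using has_qdim_forms[OF sU] by blast
  have "has_qdim pscale (forms k) {y \<in> forms k. l ^ (K - k) * y \<in> ?J} r \<longleftrightarrow>
    has_qdim pscale ?U (?J \<inter> forms K) r"
  proof (rule has_qdim_mult[where p = "l ^ (K - k)"])
    fix v :: "'n cpoly" assume v: "v \<in> forms k"
    have "l ^ (K - k) * v \<in> forms K" using forms_mult[OF lpow v, of "K - k"] K by simp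
    then show "l ^ (K - k) * v \<in> ?U"
      "l ^ (K - k) * v \<in> ?J \<inter> forms K \<longleftrightarrow> v \<in> {y \<in> forms k. l ^ (K - k) * y \<in> ?J}"
      using v by (auto intro: pideal_mult_right pideal_base)
  next
    fix x assume x: "x \<in> ?U"
    have "K - k \<le> K" by simp
    from form_pideal_insertE[OF grh lpow _ _ this, of x] x
    obtain v where v: "v \<in> forms (K - (K - k))" "x - l ^ (K - k) * v \<in> ?J" by blast
    have kk: "K - (K - k) = k" using K by simp
    have "x - l ^ (K - k) * v \<in> forms K"
      using x forms_mult[OF lpow v(1), of "K - k"] K by (intro hom_comp_diff) auto
    with v show "\<exists>v\<in>forms k. x - l ^ (K - k) * v \<in> ?J \<inter> forms K" unfolding kk by blast
  qed (auto intro: pv.subspace_inter)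
  with r have "has_qdim pscale ?U (?J \<inter> forms K) r" by simp
  from pv.has_qdim_add[OF m this _ _ sU] pideal_mono[of "insert h G" "insert (l ^ (K - k)) (insert h G)"]
  have "hilb ?J (int K) = m + r" by (intro hilb_eqI) auto
  with hilb_insert[OF gr h duality[OF h j K m]] show ?thesis by simp
qed

text \<open>Duality for \<open>h = 0\<close>, which annihilates everything.\<close>

lemma hilb_symmetric:
  assumes j: "j = int s - 1 - int k" and K: "s + k \<le> K"
  shows "hilb (pideal G) j + hilb (pideal G) (int k) = hilb (pideal G) (int K)"
proof -
  have e: "pideal (insert 0 G) = pideal G" by (auto simp: pideal_insert)
  have "{y \<in> forms k. l ^ (K - k) * y \<in> pideal (insert 0 G)} = pideal G \<inter> forms k"
    unfolding e using nzp by (auto intro: pideal_mult)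
  then have r: "has_qdim pscale (forms k) {y \<in> forms k. l ^ (K - k) * y \<in> pideal (insert 0 G)} (hilb (pideal G) (int k))"
    using has_qdim_hilb[of "pideal G"] by simp
  have "0 \<in> forms 0" by simp
  from hilb_duality[OF this j _ r] K show ?thesis unfolding e by simp
qed

text \<open>From degree \<open>s\<close> on, multiplication by \<open>l\<close> is onto, so the
  Hilbert function of the quotient does not increase; once it has reached its minimum,
  \<open>l\<close> is injective as well.\<close>

lemma stable_range:
  assumes h: "h \<in> forms e"
  obtains K0 where "\<And>m y. m \<ge> K0 \<Longrightarrow> y \<in> forms m \<Longrightarrow> l * y \<in> pideal (insert h G) \<Longrightarrow> y \<in> pideal (insert h G)"
proof -
  let ?J = "pideal (insert h G)"
  let ?H = "\<lambda>m. hilb ?J (int m)"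
  let ?W = "\<lambda>m. {y \<in> forms m. l * y \<in> ?J}"
  have grh: "graded ?J" by (rule graded_pideal) (use forms_G h in blast)
  have IW: "?J \<inter> forms m \<subseteq> ?W m" for m by (auto intro: pideal_mult)
  have split: "\<exists>k. has_qdim pscale (?W m) (?J \<inter> forms m) k \<and> ?H m = ?H (Suc m) + k" if m: "s \<le> m" for m
  proof -
    have "has_qdim pscale (forms m) (?W m) n \<longleftrightarrow>
      has_qdim pscale (forms (Suc m)) (?J \<inter> forms (Suc m)) n" for n
    proof (rule has_qdim_mult[where p = l])
      fix v :: "'n cpoly" assume v: "v \<in> forms m"
      show lv: "l * v \<in> forms (Suc m)" using forms_mult[OF l v] by simp
      show "l * v \<in> ?J \<inter> forms (Suc m) \<longleftrightarrow> v \<in> ?W m" using lv v by auto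
    next
      fix x :: "'n cpoly" assume x: "x \<in> forms (Suc m)"
      have "x \<in> pideal (insert l G)" using top_degree[of "Suc m"] m x by auto
      then have "x \<in> pideal (insert l (insert h G))"
        using pideal_mono[of "insert l G" "insert l (insert h G)"] by auto
      from form_pideal_insertE[OF grh l x this] obtain y where y: "y \<in> forms m" "x - l * y \<in> ?J" by auto
      have "x - l * y \<in> forms (Suc m)"
        using forms_mult[OF l y(1)] by (intro hom_comp_diff[OF x]) simp
      with y show "\<exists>v\<in>forms m. x - l * v \<in> ?J \<inter> forms (Suc m)" by blast
    qed (auto intro: pv.subspace_inter)
    then have qW: "has_qdim pscale (forms m) (?W m) (?H (Suc m))"
      by (rule iffD2) (rule has_qdim_hilb, simp)
    have "\<exists>k\<le>?H m. has_qdim pscale (?W m) (?J \<inter> forms m) k"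
      by (rule pv.has_qdim_sub[OF has_qdim_hilb subspace_hom_comp _ subspace_mult_preimage IW])
        (auto intro: pv.subspace_inter)
    then obtain k where k: "has_qdim pscale (?W m) (?J \<inter> forms m) k" by blast
    from hilb_eqI[OF pv.has_qdim_add[OF qW k _ IW subspace_mult_preimage]] k show ?thesis by auto
  qed
  \<comment> \<open>A degree at which the Hilbert function is minimal among degrees from
    \<open>s\<close> on.\<close>
  obtain K0 where K0: "s \<le> K0" "\<And>m. s \<le> m \<Longrightarrow> ?H K0 \<le> ?H m"
    using ex_has_least_nat[of "\<lambda>m. s \<le> m" s ?H] by auto
  have const: "?H m = ?H K0" if "K0 \<le> m" for m
    using that
  proof (induction rule: dec_induct)
    case (step m)
    then have sm: "s \<le> m" using K0(1) by simp
    from split[OF sm] step.IH K0(2)[of "Suc m"] sm show ?case by auto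
  qed simp
  show ?thesis
  proof (rule that[of K0])
    fix m y assume m: "K0 \<le> m" and y: "y \<in> forms m" "l * y \<in> ?J"
    obtain k where k: "has_qdim pscale (?W m) (?J \<inter> forms m) k" "?H m = ?H (Suc m) + k"
      using split[of m] m K0(1) by auto
    have "k = 0" using k(2) const[of m] const[of "Suc m"] m by simp
    with k(1) have "?W m \<subseteq> ?J" using pv.has_qdim_0D by blast
    with y show "y \<in> ?J" by blast
  qed
qed

end

section \<open>Saturation\<close>

lemma power_in_ideal_power: "p \<in> max_ideal \<Longrightarrow> p ^ m \<in> ideal_power max_ideal m"
proof (induction m)
  case (Suc m)
  then have "p ^ m * p \<in> ideal_power max_ideal (Suc m)" by (auto intro!: pideal_base)
  then show ?case by (simp add: mult.commute)
qed simp

lemma max_ideal_eq: "max_ideal = pideal (range pvar)"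
  by (simp add: max_ideal_def full_SetCompr_eq)

lemma hpart_0_max_ideal: "g \<in> max_ideal \<Longrightarrow> hpart 0 g = 0"
  unfolding max_ideal_eq pideal_def
  by (induction g rule: pid.span_induct_alt) (auto simp: hpart_add hpart_mult_form[OF forms_pvar])

lemma hpart_mult: "hpart k (f * g) = (\<Sum>i\<le>k. hpart i f * hpart (k - i) g)"
proof -
  have "hpart k (f * g) = hpart k (\<Sum>i\<le>pdeg g. f * hpart i g)"
    by (simp add: sum_hpart flip: sum_distrib_left)
  also have "\<dots> = (\<Sum>i\<le>pdeg g. if i \<le> k then hpart (k - i) f * hpart i g else 0)"
    by (simp add: hpart_sum hpart_mult_form[OF hpart_in])
  also have "\<dots> = (\<Sum>i\<le>k. hpart (k - i) f * hpart i g)"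
  proof -
    have "(\<Sum>i\<le>pdeg g. if i \<le> k then hpart (k - i) f * hpart i g else 0)
        = (\<Sum>i\<le>max k (pdeg g). if i \<le> k then hpart (k - i) f * hpart i g else 0)"
      by (rule sum.mono_neutral_left) (auto simp: hpart_eq_0)
    also have "\<dots> = (\<Sum>i\<le>k. hpart (k - i) f * hpart i g)"
      by (rule sum.mono_neutral_cong_right) auto
    finally show ?thesis .
  qed
  also have "\<dots> = (\<Sum>i\<le>k. hpart i f * hpart (k - i) g)"
    by (rule sum.reindex_bij_witness[of _ "\<lambda>i. k - i" "\<lambda>i. k - i"]) auto
  finally show ?thesis .
qed

text \<open>Translates the recursive ideal powers in \<open>saturation\<close> into a lower bound
  for degrees.\<close>

lemma hpart_ideal_power:
  fixes g :: "'n::finite cpoly"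
  shows "g \<in> ideal_power max_ideal m \<Longrightarrow> k < m \<Longrightarrow> hpart k g = 0"
proof (induction m arbitrary: g k)
  case (Suc m)
  have gen: "hpart k (a * b) = 0" if "a \<in> ideal_power max_ideal m" "b \<in> max_ideal" "k < Suc m" for a b :: "'n cpoly" and k
    unfolding hpart_mult
  proof (rule sum.neutral, rule ballI)
    fix i assume i: "i \<in> {..k}"
    show "hpart i a * hpart (k - i) b = 0"
    proof (cases "i < m")
      case True
      then show ?thesis using Suc.IH[OF that(1)] by simp
    next
      case False
      then have "k - i = 0" using i that(3) by simp
      then show ?thesis using hpart_0_max_ideal[OF that(2)] by simp
    qed
  qed
  have "\<forall>k<Suc m. hpart k g = 0"
    using Suc.prems(1) unfolding ideal_power.simps pideal_def
  proof (induction g rule: pid.span_induct_alt)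
    case (step c x y)
    have "hpart k (c * x) = 0" if "k < Suc m" for k
      unfolding hpart_mult by (rule sum.neutral) (use step(1) gen that in auto)
    with step show ?case by (simp add: hpart_add)
  qed simp
  with Suc.prems show ?case by blast
qed simp

context one_dim_ci
begin

text \<open>A single power of \<open>l\<close> tests membership in the saturation. Powers of the
  maximal ideal contain powers of \<open>l\<close>, which can be cancelled in stable degrees;
  conversely, forms of high degree are multiples of a given power of \<open>l\<close> modulo
  \<open>G\<close>.\<close>

lemma saturation_forms:
  assumes h: "h \<in> forms e"
  obtains K0 where "\<And>k K. K \<ge> K0 \<Longrightarrow> K \<ge> k \<Longrightarrow>
    saturation (pideal (insert h G)) \<inter> forms k = {y \<in> forms k. l ^ (K - k) * y \<in> pideal (insert h G)}"
proof -
  let ?J = "pideal (insert h G)"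
  obtain K0 where K0: "\<And>m y. m \<ge> K0 \<Longrightarrow> y \<in> forms m \<Longrightarrow> l * y \<in> ?J \<Longrightarrow> y \<in> ?J"
    using stable_range[OF h] by metis
  have K0': "l ^ t * y \<in> ?J \<Longrightarrow> y \<in> ?J" if "m \<ge> K0" "y \<in> forms m" for m y t
  proof (induction t)
    case (Suc t)
    have "l ^ t * y \<in> forms (t + m)" by (rule forms_mult[OF lpow that(2)])
    with K0[of "t + m" "l ^ t * y"] Suc that(1) show ?case by (simp add: mult.assoc)
  qed simp
  have IJ: "pideal G \<subseteq> ?J" by (rule pideal_mono) auto
  show ?thesis
  proof (rule that[of K0])
    fix k K assume K: "K \<ge> K0" "K \<ge> k"
    show "saturation ?J \<inter> forms k = {y \<in> forms k. l ^ (K - k) * y \<in> ?J}"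
    proof (intro set_eqI iffI)
      fix y assume y: "y \<in> saturation ?J \<inter> forms k"
      then obtain m where m: "\<And>g. g \<in> ideal_power max_ideal m \<Longrightarrow> g * y \<in> ?J" by (auto simp: saturation_def)
      have "l \<in> max_ideal" using forms_in_max_ideal[OF l] by (simp add: max_ideal_eq)
      then have "l ^ m * y \<in> ?J" by (intro m power_in_ideal_power)
      then have "l ^ m * (l ^ (K - k) * y) \<in> ?J"
        using pideal_mult[of "l ^ m * y" _ "l ^ (K - k)"] by (simp add: mult_ac)
      moreover have "l ^ (K - k) * y \<in> forms K"
        using forms_mult[OF lpow, of y k "K - k"] y K by simp
      ultimately show "y \<in> {y \<in> forms k. l ^ (K - k) * y \<in> ?J}" using K0' K y by blast
    next
      fix y assume y: "y \<in> {y \<in> forms k. l ^ (K - k) * y \<in> ?J}"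
      \<comment> \<open>A component of degree \<open>t\<close> is \<open>l ^ (t - s) * z\<close>
        modulo \<open>G\<close>; from \<open>t = s + (K - k)\<close> on, it contains the factor
        \<open>l ^ (K - k)\<close>.\<close>
      have "g * y \<in> ?J" if g: "g \<in> ideal_power max_ideal (s + (K - k))" for g
      proof -
        have "hpart t g * y \<in> ?J" for t
        proof (cases "t < s + (K - k)")
          case True
          then show ?thesis using hpart_ideal_power[OF g] by simp
        next
          case False
          then have st: "s \<le> t" by simp
          obtain z where z: "hpart t g - l ^ (t - s) * z \<in> pideal G"
            using divide_l_power[OF st hpart_in] by blast
          have "hpart t g * y = (hpart t g - l ^ (t - s) * z) * y + (z * l ^ (t - s - (K - k))) * (l ^ (K - k) * y)"
          proof -
            have "l ^ (t - s) = l ^ (t - s - (K - k)) * l ^ (K - k)" using False by (simp flip: power_add)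
            then show ?thesis by (simp add: algebra_simps)
          qed
          also have "\<dots> \<in> ?J"
            by (rule pideal_add[OF subsetD[OF IJ pideal_mult_right[OF z]] pideal_mult]) (use y in simp)
          finally show ?thesis .
        qed
        then have "(\<Sum>t\<le>pdeg g. hpart t g * y) \<in> ?J" by (intro pideal_sum)
        then show ?thesis by (simp add: sum_hpart flip: sum_distrib_right)
      qed
      then show "y \<in> saturation ?J \<inter> forms k" using y by (auto simp: saturation_def)
    qed
  qed
qed

end

section \<open>Partial derivatives\<close>

text \<open>Carries facts about polynomial derivatives over to the generators of
  \<open>tjurina_ideal\<close>.\<close>

lemma lookup_pdiff: "lkp (pdiff j f) = series_diff j (lkp f)"
proof
  fix m
  have "lkp (pdiff j f) m = (\<Sum>k\<in>Poly_Mapping.keys f.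
      if k = m + Poly_Mapping.single j 1 then of_nat (lkp k j) * lkp f k else 0)"
    unfolding pdiff_def lookup_sum
  proof (rule sum.cong[OF refl])
    fix k assume "k \<in> Poly_Mapping.keys f"
    show "lkp (Poly_Mapping.single (k - Poly_Mapping.single j 1) (of_nat (lkp k j) * lkp f k)) m =
        (if k = m + Poly_Mapping.single j 1 then of_nat (lkp k j) * lkp f k else 0)"
    proof (cases "lkp k j = 0")
      case False
      have "(k - Poly_Mapping.single j 1) + Poly_Mapping.single j 1 = k"
        by (rule poly_mapping_eqI) (use False in \<open>auto simp: lookup_add lookup_minus lookup_single when_def\<close>)
      then have "k - Poly_Mapping.single j 1 = m \<longleftrightarrow> k = m + Poly_Mapping.single j 1"
        by (metis add_diff_cancel_right')
      then show ?thesis by (simp add: lookup_single when_def)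
    qed (auto simp: lookup_add)
  qed
  also have "\<dots> = series_diff j (lkp f) m"
    by (auto simp: series_diff_def in_keys_iff lookup_add)
  finally show "lkp (pdiff j f) m = series_diff j (lkp f) m" .
qed

lemma pdiff_add: "pdiff j (f + g) = pdiff j f + pdiff j g"
  by (rule poly_mapping_eqI) (simp add: lookup_pdiff lookup_add series_diff_def algebra_simps)

lemma pdiff_0 [simp]: "pdiff j 0 = 0"
  by (simp add: pdiff_def)

lemma pdiff_single:
  "pdiff j (Poly_Mapping.single m c) = Poly_Mapping.single (m - Poly_Mapping.single j 1) (of_nat (lkp m j) * c)"
  by (cases "c = 0") (simp_all add: pdiff_def)

lemma single_minus_add:
  assumes "lkp m j \<noteq> 0"
  shows "m - Poly_Mapping.single j 1 + k = m + k - Poly_Mapping.single j (1::nat)"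
  by (rule poly_mapping_eqI) (use assms in \<open>auto simp: lookup_add lookup_minus lookup_single when_def\<close>)

lemma pdiff_mult: "pdiff j (f * g) = pdiff j f * g + f * pdiff j g"
proof (induction f rule: cpoly_induct)
  case (single m c)
  show ?case
  proof (induction g rule: cpoly_induct)
    case (single k d)
    have "Poly_Mapping.single (m + k - Poly_Mapping.single j 1) (of_nat (lkp m j + lkp k j) * (c * d)) =
      Poly_Mapping.single (m - Poly_Mapping.single j 1 + k) (of_nat (lkp m j) * c * d) +
      Poly_Mapping.single (m + (k - Poly_Mapping.single j 1)) (c * (of_nat (lkp k j) * d))"
    proof -
      have "Poly_Mapping.single (m - Poly_Mapping.single j 1 + k) (of_nat (lkp m j) * c * d) =
        Poly_Mapping.single (m + k - Poly_Mapping.single j 1) (of_nat (lkp m j) * c * d)"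
        by (cases "lkp m j = 0") (simp, subst single_minus_add, assumption, rule refl)
      moreover have "Poly_Mapping.single (m + (k - Poly_Mapping.single j 1)) (c * (of_nat (lkp k j) * d)) =
        Poly_Mapping.single (m + k - Poly_Mapping.single j 1) (c * (of_nat (lkp k j) * d))"
        using single_minus_add[of k j m] by (cases "lkp k j = 0") (simp_all add: add.commute)
      ultimately show ?thesis by (simp add: single_add[symmetric] algebra_simps)
    qed
    then show ?case by (simp add: mult_single pdiff_single lookup_add)
  qed (simp add: pdiff_add algebra_simps)
qed (simp add: pdiff_add algebra_simps)

lemma pdiff_pconst [simp]: "pdiff j (pconst c) = 0"
  by (simp add: pconst_def pdiff_single)

lemma pdiff_pvar: "pdiff j (pvar k) = (if j = k then 1 else 0)"
  by (simp add: pvar_def pdiff_single lookup_single when_def)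

lemma lookup_pvar_mult_pdiff: "lkp (pvar j * pdiff j f) m = of_nat (lkp m j) * lkp f m"
proof (induction f rule: cpoly_induct)
  case (single k c)
  have "pvar j * pdiff j (Poly_Mapping.single k c) = Poly_Mapping.single k (of_nat (lkp k j) * c)"
  proof (cases "lkp k j = 0")
    case False
    have "Poly_Mapping.single j 1 + (k - Poly_Mapping.single j 1) = k"
      by (rule poly_mapping_eqI) (use False in \<open>auto simp: lookup_add lookup_minus lookup_single when_def\<close>)
    then show ?thesis by (simp add: pdiff_single pvar_def mult_single)
  qed (simp add: pdiff_single)
  then show ?case by (simp add: lookup_single when_def)
qed (simp add: pdiff_add lookup_add algebra_simps)

lemma euler_formula:
  assumes "f \<in> forms d"
  shows "(\<Sum>j\<in>UNIV. pvar j * pdiff j f) = pconst (of_nat d) * f"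
proof (rule poly_mapping_eqI)
  fix m
  have "lkp (\<Sum>j\<in>UNIV. pvar j * pdiff j f) m = of_nat (mdeg m) * lkp f m"
    by (simp add: lookup_sum lookup_pvar_mult_pdiff mdeg_def sum_distrib_right)
  also have "\<dots> = lkp (pconst (of_nat d) * f) m"
    using hom_compD[OF assms, of m] by (cases "lkp f m = 0") (simp_all add: lookup_pconst_mult)
  finally show "lkp (\<Sum>j\<in>UNIV. pvar j * pdiff j f) m = lkp (pconst (of_nat d) * f) m" .
qed

lemma pdiff_forms:
  assumes "f \<in> forms d"
  shows "pdiff j f \<in> forms (d - 1)"
proof (rule hom_compI)
  fix m assume "lkp (pdiff j f) m \<noteq> 0"
  then have "lkp f (m + Poly_Mapping.single j 1) \<noteq> 0" by (auto simp: lookup_pdiff series_diff_def)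
  from hom_compD[OF assms this] show "int (mdeg m) = int (d - 1)" by simp
qed

section \<open>Convergent power series\<close>

lemma finite_decompositions: "finite {(k, l). k + l = (m :: 'n::finite mono)}"
proof (rule finite_subset)
  show "{(k, l). k + l = m} \<subseteq> {k. mdeg k \<le> mdeg m} \<times> {l. mdeg l \<le> mdeg m}" by auto
  show "finite ({k. mdeg k \<le> mdeg m} \<times> {l :: 'n mono. mdeg l \<le> mdeg m})"
    by (intro finite_cartesian_product finite_mdeg_le)
qed

lemma series_mult_cong:
  assumes "\<And>k. mdeg k \<le> mdeg m \<Longrightarrow> a k = a' k" "\<And>k. mdeg k \<le> mdeg m \<Longrightarrow> b k = b' k"
  shows "series_mult a b m = series_mult a' b' m"
  unfolding series_mult_def by (rule sum.cong) (use assms in auto)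

lemma series_mult_add_left: "series_mult (a + b) c = series_mult a c + series_mult b c"
  by (rule ext) (simp add: series_mult_def split_def algebra_simps sum.distrib)

lemma series_mult_add_right: "series_mult c (a + b) = series_mult c a + series_mult c b"
  by (rule ext) (simp add: series_mult_def split_def algebra_simps sum.distrib)

lemma lookup_mult_series: "lkp (f * g) = series_mult (lkp f) (lkp g)" for f g :: "'n::finite cpoly"
proof (induction f rule: cpoly_induct)
  case (single k c)
  show ?case
  proof (induction g rule: cpoly_induct)
    case (single l d)
    show ?case
    proof
      fix m
      have "series_mult (lkp (Poly_Mapping.single k c)) (lkp (Poly_Mapping.single l d)) m =
          (\<Sum>x\<in>{(k, l). k + l = m}. if x = (k, l) then c * d else 0)"
        unfolding series_mult_def
        by (rule sum.cong) (auto simp: lookup_single when_def split: if_splits)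
      also have "\<dots> = lkp (Poly_Mapping.single k c * Poly_Mapping.single l d) m"
        using finite_decompositions[of m] by (simp add: mult_single lookup_single when_def)
      finally show "lkp (Poly_Mapping.single k c * Poly_Mapping.single l d) m =
        series_mult (lkp (Poly_Mapping.single k c)) (lkp (Poly_Mapping.single l d)) m" ..
    qed
  next
    case (add g1 g2)
    let ?f = "Poly_Mapping.single k c"
    have "lkp (?f * (g1 + g2)) = lkp (?f * g1) + lkp (?f * g2)"
      by (rule ext) (simp add: distrib_left lookup_add)
    also have "\<dots> = series_mult (lkp ?f) (lkp g1 + lkp g2)"
      by (simp only: add series_mult_add_right)
    also have "lkp g1 + lkp g2 = lkp (g1 + g2)" by (rule ext) (simp add: lookup_add)
    finally show ?case .
  qed
next
  case (add f1 f2)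
  have "lkp ((f1 + f2) * g) = lkp (f1 * g) + lkp (f2 * g)"
    by (rule ext) (simp add: distrib_right lookup_add)
  also have "\<dots> = series_mult (lkp f1 + lkp f2) (lkp g)"
    by (simp only: add series_mult_add_left)
  also have "lkp f1 + lkp f2 = lkp (f1 + f2)" by (rule ext) (simp add: lookup_add)
  finally show ?case .
qed

definition trunc :: "nat \<Rightarrow> 'n::finite series \<Rightarrow> 'n cpoly" where
  "trunc N a = (\<Sum>m\<in>{m. mdeg m \<le> N}. Poly_Mapping.single m (a m))"

lemma lookup_trunc: "lkp (trunc N a) m = (if mdeg m \<le> N then a m else 0)"
proof -
  have "lkp (trunc N a) m = (\<Sum>k\<in>{m. mdeg m \<le> N}. if k = m then a m else 0)"
    unfolding trunc_def lookup_sum by (rule sum.cong) (auto simp: lookup_single when_def)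
  then show ?thesis using finite_mdeg_le[of N, where 'n = 'a] by simp
qed

text \<open>A coefficient of a product depends only on coefficients of no larger degree, so the ring
  laws for series follow from those for polynomials.\<close>

lemma series_mult_trunc:
  "mdeg m \<le> N \<Longrightarrow> series_mult a b m = lkp (trunc N a * trunc N b) m"
  unfolding lookup_mult_series by (rule series_mult_cong) (auto simp: lookup_trunc)

lemma series_mult_assoc: "series_mult (series_mult a b) c = series_mult a (series_mult b c)"
  for a b c :: "'n::finite series"
proof
  fix m :: "'n mono"
  let ?t = "trunc (mdeg m)"
  have "series_mult (series_mult a b) c m = series_mult (lkp (?t a * ?t b)) (lkp (?t c)) m"
    by (rule series_mult_cong) (auto simp: series_mult_trunc lookup_trunc)
  also have "\<dots> = series_mult (lkp (?t a)) (lkp (?t b * ?t c)) m"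
    by (simp only: lookup_mult_series[symmetric] mult.assoc)
  also have "\<dots> = series_mult a (series_mult b c) m"
    by (rule series_mult_cong) (auto simp: series_mult_trunc lookup_trunc)
  finally show "series_mult (series_mult a b) c m = series_mult a (series_mult b c) m" .
qed

lemma series_mult_commute: "series_mult a b = series_mult b a" for a b :: "'n::finite series"
proof
  fix m :: "'n mono"
  show "series_mult a b m = series_mult b a m"
    using series_mult_trunc[of m "mdeg m" a b] series_mult_trunc[of m "mdeg m" b a] by (simp add: mult.commute)
qed

lemma series_mult_1 [simp]: "series_mult (lkp 1) a = a" for a :: "'n::finite series"
proof
  fix m :: "'n mono"
  have "series_mult (lkp 1) a m = series_mult (lkp 1) (lkp (trunc (mdeg m) a)) m"
    by (rule series_mult_cong) (auto simp: lookup_trunc)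
  then show "series_mult (lkp 1) a m = a m"
    by (simp only: lookup_mult_series[symmetric]) (simp add: lookup_trunc)
qed

lemma sum_fun_apply: "(\<Sum>j\<in>A. f j) x = (\<Sum>j\<in>A. f j x)"
  for f :: "'a \<Rightarrow> 'b \<Rightarrow> 'c::comm_monoid_add"
  by (induction A rule: infinite_finite_induct) simp_all

lemma lookup_plus: "lkp (f + g) = lkp f + lkp g" and lookup_zero_fun: "lkp 0 = 0"
  for f g :: "'n::finite cpoly"
  by (auto simp: fun_eq_iff lookup_add)

lemma lookup_diff: "lkp (f - g) = lkp f - lkp g" for f g :: "'n::finite cpoly"
  by (auto simp: fun_eq_iff lookup_minus)

lemma lookup_sum_fun: "lkp (sum f A) = (\<Sum>x\<in>A. lkp (f x))" for f :: "'a \<Rightarrow> 'n::finite cpoly"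
  by (rule ext) (simp add: lookup_sum sum_fun_apply)

lemma series_mult_zero [simp]: "series_mult a 0 = 0" "series_mult 0 a = 0"
  by (rule ext, simp add: series_mult_def split_def)+

lemma series_mult_diff_right: "series_mult c (a - b) = series_mult c a - series_mult c b"
  using series_mult_add_right[of c "a - b" b] by simp

lemma series_mult_sum_right: "series_mult c (\<Sum>x\<in>A. f x) = (\<Sum>x\<in>A. series_mult c (f x))"
proof
  fix m
  show "series_mult c (\<Sum>x\<in>A. f x) m = (\<Sum>x\<in>A. series_mult c (f x)) m"
    unfolding series_mult_def sum_fun_apply split_def sum_distrib_left by (rule sum.swap)
qed

lemma series_scale_mult: "series_scale c a = series_mult (lkp (pconst c)) a"
  for a :: "'n::finite series"
proof
  fix m :: "'n mono"
  have "series_mult (lkp (pconst c)) a m = series_mult (lkp (pconst c)) (lkp (trunc (mdeg m) a)) m"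
    by (rule series_mult_cong) (auto simp: lookup_trunc)
  then show "series_scale c a m = series_mult (lkp (pconst c)) a m"
    by (simp only: lookup_mult_series[symmetric]) (simp add: lookup_trunc lookup_pconst_mult series_scale_def)
qed

interpretation sv: vector_space "series_scale :: complex \<Rightarrow> 'n::finite series \<Rightarrow> 'n series"
  by standard (auto simp: series_scale_def fun_eq_iff algebra_simps)

section \<open>Absolute convergence and closure properties\<close>

definition in_vars :: "'n::finite set \<Rightarrow> 'n series \<Rightarrow> bool" where
  "in_vars V a \<longleftrightarrow> (\<forall>m. a m \<noteq> 0 \<longrightarrow> Poly_Mapping.keys m \<subseteq> V)"

definition abs_summable_radius :: "'n::finite series \<Rightarrow> real \<Rightarrow> bool" where
  "abs_summable_radius a r \<longleftrightarrow> (\<lambda>m. norm (a m) * r ^ mdeg m) summable_on UNIV"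

lemma conv_series_iff:
  "a \<in> conv_series V \<longleftrightarrow> in_vars V a \<and> (\<exists>r>0. abs_summable_radius a r)"
  by (simp add: conv_series_def in_vars_def abs_summable_radius_def)

lemma abs_summable_radius_mono:
  assumes "abs_summable_radius a r" "0 \<le> r'" "r' \<le> r"
  shows "abs_summable_radius a r'"
  unfolding abs_summable_radius_def
proof (rule summable_on_comparison_test)
  show "(\<lambda>m. norm (a m) * r ^ mdeg m) summable_on UNIV" using assms(1) by (simp add: abs_summable_radius_def)
qed (use assms in \<open>auto intro!: mult_left_mono power_mono\<close>)

lemma abs_summable_radius_boundI:
  assumes "r \<ge> 0" "\<And>F. finite F \<Longrightarrow> (\<Sum>m\<in>F. norm (a m) * r ^ mdeg m) \<le> C"
  shows "abs_summable_radius a r"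
  unfolding abs_summable_radius_def
  by (rule nonneg_bounded_partial_sums_imp_summable_on[of _ _ C])
    (use assms in \<open>auto simp: eventually_finite_subsets_at_top intro!: exI[of _ "{}"]\<close>)

lemma abs_summable_radius_bound:
  assumes "abs_summable_radius a r" "r \<ge> 0"
  obtains C where "\<And>F. finite F \<Longrightarrow> (\<Sum>m\<in>F. norm (a m) * r ^ mdeg m) \<le> C" "C \<ge> 0"
proof
  let ?C = "infsum (\<lambda>m. norm (a m) * r ^ mdeg m) UNIV"
  show "(\<Sum>m\<in>F. norm (a m) * r ^ mdeg m) \<le> ?C" if "finite F" for F
    by (rule finite_sum_le_infsum) (use assms that in \<open>auto simp: abs_summable_radius_def\<close>)
  show "?C \<ge> 0" by (rule infsum_nonneg) (use assms in auto)
qed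

lemma conv_series_common_radius:
  assumes "a \<in> conv_series V" "b \<in> conv_series V"
  obtains r where "r > 0" "abs_summable_radius a r" "abs_summable_radius b r"
proof -
  obtain r1 r2 where r: "r1 > 0" "abs_summable_radius a r1" "r2 > 0" "abs_summable_radius b r2"
    using assms by (auto simp: conv_series_iff)
  then show ?thesis
    by (intro that[of "min r1 r2"]) (auto intro: abs_summable_radius_mono)
qed

lemma conv_series_add:
  assumes "a \<in> conv_series V" "b \<in> conv_series V"
  shows "a + b \<in> conv_series V"
proof -
  obtain r where r: "r > 0" "abs_summable_radius a r" "abs_summable_radius b r"
    using conv_series_common_radius[OF assms] .
  have "(\<lambda>m. norm (a m) * r ^ mdeg m + norm (b m) * r ^ mdeg m) summable_on UNIV"
    using r by (intro summable_on_add) (auto simp: abs_summable_radius_def)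
  then have "abs_summable_radius (a + b) r" unfolding abs_summable_radius_def
    by (rule summable_on_comparison_test)
      (use r in \<open>auto simp: distrib_right[symmetric] intro!: mult_right_mono norm_triangle_ineq\<close>)
  moreover have "in_vars V (a + b)" using assms by (force simp: conv_series_iff in_vars_def)
  ultimately show ?thesis using r by (auto simp: conv_series_iff)
qed

lemma keys_add_mono: "Poly_Mapping.keys (k + l) = Poly_Mapping.keys k \<union> Poly_Mapping.keys l"
  for k l :: "'n mono"
  by (auto simp: in_keys_iff lookup_add)

lemma in_vars_mult: "in_vars V a \<Longrightarrow> in_vars V b \<Longrightarrow> in_vars V (series_mult a b)"
  unfolding in_vars_def
proof (intro allI impI)
  fix m assume ab: "\<forall>m. a m \<noteq> 0 \<longrightarrow> Poly_Mapping.keys m \<subseteq> V" "\<forall>m. b m \<noteq> 0 \<longrightarrow> Poly_Mapping.keys m \<subseteq> V"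
    and m: "series_mult a b m \<noteq> 0"
  obtain x where "x \<in> {(k, l). k + l = m}" "(case x of (k, l) \<Rightarrow> a k * b l) \<noteq> 0"
    by (rule sum.not_neutral_contains_not_neutral[OF m[unfolded series_mult_def]])
  then obtain k l where "k + l = m" "a k * b l \<noteq> 0" by (cases x) auto
  with ab show "Poly_Mapping.keys m \<subseteq> V" using keys_add_mono by fastforce
qed

text \<open>The decompositions of finitely many monomials lie in a finite rectangle of index pairs,
  over which the double sum is at most the product of the two bounds.\<close>

lemma conv_series_mult:
  fixes a b :: "'n::finite series"
  assumes "a \<in> conv_series V" "b \<in> conv_series V"
  shows "series_mult a b \<in> conv_series V"
proof -
  obtain r where r: "r > 0" "abs_summable_radius a r" "abs_summable_radius b r"
    using conv_series_common_radius[OF assms] .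
  obtain A where A: "\<And>F. finite F \<Longrightarrow> (\<Sum>m\<in>F. norm (a m) * r ^ mdeg m) \<le> A" "A \<ge> 0"
    using abs_summable_radius_bound[OF r(2)] r(1) by (metis less_imp_le)
  obtain B where B: "\<And>F. finite F \<Longrightarrow> (\<Sum>m\<in>F. norm (b m) * r ^ mdeg m) \<le> B" "B \<ge> 0"
    using abs_summable_radius_bound[OF r(3)] r(1) by (metis less_imp_le)
  let ?a = "\<lambda>k. norm (a k) * r ^ mdeg k" and ?b = "\<lambda>k. norm (b k) * r ^ mdeg k"
  have "abs_summable_radius (series_mult a b) r"
  proof (rule abs_summable_radius_boundI)
    fix F :: "'n mono set" assume F: "finite F"
    let ?D = "\<lambda>m. {(k, l). k + l = (m :: 'n mono)}"
    let ?P = "\<Union>m\<in>F. ?D m"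
    have fP: "finite ?P" using F finite_decompositions by auto
    have "(\<Sum>m\<in>F. norm (series_mult a b m) * r ^ mdeg m) \<le> (\<Sum>m\<in>F. \<Sum>(k, l)\<in>?D m. ?a k * ?b l)"
    proof (rule sum_mono)
      fix m
      have "norm (series_mult a b m) * r ^ mdeg m \<le> (\<Sum>(k, l)\<in>?D m. norm (a k * b l)) * r ^ mdeg m"
        unfolding series_mult_def split_def
        by (intro mult_right_mono norm_sum) (use r in auto)
      also have "\<dots> = (\<Sum>(k, l)\<in>?D m. ?a k * ?b l)"
        unfolding sum_distrib_right by (rule sum.cong) (auto simp: norm_mult power_add)
      finally show "norm (series_mult a b m) * r ^ mdeg m \<le> (\<Sum>(k, l)\<in>?D m. ?a k * ?b l)" .
    qed
    also have "\<dots> = (\<Sum>(k, l)\<in>?P. ?a k * ?b l)"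
      by (rule sum.UNION_disjoint[symmetric]) (use F finite_decompositions in auto)
    also have "\<dots> \<le> (\<Sum>(k, l)\<in>fst ` ?P \<times> snd ` ?P. ?a k * ?b l)"
      by (rule sum_mono2) (use fP r in \<open>force+\<close>)
    also have "\<dots> = (\<Sum>k\<in>fst ` ?P. ?a k) * (\<Sum>l\<in>snd ` ?P. ?b l)"
      by (simp add: sum_product sum.cartesian_product)
    also have "\<dots> \<le> A * B"
      by (intro mult_mono A B) (use fP r A in \<open>auto intro!: sum_nonneg\<close>)
    finally show "(\<Sum>m\<in>F. norm (series_mult a b m) * r ^ mdeg m) \<le> A * B" .
  qed (use r in simp)
  moreover have "in_vars V (series_mult a b)"
    using assms by (intro in_vars_mult) (auto simp: conv_series_iff)
  ultimately show ?thesis using r(1) by (auto simp: conv_series_iff)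
qed

lemma conv_series_poly: "in_vars V (lkp f) \<Longrightarrow> lkp f \<in> conv_series V"
  unfolding conv_series_iff abs_summable_radius_def
  by (auto intro!: exI[of _ 1] finite_nonzero_values_imp_summable_on
      intro: finite_subset[OF _ finite_keys[of f]] simp: in_keys_iff)

lemma in_vars_pconst [simp]: "in_vars V (lkp (pconst c))"
  by (auto simp: in_vars_def pconst_def lookup_single when_def)

lemma in_vars_1 [simp]: "in_vars V (lkp 1)"
  using in_vars_pconst[of V 1] by simp

lemma in_vars_0 [simp]: "in_vars V (lkp 0)"
  by (simp add: in_vars_def)

lemma in_vars_pvar: "j \<in> V \<Longrightarrow> in_vars V (lkp (pvar j))"
  by (auto simp: in_vars_def pvar_def lookup_single when_def split: if_splits)

lemma in_vars_add: "in_vars V (lkp f) \<Longrightarrow> in_vars V (lkp g) \<Longrightarrow> in_vars V (lkp (f + g))"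
  unfolding in_vars_def lookup_add by (metis add_0)

lemma in_vars_mult_poly: "in_vars V (lkp f) \<Longrightarrow> in_vars V (lkp g) \<Longrightarrow> in_vars V (lkp (f * g))"
  by (simp add: lookup_mult_series in_vars_mult)

lemma in_vars_power: "in_vars V (lkp f) \<Longrightarrow> in_vars V (lkp (f ^ k))"
  by (induction k) (simp_all add: in_vars_mult_poly)

lemma in_vars_sum: "(\<And>x. x \<in> A \<Longrightarrow> in_vars V (lkp (f x))) \<Longrightarrow> in_vars V (lkp (sum f A))"
  by (induction A rule: infinite_finite_induct) (simp_all add: in_vars_add)

lemma in_vars_trunc: "in_vars V a \<Longrightarrow> in_vars V (lkp (trunc N a))"
  by (simp add: in_vars_def lookup_trunc)

lemma conv_series_scale: "a \<in> conv_series V \<Longrightarrow> series_scale c a \<in> conv_series V"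
  unfolding series_scale_mult by (intro conv_series_mult conv_series_poly in_vars_pconst)

lemma conv_series_zero: "0 \<in> conv_series V"
  using conv_series_poly[OF in_vars_0] unfolding lookup_zero_fun .

lemma subspace_conv_series: "sv.subspace (conv_series V)"
  by (rule sv.subspaceI) (auto intro: conv_series_add conv_series_scale conv_series_zero)

section \<open>Weighted norms and inversion of units\<close>

text \<open>The weighted sum of absolute coefficients; its submultiplicativity controls the
  geometric series below.\<close>

definition pnorm :: "real \<Rightarrow> 'n::finite cpoly \<Rightarrow> real" where
  "pnorm r f = (\<Sum>m\<in>Poly_Mapping.keys f. norm (lkp f m) * r ^ mdeg m)"

lemma pnorm_superset:
  assumes "finite A" "Poly_Mapping.keys f \<subseteq> A"
  shows "pnorm r f = (\<Sum>m\<in>A. norm (lkp f m) * r ^ mdeg m)"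
  unfolding pnorm_def by (rule sum.mono_neutral_left) (use assms in \<open>auto simp: in_keys_iff\<close>)

lemma pnorm_partial_sum:
  assumes "r \<ge> 0" "finite F"
  shows "(\<Sum>m\<in>F. norm (lkp f m) * r ^ mdeg m) \<le> pnorm r f"
proof -
  have "(\<Sum>m\<in>F. norm (lkp f m) * r ^ mdeg m) \<le> (\<Sum>m\<in>F \<union> Poly_Mapping.keys f. norm (lkp f m) * r ^ mdeg m)"
    by (rule sum_mono2) (use assms in auto)
  then show ?thesis using pnorm_superset[of "F \<union> Poly_Mapping.keys f" f r] assms by simp
qed

lemma pnorm_nonneg: "r \<ge> 0 \<Longrightarrow> pnorm r f \<ge> 0"
  unfolding pnorm_def by (rule sum_nonneg) auto

lemma pnorm_add:
  assumes "r \<ge> 0"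
  shows "pnorm r (f + g) \<le> pnorm r f + pnorm r g"
proof -
  let ?A = "Poly_Mapping.keys f \<union> Poly_Mapping.keys g"
  have "pnorm r (f + g) = (\<Sum>m\<in>?A. norm (lkp f m + lkp g m) * r ^ mdeg m)"
    using pnorm_superset[of ?A "f + g" r] Poly_Mapping.keys_add[of f g] by (simp add: lookup_add)
  also have "\<dots> \<le> (\<Sum>m\<in>?A. norm (lkp f m) * r ^ mdeg m + norm (lkp g m) * r ^ mdeg m)"
    unfolding distrib_right[symmetric]
    by (intro sum_mono mult_right_mono norm_triangle_ineq) (use assms in auto)
  also have "\<dots> = pnorm r f + pnorm r g"
    using pnorm_superset[of ?A f r] pnorm_superset[of ?A g r] by (simp add: sum.distrib)
  finally show ?thesis .
qed

lemma pnorm_0 [simp]: "pnorm r 0 = 0"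
  by (simp add: pnorm_def)

lemma pnorm_sum: "r \<ge> 0 \<Longrightarrow> pnorm r (\<Sum>x\<in>A. f x) \<le> (\<Sum>x\<in>A. pnorm r (f x))"
proof (induction A rule: infinite_finite_induct)
  case (insert x A)
  then show ?case using pnorm_add[of r "f x" "\<Sum>x\<in>A. f x"] by simp
qed simp_all

lemma pnorm_single: "pnorm r (Poly_Mapping.single m c) = norm c * r ^ mdeg m"
  by (simp add: pnorm_def)

lemma pnorm_1 [simp]: "pnorm r 1 = 1"
  using pnorm_single[of r 0 1] by simp

lemma pnorm_mult:
  assumes r: "r \<ge> 0"
  shows "pnorm r (f * g) \<le> pnorm r f * pnorm r g"
proof -
  have "f * g = (\<Sum>m\<in>Poly_Mapping.keys f. \<Sum>k\<in>Poly_Mapping.keys g.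
      Poly_Mapping.single (m + k) (lkp f m * lkp g k))"
    by (subst sum_monomials[of f], subst sum_monomials[of g]) (simp add: sum_product mult_single)
  then have "pnorm r (f * g) \<le> (\<Sum>m\<in>Poly_Mapping.keys f. pnorm r (\<Sum>k\<in>Poly_Mapping.keys g.
      Poly_Mapping.single (m + k) (lkp f m * lkp g k)))"
    using pnorm_sum[OF r] by simp
  also have "\<dots> \<le> (\<Sum>m\<in>Poly_Mapping.keys f. \<Sum>k\<in>Poly_Mapping.keys g.
      pnorm r (Poly_Mapping.single (m + k) (lkp f m * lkp g k)))"
    by (intro sum_mono pnorm_sum[OF r])
  also have "\<dots> = pnorm r f * pnorm r g"
    unfolding pnorm_single by (simp add: pnorm_def sum_product norm_mult power_add mult_ac)
  finally show ?thesis .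
qed

lemma pnorm_power: "r \<ge> 0 \<Longrightarrow> pnorm r (f ^ k) \<le> pnorm r f ^ k"
proof (induction k)
  case (Suc k)
  have "pnorm r (f ^ Suc k) \<le> pnorm r f * pnorm r (f ^ k)" using pnorm_mult[OF Suc.prems] by simp
  also have "\<dots> \<le> pnorm r f * pnorm r f ^ k" by (intro mult_left_mono Suc pnorm_nonneg)
  finally show ?case by simp
qed simp

definition order_ge :: "nat \<Rightarrow> 'n::finite series \<Rightarrow> bool" where
  "order_ge N a \<longleftrightarrow> (\<forall>m. mdeg m < N \<longrightarrow> a m = 0)"

lemma order_ge_mult:
  fixes a b :: "'n::finite series"
  assumes "order_ge M a" "order_ge N b"
  shows "order_ge (M + N) (series_mult a b)"
  unfolding order_ge_def series_mult_def
proof (intro allI impI sum.neutral ballI, clarify)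
  fix k l :: "'n mono" assume "mdeg (k + l) < M + N"
  then have "mdeg k < M \<or> mdeg l < N" by auto
  then show "a k * b l = 0" using assms by (auto simp: order_ge_def)
qed

lemma order_ge_power: "order_ge 1 (lkp p) \<Longrightarrow> order_ge k (lkp (p ^ k))"
proof (induction k)
  case (Suc k)
  then show ?case using order_ge_mult[of 1 "lkp p" k "lkp (p ^ k)"] by (simp add: lookup_mult_series)
qed (simp add: order_ge_def)

text \<open>The inverse of \<open>1 - p\<close> is the geometric series. Since \<open>p\<close> has
  no constant term, the coefficient at \<open>m\<close> involves only powers up to
  \<open>mdeg m\<close>.\<close>

lemma conv_series_geometric:
  fixes p :: "'n::finite cpoly"
  assumes p: "in_vars V (lkp p)" "lkp p 0 = 0"
  obtains c where "c \<in> conv_series V" "series_mult (lkp (1 - p)) c = lkp 1"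
proof -
  define S where "S K = (\<Sum>k\<le>K. p ^ k)" for K
  define c where "c m = lkp (S (mdeg m)) m" for m
  have o1: "order_ge 1 (lkp p)" using p(2) by (auto simp: order_ge_def mdeg_eq_0_iff)
  have cS: "c m = lkp (S K) m" if "mdeg m \<le> K" for m K
  proof -
    have "lkp (S K) m = (\<Sum>k\<le>K. lkp (p ^ k) m)" by (simp add: S_def lookup_sum)
    also have "\<dots> = (\<Sum>k\<le>mdeg m. lkp (p ^ k) m)"
      by (rule sum.mono_neutral_right) (use that order_ge_power[OF o1] in \<open>auto simp: order_ge_def\<close>)
    finally show ?thesis by (simp add: c_def S_def lookup_sum)
  qed
  \<comment> \<open>Without constant term, \<open>pnorm r p \<le> r * pnorm 1 p\<close>; this radius
    brings it down to at most 1/2, and the summand 1 keeps the denominator positive.\<close>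
  define r where "r = 1 / (2 * (pnorm 1 p + 1))"
  have pn: "pnorm 1 p \<ge> 0" by (rule pnorm_nonneg) simp
  have r: "r > 0" "r \<le> 1" using pn by (auto simp: r_def divide_simps)
  have "pnorm r p \<le> r * pnorm 1 p"
    unfolding pnorm_def sum_distrib_left
  proof (rule sum_mono)
    fix m assume "m \<in> Poly_Mapping.keys p"
    then have "mdeg m \<noteq> 0" using p(2) by (auto simp: mdeg_eq_0_iff in_keys_iff)
    then have "r ^ mdeg m \<le> r" using r power_decreasing[of 1 "mdeg m" r] by simp
    then show "norm (lkp p m) * r ^ mdeg m \<le> r * (norm (lkp p m) * 1 ^ mdeg m)"
      using mult_right_mono[of _ _ "norm (lkp p m)"] by (simp add: mult.commute)
  qed
  also have "\<dots> \<le> 1 / 2" using pn by (simp add: r_def divide_simps)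
  finally have half: "pnorm r p \<le> 1 / 2" .
  \<comment> \<open>A bound uniform in \<open>K\<close>, hence a bound for all finite sums of
    weighted coefficients of \<open>c\<close>.\<close>
  have S2: "pnorm r (S K) \<le> 2" for K
  proof -
    have "pnorm r (S K) \<le> (\<Sum>k\<le>K. pnorm r (p ^ k))" unfolding S_def by (rule pnorm_sum) (use r in simp)
    also have "\<dots> \<le> (\<Sum>k\<le>K. (1/2) ^ k)"
    proof (rule sum_mono)
      fix k
      have "pnorm r (p ^ k) \<le> pnorm r p ^ k" using r by (intro pnorm_power) simp
      also have "\<dots> \<le> (1/2) ^ k" using half r by (intro power_mono pnorm_nonneg) auto
      finally show "pnorm r (p ^ k) \<le> (1/2) ^ k" .
    qed
    also have "\<dots> = 2 - (1/2 :: real) ^ K" by (induction K) auto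
    also have "\<dots> \<le> 2" by simp
    finally show ?thesis .
  qed
  have "abs_summable_radius c r"
  proof (rule abs_summable_radius_boundI)
    fix F :: "'n mono set" assume F: "finite F"
    define K where "K = Max (insert 0 (mdeg ` F))"
    have K: "mdeg m \<le> K" if "m \<in> F" for m using F that by (simp add: K_def)
    have "(\<Sum>m\<in>F. norm (c m) * r ^ mdeg m) = (\<Sum>m\<in>F. norm (lkp (S K) m) * r ^ mdeg m)"
      by (rule sum.cong[OF refl]) (simp add: cS[OF K])
    also have "\<dots> \<le> pnorm r (S K)" by (rule pnorm_partial_sum) (use r F in auto)
    also have "\<dots> \<le> 2" by (rule S2)
    finally show "(\<Sum>m\<in>F. norm (c m) * r ^ mdeg m) \<le> 2" .
  qed (use r in simp)
  moreover have "in_vars V (lkp (S K))" for K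
    unfolding S_def by (intro in_vars_sum in_vars_power p)
  then have "in_vars V c" by (auto simp: in_vars_def c_def)
  ultimately have conv: "c \<in> conv_series V" using r by (auto simp: conv_series_iff)
  have "series_mult (lkp (1 - p)) c m = lkp 1 m" for m
  proof -
    let ?K = "mdeg m"
    have "series_mult (lkp (1 - p)) c m = series_mult (lkp (1 - p)) (lkp (S ?K)) m"
      by (rule series_mult_cong) (use cS in auto)
    also have "\<dots> = lkp ((1 - p) * S ?K) m" by (simp only: lookup_mult_series)
    also have "(1 - p) * S ?K = 1 - p ^ Suc ?K"
      unfolding S_def using one_diff_power_eq[of p "Suc ?K"] by (simp add: lessThan_Suc_atMost)
    also have "lkp (1 - p ^ Suc ?K) m = lkp 1 m"
      using order_ge_power[OF o1, of "Suc ?K"] by (simp add: lookup_minus order_ge_def del: power_Suc)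
    finally show ?thesis .
  qed
  with conv that show ?thesis by blast
qed

lemma conv_series_inverse:
  assumes q: "in_vars V (lkp q)" "lkp q 0 \<noteq> 0"
  obtains c where "c \<in> conv_series V" "series_mult c (lkp q) = lkp 1"
proof -
  let ?k = "pconst (inverse (lkp q 0))"
  have "lkp (?k * q) 0 = 1" using q(2) by (simp add: lookup_pconst_mult)
  then have "lkp (1 - ?k * q) 0 = 0" by (simp add: lookup_minus)
  moreover have "in_vars V (lkp (1 - ?k * q))"
    using in_vars_add[OF in_vars_1 in_vars_mult_poly[OF in_vars_pconst q(1)], of "- inverse (lkp q 0)"]
    by (simp add: pconst_minus)
  ultimately obtain c where c: "c \<in> conv_series V" "series_mult (lkp (1 - (1 - ?k * q))) c = lkp 1"
    using conv_series_geometric by blast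
  have "series_mult (series_mult c (lkp ?k)) (lkp q) = series_mult (lkp (?k * q)) c"
    unfolding series_mult_assoc lookup_mult_series[symmetric] by (rule series_mult_commute)
  with c have "series_mult (series_mult c (lkp ?k)) (lkp q) = lkp 1" by simp
  moreover have "series_mult c (lkp ?k) \<in> conv_series V"
    by (intro conv_series_mult c conv_series_poly in_vars_pconst)
  ultimately show ?thesis using that by blast
qed

lemma mono_divisor_exists: "N \<le> mdeg m \<Longrightarrow> \<exists>\<alpha> k. mdeg \<alpha> = N \<and> m = \<alpha> + k"
proof (induction N)
  case 0
  show ?case by (intro exI[of _ 0] exI[of _ m]) simp
next
  case (Suc N)
  then obtain \<alpha> k where ak: "mdeg \<alpha> = N" "m = \<alpha> + k" by auto
  with Suc.prems have "mdeg k \<noteq> 0" by simp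
  then obtain j where j: "lkp k j \<noteq> 0" unfolding mdeg_def by auto
  have "Poly_Mapping.single j 1 + (k - Poly_Mapping.single j 1) = k"
    by (rule poly_mapping_eqI) (use j in \<open>auto simp: lookup_add lookup_minus lookup_single when_def\<close>)
  then have "m = (\<alpha> + Poly_Mapping.single j 1) + (k - Poly_Mapping.single j 1)"
    using ak by (simp add: add.assoc)
  then show ?case using ak(1) by (intro exI[of _ "\<alpha> + Poly_Mapping.single j 1"] exI) auto
qed

lemma series_mult_monomial:
  "series_mult (lkp (Poly_Mapping.single \<alpha> 1)) b (\<alpha> + k) = b k"
  "(\<And>k. m \<noteq> \<alpha> + k) \<Longrightarrow> series_mult (lkp (Poly_Mapping.single \<alpha> 1)) b m = 0"
proof -
  have "series_mult (lkp (Poly_Mapping.single \<alpha> 1)) b (\<alpha> + k) =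
      (\<Sum>x\<in>{(i, l). i + l = \<alpha> + k}. if x = (\<alpha>, k) then b k else 0)"
    unfolding series_mult_def by (rule sum.cong) (auto simp: lookup_single when_def split: if_splits)
  also have "\<dots> = b k" using finite_decompositions[of "\<alpha> + k"] by simp
  finally show "series_mult (lkp (Poly_Mapping.single \<alpha> 1)) b (\<alpha> + k) = b k" .
  show "series_mult (lkp (Poly_Mapping.single \<alpha> 1)) b m = 0" if "\<And>k. m \<noteq> \<alpha> + k"
    unfolding series_mult_def by (rule sum.neutral) (use that in \<open>auto simp: lookup_single when_def\<close>)
qed

text \<open>Each monomial of degree at least \<open>N\<close> is assigned to just one divisor
  \<open>\<delta> m\<close> of degree \<open>N\<close>. The quotient series then use disjoint sets
  of coefficients of \<open>a\<close> and converge at the same radius, up to the factor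
  \<open>r ^ N\<close>.\<close>

lemma conv_series_divide:
  fixes a :: "'n::finite series"
  assumes a: "a \<in> conv_series V" "order_ge N a"
  obtains b where "\<And>\<alpha>. b \<alpha> \<in> conv_series V"
    "a = (\<Sum>\<alpha>\<in>{\<alpha>. mdeg \<alpha> = N \<and> Poly_Mapping.keys \<alpha> \<subseteq> V}. series_mult (lkp (Poly_Mapping.single \<alpha> 1)) (b \<alpha>))"
proof -
  have "\<forall>m :: 'n mono. \<exists>\<alpha>. N \<le> mdeg m \<longrightarrow> mdeg \<alpha> = N \<and> (\<exists>k. m = \<alpha> + k)" using mono_divisor_exists by metis
  then obtain \<delta> :: "'n mono \<Rightarrow> 'n mono" where \<delta>: "\<And>m. N \<le> mdeg m \<Longrightarrow> mdeg (\<delta> m) = N \<and> (\<exists>k. m = \<delta> m + k)" by metis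
  define b where "b \<alpha> k = (if mdeg \<alpha> = N \<and> Poly_Mapping.keys \<alpha> \<subseteq> V \<and> \<delta> (\<alpha> + k) = \<alpha> then a (\<alpha> + k) else 0)" for \<alpha> k
  let ?A = "{\<alpha>. mdeg \<alpha> = N \<and> Poly_Mapping.keys \<alpha> \<subseteq> V}"
  have fA: "finite ?A" by (rule finite_subset[OF _ finite_mdeg_le[of N]]) auto
  obtain r where r: "r > 0" "abs_summable_radius a r" using a(1) by (auto simp: conv_series_iff)
  obtain C where C: "\<And>F. finite F \<Longrightarrow> (\<Sum>m\<in>F. norm (a m) * r ^ mdeg m) \<le> C"
    using abs_summable_radius_bound[OF r(2)] r(1) by (metis less_imp_le)
  have iv: "in_vars V a" using a(1) by (simp add: conv_series_iff)
  have conv: "b \<alpha> \<in> conv_series V" for \<alpha>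
  proof -
    have "abs_summable_radius (b \<alpha>) r"
    proof (rule abs_summable_radius_boundI)
      fix F :: "'n mono set" assume F: "finite F"
      have "(\<Sum>k\<in>F. norm (b \<alpha> k) * r ^ mdeg k) \<le> (\<Sum>k\<in>F. norm (a (\<alpha> + k)) * r ^ mdeg (\<alpha> + k) / r ^ N)"
        by (rule sum_mono) (use r in \<open>auto simp: b_def power_add\<close>)
      also have "\<dots> = (\<Sum>m\<in>(+) \<alpha> ` F. norm (a m) * r ^ mdeg m) / r ^ N"
        by (simp add: sum.reindex sum_divide_distrib)
      also have "\<dots> \<le> C / r ^ N" using C[of "(+) \<alpha> ` F"] F r by (intro divide_right_mono) auto
      finally show "(\<Sum>k\<in>F. norm (b \<alpha> k) * r ^ mdeg k) \<le> C / r ^ N" .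
    qed (use r in simp)
    moreover have "in_vars V (b \<alpha>)"
      using iv keys_add_mono[of \<alpha>] by (fastforce simp: in_vars_def b_def split: if_splits)
    ultimately show ?thesis using r by (auto simp: conv_series_iff)
  qed
  have "a m = (\<Sum>\<alpha>\<in>?A. series_mult (lkp (Poly_Mapping.single \<alpha> 1)) (b \<alpha>)) m" for m
  proof -
    have trm: "series_mult (lkp (Poly_Mapping.single \<alpha> 1)) (b \<alpha>) m =
      (if a m \<noteq> 0 \<and> \<delta> m = \<alpha> then a m else 0)" if \<alpha>: "\<alpha> \<in> ?A" for \<alpha>
    proof (cases "\<exists>k. m = \<alpha> + k")
      case True
      then obtain k where k: "m = \<alpha> + k" by blast
      then show ?thesis using \<alpha> by (auto simp: series_mult_monomial b_def)
    next
      case False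
      have "\<delta> m \<noteq> \<alpha>" if "a m \<noteq> 0"
      proof -
        have "N \<le> mdeg m" using a(2) that by (auto simp: order_ge_def not_less[symmetric])
        with \<delta> False show ?thesis by metis
      qed
      then show ?thesis using False by (auto simp: series_mult_monomial)
    qed
    have "(\<Sum>\<alpha>\<in>?A. series_mult (lkp (Poly_Mapping.single \<alpha> 1)) (b \<alpha>)) m =
      (\<Sum>\<alpha>\<in>?A. if a m \<noteq> 0 \<and> \<delta> m = \<alpha> then a m else 0)"
      unfolding sum_fun_apply by (rule sum.cong[OF refl trm])
    also have "\<dots> = a m"
    proof (cases "a m = 0")
      case False
      have "N \<le> mdeg m" using a(2) False by (auto simp: order_ge_def not_less[symmetric])
      then obtain k where k: "mdeg (\<delta> m) = N" "m = \<delta> m + k" using \<delta> by blast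
      moreover have "Poly_Mapping.keys m \<subseteq> V" using iv False by (simp add: in_vars_def)
      ultimately have "\<delta> m \<in> ?A" using keys_add_mono[of "\<delta> m" k] by auto
      then show ?thesis using fA False by simp
    qed simp
    finally show ?thesis ..
  qed
  then have "a = (\<Sum>\<alpha>\<in>?A. series_mult (lkp (Poly_Mapping.single \<alpha> 1)) (b \<alpha>))" by blast
  with conv that show ?thesis by blast
qed

section \<open>Closure properties of the Tjurina ideal\<close>

lemma tjurina_ideal_I:
  "a \<in> conv_series V \<Longrightarrow> (\<And>j. j \<in> V \<Longrightarrow> b j \<in> conv_series V) \<Longrightarrow>
    series_mult a g + (\<Sum>j\<in>V. series_mult (b j) (series_diff j g)) \<in> tjurina_ideal V g"
  unfolding tjurina_ideal_def by blast

lemma tjurina_idealE: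
  assumes "x \<in> tjurina_ideal V g"
  obtains a b where "a \<in> conv_series V" "\<And>j. j \<in> V \<Longrightarrow> b j \<in> conv_series V"
    "x = series_mult a g + (\<Sum>j\<in>V. series_mult (b j) (series_diff j g))"
  using assms unfolding tjurina_ideal_def by blast

lemma tjurina_ideal_add:
  assumes "x \<in> tjurina_ideal V g" "y \<in> tjurina_ideal V g"
  shows "x + y \<in> tjurina_ideal V g"
proof -
  obtain a b where ab: "a \<in> conv_series V" "\<And>j. j \<in> V \<Longrightarrow> b j \<in> conv_series V"
    "x = series_mult a g + (\<Sum>j\<in>V. series_mult (b j) (series_diff j g))"
    by (rule tjurina_idealE[OF assms(1)]) blast
  obtain a' b' where ab': "a' \<in> conv_series V" "\<And>j. j \<in> V \<Longrightarrow> b' j \<in> conv_series V"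
    "y = series_mult a' g + (\<Sum>j\<in>V. series_mult (b' j) (series_diff j g))"
    by (rule tjurina_idealE[OF assms(2)]) blast
  have "x + y = series_mult (a + a') g + (\<Sum>j\<in>V. series_mult (b j + b' j) (series_diff j g))"
    unfolding ab(3) ab'(3) by (simp add: series_mult_add_left sum.distrib add_ac)
  also have "\<dots> \<in> tjurina_ideal V g" by (intro tjurina_ideal_I conv_series_add ab ab')
  finally show ?thesis .
qed

lemma tjurina_ideal_mult:
  assumes "c \<in> conv_series V" "x \<in> tjurina_ideal V g"
  shows "series_mult c x \<in> tjurina_ideal V g"
proof -
  obtain a b where ab: "a \<in> conv_series V" "\<And>j. j \<in> V \<Longrightarrow> b j \<in> conv_series V"
    "x = series_mult a g + (\<Sum>j\<in>V. series_mult (b j) (series_diff j g))"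
    by (rule tjurina_idealE[OF assms(2)]) blast
  have "series_mult c x = series_mult (series_mult c a) g + (\<Sum>j\<in>V. series_mult (series_mult c (b j)) (series_diff j g))"
    unfolding ab(3) by (simp add: series_mult_add_right series_mult_sum_right series_mult_assoc)
  also have "\<dots> \<in> tjurina_ideal V g" by (intro tjurina_ideal_I conv_series_mult ab assms)
  finally show ?thesis .
qed

lemma tjurina_ideal_zero: "0 \<in> tjurina_ideal V g"
proof -
  have "0 = series_mult 0 g + (\<Sum>j\<in>V. series_mult 0 (series_diff j g))"
    unfolding series_mult_zero by (metis add_0 sum.neutral_const)
  also have "\<dots> \<in> tjurina_ideal V g" by (intro tjurina_ideal_I conv_series_zero)
  finally show ?thesis .
qed

lemma subspace_tjurina_ideal: "sv.subspace (tjurina_ideal V g)"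
  by (rule sv.subspaceI)
    (simp_all only: series_scale_mult tjurina_ideal_zero tjurina_ideal_add tjurina_ideal_mult
      conv_series_poly in_vars_pconst)

lemma tjurina_ideal_sum: "(\<And>x. x \<in> A \<Longrightarrow> f x \<in> tjurina_ideal V g) \<Longrightarrow> (\<Sum>x\<in>A. f x) \<in> tjurina_ideal V g"
  by (rule sv.subspace_sum[OF subspace_tjurina_ideal])

lemma tjurina_ideal_generator: "g \<in> tjurina_ideal V g"
proof -
  have "g = series_mult (lkp 1) g + (\<Sum>j\<in>V. series_mult 0 (series_diff j g))"
    unfolding series_mult_zero series_mult_1 by (metis add.right_neutral sum.neutral_const)
  also have "\<dots> \<in> tjurina_ideal V g"
    by (intro tjurina_ideal_I conv_series_zero conv_series_poly in_vars_1)
  finally show ?thesis .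
qed

lemma tjurina_ideal_derivative:
  assumes "j \<in> V"
  shows "series_diff j g \<in> tjurina_ideal V g"
proof -
  let ?b = "\<lambda>k. if k = j then lkp 1 else 0"
  have "(\<Sum>k\<in>V. series_mult (?b k) (series_diff k g)) = (\<Sum>k\<in>V. if k = j then series_diff j g else 0)"
    by (rule sum.cong) (simp_all only: series_mult_zero series_mult_1 split: if_splits, auto)
  also have "\<dots> = series_diff j g" using assms by (subst sum.delta) auto
  finally have "series_diff j g = series_mult 0 g + (\<Sum>k\<in>V. series_mult (?b k) (series_diff k g))"
    unfolding series_mult_zero by (metis add_0)
  also have "\<dots> \<in> tjurina_ideal V g"
    by (intro tjurina_ideal_I) (auto intro: conv_series_zero conv_series_poly)
  finally show ?thesis .
qed

section \<open>Local equations at the singular points\<close>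

abbreviation chart :: "'n::finite \<Rightarrow> complex ^ 'n \<Rightarrow> 'n cpoly \<Rightarrow> 'n cpoly" where
  "chart i v F \<equiv> psubst F (\<lambda>j. if j = i then 1 else pconst (v $ j) + pvar j)"

text \<open>The linear form that becomes the local coordinate \<open>u_j\<close> in the chart; for
  \<open>j = i\<close> it is 0 as soon as \<open>v $ i = 1\<close>.\<close>

definition chart_form :: "'n::finite \<Rightarrow> complex ^ 'n \<Rightarrow> 'n \<Rightarrow> 'n cpoly" where
  "chart_form i v j = pvar j - pconst (v $ j) * pvar i"

lemma chart_in_vars: "in_vars (- {i}) (lkp (chart i v F))"
proof (induction F rule: cpoly_ring_induct)
  case (var j)
  then show ?case by (auto intro!: in_vars_add in_vars_pvar)
qed (simp_all add: in_vars_add in_vars_mult_poly)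

lemma peval_chart: "v $ i = 1 \<Longrightarrow> peval (chart i v F) 0 = peval F v"
  by (induction F rule: cpoly_ring_induct) auto

lemma lookup_0_eq_peval: "lkp h 0 = peval h 0"
proof (induction h rule: cpoly_induct)
  case (single m c)
  have "(\<Prod>j\<in>UNIV. (0::complex) ^ lkp m j) = (if m = 0 then 1 else 0)"
  proof (cases "m = 0")
    case False
    then obtain j where "lkp m j \<noteq> 0" by (metis lookup_zero poly_mapping_eqI)
    then have "(0::complex) ^ lkp m j = 0" by simp
    then have "(\<Prod>j\<in>UNIV. (0::complex) ^ lkp m j) = 0" by (intro prod_zero) auto
    then show ?thesis using False by simp
  qed simp
  then show ?case by (simp add: peval_psub ev.psub_single lookup_single when_def)
qed (simp add: lookup_add)

lemma pdiff_chart: "j \<noteq> i \<Longrightarrow> pdiff j (chart i v F) = chart i v (pdiff j F)"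
proof (induction F rule: cpoly_ring_induct)
  case (var k)
  have "pdiff j 1 = (0 :: 'a cpoly)" using pdiff_pconst[of j 1] by simp
  with var show ?case by (simp add: pdiff_pvar pdiff_add)
qed (simp_all add: pdiff_add pdiff_mult)

lemma chart_chart_form: "v $ i = 1 \<Longrightarrow> chart i v (chart_form i v j) = (if j = i then 0 else pvar j)"
  by (simp add: chart_form_def)

lemma chart_form_forms: "chart_form i v j \<in> forms 1"
proof -
  have "pconst (v $ j) * pvar i \<in> forms 1" using hom_comp_mult[OF hom_comp_pconst hom_comp_pvar] by simp
  then show ?thesis unfolding chart_form_def using forms_pvar by (intro hom_comp_diff)
qed

lemma prod_chart_forms: "(\<Prod>j\<in>UNIV. chart_form i v j ^ lkp m j) \<in> forms (mdeg m)"
  unfolding mdeg_def using forms_power[OF chart_form_forms] by (intro forms_prod) auto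

lemma chart_prod_chart_forms:
  assumes "v $ i = 1" "lkp m i = 0"
  shows "chart i v (\<Prod>j\<in>UNIV. chart_form i v j ^ lkp m j) = Poly_Mapping.single m 1"
proof -
  have "chart i v (\<Prod>j\<in>UNIV. chart_form i v j ^ lkp m j) = (\<Prod>j\<in>UNIV. pvar j ^ lkp m j)"
    unfolding psubst_simps chart_chart_form[OF assms(1)] by (rule prod.cong) (use assms in auto)
  then show ?thesis by (simp add: mono_single_prod)
qed

lemma jacobian_ideal_eq: "jacobian_ideal f = pideal (range (\<lambda>j. pdiff j f))"
  by (simp add: jacobian_ideal_def full_SetCompr_eq)

lemma euler_in_jacobian_ideal:
  assumes f: "f \<in> forms d" "d \<ge> 1"
  shows "f \<in> jacobian_ideal f"
proof -
  have "pconst (of_nat d) * f \<in> jacobian_ideal f"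
    unfolding euler_formula[OF f(1), symmetric] jacobian_ideal_eq
    by (intro pideal_sum pideal_mult pideal_base) auto
  then have "pconst (inverse (of_nat d)) * (pconst (of_nat d) * f) \<in> jacobian_ideal f"
    unfolding jacobian_ideal_eq by (rule pideal_mult)
  then show ?thesis using f(2) by (simp add: mult.assoc[symmetric] pconst_mult[symmetric])
qed

lemma graded_jacobian_ideal: "f \<in> forms d \<Longrightarrow> graded (jacobian_ideal f)"
  unfolding jacobian_ideal_eq by (rule graded_pideal) (use pdiff_forms in auto)

lemma peval_jacobian_ideal:
  "h \<in> jacobian_ideal f \<Longrightarrow> (\<And>j. peval (pdiff j f) v = 0) \<Longrightarrow> peval h v = 0"
  unfolding jacobian_ideal_eq by (rule peval_ideal) auto

lemma psubst_cong_ideal: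
  assumes "\<And>j. s j - s' j \<in> pideal G"
  shows "psubst t s - psubst t s' \<in> pideal G"
proof (induction t rule: cpoly_ring_induct)
  case (add f g)
  from pideal_add[OF add] show ?case by (simp add: algebra_simps)
next
  case (mult f g)
  from pideal_add[OF pideal_mult[OF mult(1), of "psubst g s"] pideal_mult[OF mult(2), of "psubst f s'"]]
  show ?case by (simp add: algebra_simps)
qed (use assms in simp_all)

lemma lookup_0_in_tjurina_ideal: "lkp 0 \<in> tjurina_ideal V g"
  unfolding lookup_zero_fun by (rule tjurina_ideal_zero)

locale affine_chart =
  fixes f :: "'n::finite cpoly" and d :: nat and v :: "complex ^ 'n" and i :: 'n
  assumes f: "f \<in> forms d" and d: "d \<ge> 1" and vi: "v $ i = 1"
begin

abbreviation "J \<equiv> jacobian_ideal f"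
abbreviation "V \<equiv> - {i}"
abbreviation "T \<equiv> tjurina_ideal V (local_eq f v i)"

lemma local_eq: "local_eq f v i = lkp (chart i v f)"
  by (simp add: local_eq_def)

lemma local_eq_diff: "j \<noteq> i \<Longrightarrow> series_diff j (local_eq f v i) = lkp (chart i v (pdiff j f))"
  by (simp add: local_eq lookup_pdiff[symmetric] pdiff_chart)

lemma chart_conv: "lkp (chart i v F) \<in> conv_series V"
  by (intro conv_series_poly chart_in_vars)

text \<open>The derivative with respect to \<open>x_i\<close> has no counterpart among the local
  generators; the Euler formula, restricted to \<open>x_i = 1\<close>, expresses it through
  \<open>f\<close> and the other derivatives.\<close>

lemma chart_jacobian_ideal: "F \<in> J \<Longrightarrow> lkp (chart i v F) \<in> T"
proof -
  have T_other: "lkp (chart i v (pdiff j f)) \<in> T" if "j \<noteq> i" for j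
    using tjurina_ideal_derivative[of j V "local_eq f v i"] that by (simp add: local_eq_diff)
  have T_f: "lkp (chart i v f) \<in> T" using tjurina_ideal_generator[of "local_eq f v i" V] by (simp add: local_eq)
  have "chart i v (pdiff i f) = chart i v (pconst (of_nat d) * f) - (\<Sum>j\<in>V. chart i v (pvar j * pdiff j f))"
  proof -
    have "(\<Sum>j\<in>UNIV. chart i v (pvar j * pdiff j f)) =
        chart i v (pvar i * pdiff i f) + (\<Sum>j\<in>V. chart i v (pvar j * pdiff j f))"
      by (subst sum.remove[of _ i]) (auto simp: Compl_eq_Diff_UNIV)
    then show ?thesis unfolding euler_formula[OF f, symmetric] by simp
  qed
  then have e: "lkp (chart i v (pdiff i f)) = series_mult (lkp (chart i v (pconst (of_nat d)))) (lkp (chart i v f)) -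
      (\<Sum>j\<in>V. series_mult (lkp (chart i v (pvar j))) (lkp (chart i v (pdiff j f))))"
    by (simp only: lookup_diff lookup_sum_fun psubst_simps lookup_mult_series)
  have T_i: "lkp (chart i v (pdiff i f)) \<in> T"
    unfolding e
    by (intro sv.subspace_diff[OF subspace_tjurina_ideal] tjurina_ideal_mult tjurina_ideal_sum chart_conv T_f T_other) auto
  have T_all: "lkp (chart i v (pdiff j f)) \<in> T" for j using T_other T_i by (cases "j = i") auto
  assume "F \<in> J"
  then show ?thesis
    unfolding jacobian_ideal_eq pideal_def
  proof (induction F rule: pid.span_induct_alt)
    case base
    show ?case unfolding psubst_simps by (rule lookup_0_in_tjurina_ideal)
  next
    case (step c x y)
    have "lkp (chart i v (c * x + y)) = series_mult (lkp (chart i v c)) (lkp (chart i v x)) + lkp (chart i v y)"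
      by (simp only: psubst_simps lookup_plus lookup_mult_series)
    also have "\<dots> \<in> T"
      by (intro tjurina_ideal_add tjurina_ideal_mult chart_conv step) (use step T_all in auto)
    finally show ?case .
  qed
qed

text \<open>A global witness that the \<open>M\<close>-th power of the maximal ideal at
  \<open>v\<close> lies in the localized Jacobian ideal: the form \<open>q\<close> is invertible at
  \<open>v\<close> and clears the denominators.\<close>

definition local_data :: "nat \<Rightarrow> 'n cpoly \<Rightarrow> bool" where
  "local_data M q \<longleftrightarrow> (\<exists>k. q \<in> forms k) \<and> peval q v \<noteq> 0 \<and>
     (\<forall>m. M \<le> mdeg m \<longrightarrow> lkp m i = 0 \<longrightarrow> q * (\<Prod>j\<in>UNIV. chart_form i v j ^ lkp m j) \<in> J)"

text \<open>The form \<open>q0\<close> vanishes at the other singular points and the chart forms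
  vanish at \<open>v\<close>, so each product vanishes on all zeros of \<open>J\<close> and has a
  power in \<open>J\<close>.\<close>

lemma local_data_exists:
  assumes Z: "finite Z" "0 \<notin> Z" "v \<in> Z"
    "\<And>x y c. x \<in> Z \<Longrightarrow> y \<in> Z \<Longrightarrow> x \<noteq> y \<Longrightarrow> x \<noteq> c *s y"
    "\<And>x. x \<noteq> 0 \<Longrightarrow> (\<And>j. peval (pdiff j f) x = 0) \<Longrightarrow> \<exists>w\<in>Z. \<exists>c. x = c *s w"
  obtains M q where "local_data M q"
proof -
  let ?k = "card (Z - {v})"
  have "v \<noteq> 0" using Z by auto
  then obtain q0 where q0: "q0 \<in> forms ?k" "peval q0 v \<noteq> 0" "\<And>w. w \<in> Z - {v} \<Longrightarrow> peval q0 w = 0"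
    using separating_form[of "Z - {v}" v ?k] Z by (metis Diff_iff finite_Diff insertI1 order_refl)
  have sJ: "pid.subspace J" by (simp add: jacobian_ideal_eq)
  have "\<exists>M. (q0 * chart_form i v j) ^ M \<in> J" for j
  proof (rule nullstellensatz_form[OF graded_jacobian_ideal[OF f]])
    show fm: "q0 * chart_form i v j \<in> forms (?k + 1)" by (rule forms_mult[OF q0(1) chart_form_forms])
    fix x assume x: "\<And>p. p \<in> J \<Longrightarrow> peval p x = 0"
    show "peval (q0 * chart_form i v j) x = 0"
    proof (cases "x = 0")
      case True
      then show ?thesis using peval_form_scale[OF fm, of 0 0] by simp
    next
      case False
      have "peval (pdiff j f) x = 0" for j by (rule x) (simp add: jacobian_ideal_eq pideal_base)
      then obtain w c where w: "w \<in> Z" "x = c *s w" using Z(5)[OF False] by blast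
      have "peval (q0 * chart_form i v j) w = 0"
        using q0(3)[of w] w(1) vi by (cases "w = v") (auto simp: chart_form_def)
      then show ?thesis using peval_form_scale[OF fm, of c w] w(2) by simp
    qed
  qed simp
  then obtain E where E: "\<And>j. (q0 * chart_form i v j) ^ E j \<in> J" by metis
  define E0 where "E0 = Max (range E)"
  have E0: "(q0 * chart_form i v j) ^ E0 \<in> J" for j
  proof -
    have "E j \<le> E0" unfolding E0_def by (rule Max_ge) auto
    then have "(q0 * chart_form i v j) ^ E0 = (q0 * chart_form i v j) ^ (E0 - E j) * (q0 * chart_form i v j) ^ E j"
      by (simp flip: power_add)
    then show ?thesis using pid.subspace_scale[OF sJ E] by metis
  qed
  let ?M = "CARD('n) * E0"
  \<comment> \<open>In degree exactly \<open>?M\<close> the factors \<open>q0\<close> combine to the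
    fixed power \<open>q0 ^ ?M\<close>; larger monomials are reduced to this case by splitting off a
    divisor of degree \<open>?M\<close>.\<close>
  have ex: "q0 ^ ?M * (\<Prod>j\<in>UNIV. chart_form i v j ^ lkp m j) \<in> J" if "mdeg m = ?M" for m
  proof -
    have "(\<Prod>j\<in>UNIV. (q0 * chart_form i v j) ^ lkp m j) \<in> J"
      by (rule monomials_cofinite[OF sJ E0]) (use that in simp)
    moreover have "(\<Prod>j\<in>UNIV. q0 ^ lkp m j) = q0 ^ ?M" using that by (simp add: mdeg_def flip: power_sum)
    ultimately show ?thesis by (simp add: power_mult_distrib prod.distrib)
  qed
  have "local_data ?M (q0 ^ ?M)"
    unfolding local_data_def
  proof (intro conjI allI impI)
    show "\<exists>k. q0 ^ ?M \<in> forms k" using forms_power[OF q0(1)] by blast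
    show "peval (q0 ^ ?M) v \<noteq> 0" using q0(2) by simp
    fix m :: "'n mono" assume "?M \<le> mdeg m"
    then obtain \<alpha> k where m: "mdeg \<alpha> = ?M" "m = \<alpha> + k" using mono_divisor_exists by blast
    have "q0 ^ ?M * (\<Prod>j\<in>UNIV. chart_form i v j ^ lkp m j) =
      (\<Prod>j\<in>UNIV. chart_form i v j ^ lkp k j) * (q0 ^ ?M * (\<Prod>j\<in>UNIV. chart_form i v j ^ lkp \<alpha> j))"
      unfolding m(2) by (simp add: lookup_add power_add prod.distrib mult_ac)
    also have "\<dots> \<in> J" by (rule pid.subspace_scale[OF sJ ex[OF m(1)]])
    finally show "q0 ^ ?M * (\<Prod>j\<in>UNIV. chart_form i v j ^ lkp m j) \<in> J" .
  qed
  then show ?thesis by (rule that)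
qed

text \<open>\<open>q\<close> times a local monomial of degree \<open>M\<close> maps into
  \<open>T\<close>, and \<open>q\<close> is a unit in the ring of convergent series; division by
  these monomials then covers all series of order \<open>M\<close>.\<close>

lemma high_order_in_tjurina_ideal:
  assumes q: "local_data M q" and a: "a \<in> conv_series V" "order_ge M a"
  shows "a \<in> T"
proof -
  have qv: "peval q v \<noteq> 0" using q by (simp add: local_data_def)
  then have "lkp (chart i v q) 0 \<noteq> 0" by (simp add: lookup_0_eq_peval peval_chart[OF vi])
  then obtain c where c: "c \<in> conv_series V" "series_mult c (lkp (chart i v q)) = lkp 1"
    using conv_series_inverse[OF chart_in_vars] by blast
  have mono: "lkp (Poly_Mapping.single \<alpha> 1) \<in> T" if \<alpha>: "mdeg \<alpha> = M" "Poly_Mapping.keys \<alpha> \<subseteq> V" for \<alpha>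
  proof -
    have i0: "lkp \<alpha> i = 0" using \<alpha>(2) by (auto simp: in_keys_iff)
    have "q * (\<Prod>j\<in>UNIV. chart_form i v j ^ lkp \<alpha> j) \<in> J" using q \<alpha>(1) i0 by (auto simp: local_data_def)
    from chart_jacobian_ideal[OF this]
    have "series_mult (lkp (chart i v q)) (lkp (Poly_Mapping.single \<alpha> 1)) \<in> T"
      using chart_prod_chart_forms[OF vi i0] by (simp only: psubst_simps(6) lookup_mult_series)
    from tjurina_ideal_mult[OF c(1) this] show ?thesis
      by (simp add: series_mult_assoc[symmetric] c(2))
  qed
  obtain b where b: "\<And>\<alpha>. b \<alpha> \<in> conv_series V"
    "a = (\<Sum>\<alpha>\<in>{\<alpha>. mdeg \<alpha> = M \<and> Poly_Mapping.keys \<alpha> \<subseteq> V}. series_mult (lkp (Poly_Mapping.single \<alpha> 1)) (b \<alpha>))"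
    using conv_series_divide[OF a] by blast
  have "(\<Sum>\<alpha>\<in>{\<alpha>. mdeg \<alpha> = M \<and> Poly_Mapping.keys \<alpha> \<subseteq> V}. series_mult (b \<alpha>) (lkp (Poly_Mapping.single \<alpha> 1))) \<in> T"
    by (intro tjurina_ideal_sum tjurina_ideal_mult b(1) mono) auto
  then show ?thesis by (subst b(2)) (simp only: series_mult_commute)
qed

text \<open>Passage from convergent to algebraic membership: the coefficient series are truncated to
  polynomials, and the error, of order at least \<open>M\<close>, is absorbed by
  \<open>q\<close>.\<close>

lemma tjurina_ideal_local:
  assumes q: "local_data M q" and F: "F \<in> forms K" "lkp (chart i v F) \<in> T"
  obtains p k where "p \<in> forms k" "peval p v \<noteq> 0" "p * F \<in> J"
proof -
  obtain k where qk: "q \<in> forms k" and qv: "peval q v \<noteq> 0"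
    and qJ: "\<And>m. M \<le> mdeg m \<Longrightarrow> lkp m i = 0 \<Longrightarrow> q * (\<Prod>j\<in>UNIV. chart_form i v j ^ lkp m j) \<in> J"
    using q by (auto simp: local_data_def)
  obtain a b where ab: "a \<in> conv_series V" "\<And>j. j \<in> V \<Longrightarrow> b j \<in> conv_series V"
    "lkp (chart i v F) = series_mult a (local_eq f v i) + (\<Sum>j\<in>V. series_mult (b j) (series_diff j (local_eq f v i)))"
    by (rule tjurina_idealE[OF F(2)]) blast
  define R where "R = trunc M a * chart i v f + (\<Sum>j\<in>V. trunc M (b j) * chart i v (pdiff j f))"
  define w where "w = chart i v F - R"
  have ow: "order_ge M (lkp w)"
    unfolding order_ge_def
  proof (intro allI impI)
    fix m :: "'n mono" assume m: "mdeg m < M"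
    have tr: "lkp (trunc M c * h) m = series_mult c (lkp h) m" for c h
      unfolding lookup_mult_series by (rule series_mult_cong) (use m in \<open>auto simp: lookup_trunc\<close>)
    have "lkp R m = series_mult a (lkp (chart i v f)) m + (\<Sum>j\<in>V. series_mult (b j) (lkp (chart i v (pdiff j f))) m)"
      by (simp add: R_def lookup_add lookup_sum tr)
    also have "\<dots> = lkp (chart i v F) m"
      unfolding ab(3) by (simp add: local_eq sum_fun_apply) (simp add: local_eq[symmetric] local_eq_diff)
    finally show "lkp w m = 0" by (simp add: w_def lookup_minus)
  qed
  have iw: "in_vars V (lkp w)"
  proof -
    have "in_vars V (lkp R)" unfolding R_def using ab
      by (intro in_vars_add in_vars_sum in_vars_mult_poly in_vars_trunc chart_in_vars)
        (auto simp: conv_series_iff)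
    then have "in_vars V (lkp (pconst (-1) * R))" by (intro in_vars_mult_poly) auto
    from in_vars_add[OF chart_in_vars[where i = i and v = v and F = F] this] show ?thesis by (simp add: w_def pconst_minus)
  qed
  \<comment> \<open>Computations modulo \<open>x_i = 1\<close> take place in the affine chart
    without leaving the polynomial ring.\<close>
  let ?E = "pideal (insert (pvar i - 1) J)"
  have xE: "pvar i - 1 \<in> ?E" by (simp add: pideal_base)
  have xE': "1 - pvar i \<in> ?E" using pideal_mult[OF xE, of "-1"] by simp
  have JE: "J \<subseteq> ?E" by (auto intro: pideal_base)
  \<comment> \<open>The inverse translation, which undoes \<open>chart\<close> modulo
    \<open>?E\<close>.\<close>
  define \<Theta> where "\<Theta> t = psubst t (\<lambda>j. pvar j - pconst (v $ j))" for t :: "'n cpoly"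
  have \<Theta>chart: "\<Theta> (chart i v h) - h \<in> ?E" for h
  proof (induction h rule: cpoly_ring_induct)
    case (var j)
    show ?case using xE' by (simp add: \<Theta>_def)
  next
    case (add f g)
    from pideal_add[OF add] show ?case by (simp add: \<Theta>_def algebra_simps)
  next
    case (mult f g)
    from pideal_add[OF pideal_mult[OF mult(1), of "\<Theta> (chart i v g)"] pideal_mult[OF mult(2), of f]]
    show ?case by (simp add: \<Theta>_def algebra_simps)
  qed (simp add: \<Theta>_def)
  have \<Theta>J: "\<Theta> (chart i v h) \<in> ?E" if "h \<in> J" for h
    using pideal_add[OF \<Theta>chart[of h] subsetD[OF JE that]] by simp
  \<comment> \<open>Modulo \<open>?E\<close> the coordinates \<open>x_j - v_j\<close> may be
    replaced by the homogeneous chart forms, to which the property of \<open>q\<close>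
    refers.\<close>
  have "\<Theta> w - psubst w (chart_form i v) \<in> ?E"
    unfolding \<Theta>_def
  proof (rule psubst_cong_ideal)
    fix j
    have "pvar j - pconst (v $ j) - chart_form i v j = pconst (v $ j) * (pvar i - 1)"
      by (simp add: chart_form_def algebra_simps)
    then show "pvar j - pconst (v $ j) - chart_form i v j \<in> ?E" using pideal_mult[OF xE] by simp
  qed
  moreover have "q * psubst w (chart_form i v) \<in> J"
  proof -
    have "q * psubst w (chart_form i v) =
      (\<Sum>m\<in>Poly_Mapping.keys w. pconst (lkp w m) * (q * (\<Prod>j\<in>UNIV. chart_form i v j ^ lkp m j)))"
      by (simp add: psubst_def sum_distrib_left mult_ac)
    also have "\<dots> \<in> J"
      unfolding jacobian_ideal_eq
    proof (rule pideal_sum, rule pideal_mult)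
      fix m assume m: "m \<in> Poly_Mapping.keys w"
      have "M \<le> mdeg m" using ow m by (auto simp: order_ge_def in_keys_iff not_less[symmetric])
      moreover have "lkp m i = 0" using iw m by (auto simp: in_vars_def in_keys_iff)
      ultimately show "q * (\<Prod>j\<in>UNIV. chart_form i v j ^ lkp m j) \<in> pideal (range (\<lambda>j. pdiff j f))"
        using qJ by (simp add: jacobian_ideal_eq)
    qed
    finally show ?thesis .
  qed
  ultimately have "q * (\<Theta> w - psubst w (chart_form i v)) + q * psubst w (chart_form i v) \<in> ?E"
    by (intro pideal_add[OF pideal_mult subsetD[OF JE]])
  then have \<Theta>w: "q * \<Theta> w \<in> ?E" by (simp add: algebra_simps)
  have \<Theta>R: "\<Theta> R \<in> ?E"
  proof -
    have "\<Theta> R = \<Theta> (trunc M a) * \<Theta> (chart i v f) + (\<Sum>j\<in>V. \<Theta> (trunc M (b j)) * \<Theta> (chart i v (pdiff j f)))"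
      by (simp add: \<Theta>_def R_def)
    also have "\<dots> \<in> ?E"
      by (intro pideal_add pideal_sum pideal_mult \<Theta>J euler_in_jacobian_ideal[OF f d])
        (auto simp: jacobian_ideal_eq intro: pideal_base)
    finally show ?thesis .
  qed
  have "chart i v F = w + R" by (simp add: w_def)
  then have "\<Theta> (chart i v F) = \<Theta> w + \<Theta> R" by (simp add: \<Theta>_def)
  then have "q * F = q * \<Theta> w + q * \<Theta> R - q * (\<Theta> (chart i v F) - F)" by (simp add: algebra_simps)
  also have "\<dots> \<in> ?E" by (intro pideal_diff pideal_add \<Theta>w pideal_mult[OF \<Theta>R] pideal_mult[OF \<Theta>chart])
  finally have "q * F \<in> ?E" .
  \<comment> \<open>Removing \<open>x_i - 1\<close> costs a power of \<open>x_i\<close>, which is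
    harmless since \<open>v $ i = 1\<close>.\<close>
  from dehomogenize_pideal[OF graded_jacobian_ideal[OF f] forms_pvar _ forms_mult[OF qk F(1)] this]
  obtain N where N: "pvar i ^ N * (q * F) \<in> J" by auto
  show ?thesis
  proof (rule that[of "pvar i ^ N * q" "N * 1 + k"])
    show "pvar i ^ N * q \<in> forms (N * 1 + k)" by (rule forms_mult[OF forms_power[OF forms_pvar] qk])
    show "peval (pvar i ^ N * q) v \<noteq> 0" using qv vi by simp
    show "pvar i ^ N * q * F \<in> J" using N by (simp add: mult.assoc)
  qed
qed

text \<open>The prescribed factor \<open>s\<close> will vanish in the Tjurina algebras of the other
  points. It is a unit here, so \<open>a\<close> is divided by it, truncated at order
  \<open>M\<close> and homogenized.\<close>

lemma chart_surjective:
  assumes q: "local_data M q" and s: "s \<in> forms k" "peval s v \<noteq> 0" and a: "a \<in> conv_series V"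
    and K: "k + M \<le> K"
  obtains F where "F \<in> forms (K - k)" "a - lkp (chart i v (s * F)) \<in> T"
proof -
  have "lkp (chart i v s) 0 \<noteq> 0" using s(2) by (simp add: lookup_0_eq_peval peval_chart[OF vi])
  then obtain c where c: "c \<in> conv_series V" "series_mult c (lkp (chart i v s)) = lkp 1"
    using conv_series_inverse[OF chart_in_vars] by blast
  define b where "b = series_mult c a"
  have bconv: "b \<in> conv_series V" unfolding b_def by (rule conv_series_mult[OF c(1) a])
  define t where "t = trunc M b"
  have it: "in_vars V (lkp t)" unfolding t_def using bconv by (intro in_vars_trunc) (simp add: conv_series_iff)
  have ki: "lkp m i = 0" "mdeg m \<le> K - k" if "m \<in> Poly_Mapping.keys t" for m
  proof -
    show "lkp m i = 0" using it that by (auto simp: in_vars_def in_keys_iff)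
    show "mdeg m \<le> K - k" using that K by (auto simp: t_def in_keys_iff lookup_trunc split: if_splits)
  qed
  \<comment> \<open>Homogenization of \<open>t\<close>: local coordinates become chart forms, and
    powers of \<open>x_i\<close> fill the degree up to \<open>K - k\<close>.\<close>
  define F where "F = (\<Sum>m\<in>Poly_Mapping.keys t.
      pconst (lkp t m) * ((\<Prod>j\<in>UNIV. chart_form i v j ^ lkp m j) * pvar i ^ (K - k - mdeg m)))"
  have FK: "F \<in> forms (K - k)"
    unfolding F_def
  proof (rule hom_comp_sum)
    fix m assume m: "m \<in> Poly_Mapping.keys t"
    have "(\<Prod>j\<in>UNIV. chart_form i v j ^ lkp m j) * pvar i ^ (K - k - mdeg m) \<in> forms (mdeg m + (K - k - mdeg m) * 1)"
      by (rule forms_mult[OF prod_chart_forms forms_power[OF forms_pvar]])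
    moreover have "mdeg m + (K - k - mdeg m) * 1 = K - k" using ki(2)[OF m] by simp
    ultimately have "(\<Prod>j\<in>UNIV. chart_form i v j ^ lkp m j) * pvar i ^ (K - k - mdeg m) \<in> forms (K - k)"
      by (simp only:)
    from hom_comp_mult[OF hom_comp_pconst this]
    show "pconst (lkp t m) * ((\<Prod>j\<in>UNIV. chart_form i v j ^ lkp m j) * pvar i ^ (K - k - mdeg m)) \<in> forms (K - k)"
      by simp
  qed
  have "chart i v F = (\<Sum>m\<in>Poly_Mapping.keys t. pconst (lkp t m) * Poly_Mapping.single m 1)"
  proof -
    have "chart i v (pconst (lkp t m) * ((\<Prod>j\<in>UNIV. chart_form i v j ^ lkp m j) * pvar i ^ (K - k - mdeg m))) =
      pconst (lkp t m) * Poly_Mapping.single m 1" if "m \<in> Poly_Mapping.keys t" for m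
      using chart_prod_chart_forms[OF vi ki(1)[OF that]] by (simp del: psubst_simps(12))
    then show ?thesis unfolding F_def psubst_simps(11) by (rule sum.cong[OF refl])
  qed
  also have "\<dots> = t" by (subst (2) sum_monomials) (simp add: pconst_def mult_single)
  finally have cF: "chart i v F = t" .
  have sb: "series_mult (lkp (chart i v s)) b = a"
    unfolding b_def series_mult_assoc[symmetric] series_mult_commute[of _ c] by (simp add: c(2))
  have "a - lkp (chart i v (s * F)) = series_mult (lkp (chart i v s)) (b - lkp t)"
    unfolding series_mult_diff_right sb by (simp only: psubst_simps(6) cF lookup_mult_series)
  also have "\<dots> \<in> T"
  proof (rule tjurina_ideal_mult[OF chart_conv high_order_in_tjurina_ideal[OF q]])
    show "b - lkp t \<in> conv_series V"
      by (intro sv.subspace_diff[OF subspace_conv_series] bconv conv_series_poly it)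
    show "order_ge M (b - lkp t)" by (simp add: order_ge_def t_def lookup_trunc)
  qed
  finally show ?thesis using FK that by blast
qed

lemma linear_chart: "Vector_Spaces.linear pscale series_scale (\<lambda>F. lkp (chart i v F))"
proof -
  have "lkp (pscale c h) = series_scale c (lkp h)" for c and h :: "'n cpoly"
    by (rule ext) (simp add: pscale_def lookup_pconst_mult series_scale_def)
  then have "module_hom pscale series_scale (\<lambda>F. lkp (chart i v F))"
    unfolding module_hom_iff
    by (intro conjI allI pv.module_axioms sv.module_axioms) (simp_all only: psubst_simps lookup_plus)
  then show ?thesis unfolding Vector_Spaces.linear_def using pv.vector_space_axioms sv.vector_space_axioms by blast
qed

end

text \<open>Chinese remainder theorem: in high degree, forms map onto the product of the Tjurina
  algebras, and a form in the kernel lies in the saturation, which is assumed to agree with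
  \<open>J\<close> in degree \<open>K\<close>.\<close>

theorem tjurina_sum:
  fixes f :: "'n::finite cpoly" and S :: "'p set" and pt :: "'p \<Rightarrow> complex ^ 'n" and ix :: "'p \<Rightarrow> 'n"
  assumes f: "f \<in> forms d" "d \<ge> 1" and S: "finite S"
    and pt: "\<And>P. P \<in> S \<Longrightarrow> pt P $ ix P = 1" "\<And>P j. P \<in> S \<Longrightarrow> peval (pdiff j f) (pt P) = 0"
      "\<And>P Q c. P \<in> S \<Longrightarrow> Q \<in> S \<Longrightarrow> P \<noteq> Q \<Longrightarrow> pt P \<noteq> c *s pt Q"
      "\<And>x. x \<noteq> 0 \<Longrightarrow> (\<And>j. peval (pdiff j f) x = 0) \<Longrightarrow> \<exists>P\<in>S. \<exists>c. x = c *s pt P"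
  obtains K1 where "\<And>K. K \<ge> K1 \<Longrightarrow> saturation (jacobian_ideal f) \<inter> forms K \<subseteq> jacobian_ideal f \<Longrightarrow>
    has_qdim pscale (forms K) (jacobian_ideal f \<inter> forms K)
      (\<Sum>P\<in>S. tjurina_number (- {ix P}) (local_eq f (pt P) (ix P)))"
proof -
  let ?J = "jacobian_ideal f"
  let ?T = "\<lambda>P. tjurina_ideal (- {ix P}) (local_eq f (pt P) (ix P))"
  let ?\<Phi> = "\<lambda>P F. lkp (chart (ix P) (pt P) F)"
  let ?C = "\<lambda>P. conv_series (- {ix P})"
  have sJ: "pid.subspace ?J" by (simp add: jacobian_ideal_eq)
  have ac: "affine_chart f d (pt P) (ix P)" if "P \<in> S" for P
    by unfold_locales (use f pt that in auto)
  have pt0: "pt P \<noteq> 0" if "P \<in> S" for P using pt(1)[OF that] by auto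
  have ptinj: "pt P \<noteq> pt Q" if "P \<in> S" "Q \<in> S" "P \<noteq> Q" for P Q
    using pt(3)[OF that, of 1] by simp
  have "\<forall>P\<in>S. \<exists>M q. affine_chart.local_data f (pt P) (ix P) M q"
  proof
    fix P assume P: "P \<in> S"
    have cov: "\<exists>w\<in>pt ` S. \<exists>c. x = c *s w" if "x \<noteq> 0" "\<And>j. peval (pdiff j f) x = 0" for x
      using pt(4)[OF that] by blast
    have np: "x \<noteq> c *s y" if "x \<in> pt ` S" "y \<in> pt ` S" "x \<noteq> y" for x y c
      using that pt(3) by auto
    obtain M q where "affine_chart.local_data f (pt P) (ix P) M q"
      by (rule affine_chart.local_data_exists[OF ac[OF P], of "pt ` S"]) (use S P pt0 np cov in auto)
    then show "\<exists>M q. affine_chart.local_data f (pt P) (ix P) M q" by blast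
  qed
  then obtain M q where Mq: "\<And>P. P \<in> S \<Longrightarrow> affine_chart.local_data f (pt P) (ix P) (M P) (q P)"
    by metis
  \<comment> \<open>Linear forms vanishing at the other points \<open>Q\<close> but not at
    \<open>P\<close>, raised to the powers \<open>M Q\<close>, have order high enough to vanish in
    the Tjurina algebra at \<open>Q\<close>.\<close>
  have sep: "\<exists>s k. s \<in> forms k \<and> peval s (pt P) \<noteq> 0 \<and> (\<forall>Q\<in>S - {P}. ?\<Phi> Q s \<in> ?T Q)" if P: "P \<in> S" for P
  proof -
    have "\<forall>Q\<in>S - {P}. \<exists>l\<in>forms 1. peval l (pt Q) = 0 \<and> peval l (pt P) \<noteq> 0"
      using linear_form_separating pt0 pt(3) P by (metis DiffD1 DiffD2 singletonI)
    then obtain l where l: "\<And>Q. Q \<in> S - {P} \<Longrightarrow> l Q \<in> forms 1" "\<And>Q. Q \<in> S - {P} \<Longrightarrow> peval (l Q) (pt Q) = 0"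
      "\<And>Q. Q \<in> S - {P} \<Longrightarrow> peval (l Q) (pt P) \<noteq> 0" by metis
    let ?s = "\<Prod>Q\<in>S - {P}. l Q ^ M Q"
    have "?s \<in> forms (\<Sum>Q\<in>S - {P}. M Q * 1)"
      using S l(1) forms_power by (intro forms_prod) blast+
    moreover have "peval ?s (pt P) \<noteq> 0" using S l(3) by simp
    moreover have "?\<Phi> Q ?s \<in> ?T Q" if Q: "Q \<in> S - {P}" for Q
    proof -
      interpret affine_chart f d "pt Q" "ix Q" using ac Q by blast
      have "lkp (chart (ix Q) (pt Q) (l Q)) 0 = 0" using l(2)[OF Q] by (simp add: lookup_0_eq_peval peval_chart[OF vi])
      then have "order_ge 1 (?\<Phi> Q (l Q))" by (auto simp: order_ge_def mdeg_eq_0_iff)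
      then have "order_ge (M Q) (?\<Phi> Q (l Q ^ M Q))" unfolding psubst_simps(7) by (rule order_ge_power)
      then have lT: "?\<Phi> Q (l Q ^ M Q) \<in> ?T Q"
        by (intro high_order_in_tjurina_ideal[OF Mq] chart_conv) (use Q in auto)
      have "?s = (\<Prod>R\<in>S - {P} - {Q}. l R ^ M R) * l Q ^ M Q"
        using prod.remove[of "S - {P}" Q "\<lambda>Q. l Q ^ M Q"] S Q by (simp add: mult.commute)
      then have "?\<Phi> Q ?s = series_mult (?\<Phi> Q (\<Prod>R\<in>S - {P} - {Q}. l R ^ M R)) (?\<Phi> Q (l Q ^ M Q))"
        by (simp only: psubst_simps(6) lookup_mult_series)
      also have "\<dots> \<in> ?T Q" by (rule tjurina_ideal_mult[OF chart_conv lT])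
      finally show ?thesis .
    qed
    ultimately show ?thesis by blast
  qed
  then have "\<forall>P. \<exists>s k. P \<in> S \<longrightarrow> s \<in> forms k \<and> peval s (pt P) \<noteq> 0 \<and> (\<forall>Q\<in>S - {P}. ?\<Phi> Q s \<in> ?T Q)"
    by blast
  then obtain s k where sk: "\<forall>P. P \<in> S \<longrightarrow> s P \<in> forms (k P) \<and> peval (s P) (pt P) \<noteq> 0 \<and>
      (\<forall>Q\<in>S - {P}. ?\<Phi> Q (s P) \<in> ?T Q)"
    unfolding choice_iff by blast
  have s: "\<And>P. P \<in> S \<Longrightarrow> s P \<in> forms (k P)" "\<And>P. P \<in> S \<Longrightarrow> peval (s P) (pt P) \<noteq> 0"
    "\<And>P Q. P \<in> S \<Longrightarrow> Q \<in> S \<Longrightarrow> Q \<noteq> P \<Longrightarrow> ?\<Phi> Q (s P) \<in> ?T Q" using sk by simp_all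
  define K1 where "K1 = Max (insert 0 ((\<lambda>P. k P + M P) ` S))"
  have K1: "k P + M P \<le> K1" if "P \<in> S" for P unfolding K1_def using S that by (intro Max_ge) auto
  have surj: "\<exists>F\<in>forms K. a - ?\<Phi> P F \<in> ?T P \<and> (\<forall>Q\<in>S - {P}. ?\<Phi> Q F \<in> ?T Q)"
    if P: "P \<in> S" and a: "a \<in> ?C P" and K: "K1 \<le> K" for P a K
  proof -
    interpret affine_chart f d "pt P" "ix P" by (rule ac[OF P])
    have kK: "k P + M P \<le> K" using K1[OF P] K by simp
    obtain F where F: "F \<in> forms (K - k P)" "a - ?\<Phi> P (s P * F) \<in> ?T P"
      using chart_surjective[OF Mq[OF P] s(1)[OF P] s(2)[OF P] a kK] by blast
    have "s P * F \<in> forms K" using forms_mult[OF s(1)[OF P] F(1)] kK by simp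
    moreover have "?\<Phi> Q (s P * F) \<in> ?T Q" if Q: "Q \<in> S - {P}" for Q
    proof -
      have "?\<Phi> Q (s P * F) = series_mult (?\<Phi> Q F) (?\<Phi> Q (s P))"
        by (simp only: psubst_simps(6) lookup_mult_series series_mult_commute)
      also have "\<dots> \<in> ?T Q"
        by (rule tjurina_ideal_mult[OF affine_chart.chart_conv[OF ac] s(3)[OF P]]) (use Q in auto)
      finally show ?thesis .
    qed
    ultimately show ?thesis using F(2) by blast
  qed
  show ?thesis
  proof (rule that[of K1])
    fix K assume K: "K1 \<le> K" and sat: "saturation ?J \<inter> forms K \<subseteq> ?J"
    \<comment> \<open>Imposing the local conditions one point at a time filters the forms by
      subspaces whose successive quotients are the Tjurina algebras.\<close>
    define U where "U A = {F \<in> forms K. \<forall>P\<in>A. ?\<Phi> P F \<in> ?T P}" for A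
    have sU: "pv.subspace (U A)" if A: "A \<subseteq> S" for A
    proof (rule pv.subspaceI)
      show "0 \<in> U A" by (simp add: U_def lookup_0_in_tjurina_ideal)
      show "x + y \<in> U A" if "x \<in> U A" "y \<in> U A" for x y
        using that by (auto simp: U_def intro!: hom_comp_add)
          (simp add: lookup_plus tjurina_ideal_add)
      show "pscale c x \<in> U A" if "x \<in> U A" for c x
        using that by (auto simp: U_def intro!: hom_comp_pscale)
          (simp add: pscale_def lookup_mult_series tjurina_ideal_mult conv_series_poly)
    qed
    have step: "has_qdim pscale (U A) (U (insert P A)) n \<longleftrightarrow> has_qdim series_scale (?C P) (?T P) n"
      if P: "P \<in> S" "P \<notin> A" "A \<subseteq> S" for P A n
    proof -
      interpret affine_chart f d "pt P" "ix P" by (rule ac[OF P(1)])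
      show ?thesis
      proof (rule has_qdim_transfer[OF linear_chart subspace_tjurina_ideal])
        show "?\<Phi> P F \<in> ?C P" for F by (rule chart_conv)
        show "?\<Phi> P F \<in> ?T P \<longleftrightarrow> F \<in> U (insert P A)" if "F \<in> U A" for F using that by (auto simp: U_def)
        fix a assume "a \<in> ?C P"
        then obtain F where "F \<in> forms K" "a - ?\<Phi> P F \<in> ?T P" "\<forall>Q\<in>S - {P}. ?\<Phi> Q F \<in> ?T Q"
          using surj[OF P(1) _ K] by blast
        with P show "\<exists>F\<in>U A. a - ?\<Phi> P F \<in> ?T P" by (auto simp: U_def)
      qed (rule sU[OF P(3)])
    qed
    \<comment> \<open>Finite dimension of the Tjurina algebra comes from its being a quotient of
      \<open>forms K\<close>.\<close>
    have tj: "has_qdim series_scale (?C P) (?T P) (tjurina_number (- {ix P}) (local_eq f (pt P) (ix P)))"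
      if P: "P \<in> S" for P
    proof -
      have "U {} = forms K" by (simp add: U_def)
      moreover have "\<exists>n. has_qdim pscale (forms K) (U {P}) n"
        by (rule has_qdim_forms[OF sU]) (use P in \<open>auto simp: U_def\<close>)
      ultimately obtain n where "has_qdim pscale (U {}) (U {P}) n" by auto
      then have n: "has_qdim series_scale (?C P) (?T P) n" using step[OF P, of "{}"] by simp
      then show ?thesis unfolding tjurina_number_def using sv.quot_dim_eq[OF n subspace_tjurina_ideal] by simp
    qed
    have filt: "has_qdim pscale (forms K) (U A) (\<Sum>P\<in>A. tjurina_number (- {ix P}) (local_eq f (pt P) (ix P)))"
      if "finite A" "A \<subseteq> S" for A
      using that
    proof (induction A)
      case empty
      show ?case by (simp add: U_def pv.has_qdim_0)
    next
      case (insert P A)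
      then have 1: "has_qdim pscale (U A) (U (insert P A)) (tjurina_number (- {ix P}) (local_eq f (pt P) (ix P)))"
        using step[of P A] tj[of P] by simp
      have "has_qdim pscale (forms K) (U (insert P A))
        ((\<Sum>P\<in>A. tjurina_number (- {ix P}) (local_eq f (pt P) (ix P))) + tjurina_number (- {ix P}) (local_eq f (pt P) (ix P)))"
        by (rule pv.has_qdim_add[OF _ 1 _ _ sU]) (use insert in \<open>auto simp: U_def\<close>)
      then show ?case using insert.hyps by (simp add: add.commute)
    qed
    have "U S = ?J \<inter> forms K"
    proof (intro set_eqI iffI)
      fix F assume "F \<in> ?J \<inter> forms K"
      then show "F \<in> U S" using affine_chart.chart_jacobian_ideal[OF ac] by (auto simp: U_def)
    next
      fix F assume F: "F \<in> U S"
      then have FK: "F \<in> forms K" by (simp add: U_def)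
      \<comment> \<open>The ideal quotient of \<open>J\<close> by \<open>F\<close> contains, for
        each singular point, a form that is nonzero there. It therefore has no zero besides the
        origin and contains all forms of high degree.\<close>
      let ?C = "{r. r * F \<in> ?J}"
      have sC: "pid.subspace ?C"
        by (rule pid.subspaceI)
          (auto simp: distrib_right mult.assoc pid.subspace_0[OF sJ] pid.subspace_add[OF sJ] pid.subspace_scale[OF sJ])
      have grC: "graded ?C"
        unfolding graded_def
      proof (intro conjI ballI allI sC)
        fix r t assume "r \<in> ?C"
        then have "hpart (t + K) (r * F) \<in> ?J" using graded_hpart[OF graded_jacobian_ideal[OF f(1)]] by blast
        then show "hpart t r \<in> ?C" by (simp add: hpart_mult_form[OF FK])
      qed
      have "\<exists>N. \<forall>t\<ge>N. forms t \<subseteq> ?C"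
      proof (rule cofinite_if_no_zeros[OF grC])
        fix x assume x: "\<And>p. p \<in> ?C \<Longrightarrow> peval p x = 0"
        show "x = 0"
        proof (rule ccontr)
          assume "x \<noteq> 0"
          have "peval (pdiff j f) x = 0" for j
            by (rule x) (simp add: jacobian_ideal_eq pideal_base pideal_mult_right)
          then obtain P c where P: "P \<in> S" "x = c *s pt P" using pt(4)[OF \<open>x \<noteq> 0\<close>] by blast
          then have "?\<Phi> P F \<in> ?T P" using F by (simp add: U_def)
          from affine_chart.tjurina_ideal_local[OF ac[OF P(1)] Mq[OF P(1)] FK this]
          obtain p t where p: "p \<in> forms t" "peval p (pt P) \<noteq> 0" "p * F \<in> ?J" by blast
          have "c \<noteq> 0" using P \<open>x \<noteq> 0\<close> by auto
          then have "peval p x \<noteq> 0" using peval_form_scale[OF p(1), of c "pt P"] p(2) P(2) by simp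
          with x p(3) show False by blast
        qed
      qed
      then obtain N where N: "\<And>t. t \<ge> N \<Longrightarrow> forms t \<subseteq> ?C" by blast
      have "g * F \<in> ?J" if g: "g \<in> ideal_power max_ideal N" for g
      proof -
        have "hpart t g \<in> ?C" for t
        proof (cases "t < N")
          case True
          then show ?thesis using hpart_ideal_power[OF g True] pid.subspace_0[OF sC] by simp
        next
          case False
          then show ?thesis using subsetD[OF N hpart_in] by (simp add: not_less)
        qed
        then have "(\<Sum>t\<le>pdeg g. hpart t g) \<in> ?C" by (rule pid.subspace_sum[OF sC])
        then show ?thesis by (simp add: sum_hpart)
      qed
      then have "F \<in> saturation ?J" by (auto simp: saturation_def)
      with sat FK show "F \<in> ?J \<inter> forms K" by blast
    qed
    with filt[OF S subset_refl] show "has_qdim pscale (forms K) (?J \<inter> forms K)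
      (\<Sum>P\<in>S. tjurina_number (- {ix P}) (local_eq f (pt P) (ix P)))" by simp
  qed
qed

section \<open>The singular locus\<close>

lemma proj_pt_eqD:
  assumes "v \<noteq> 0" "w \<noteq> 0" "proj_pt v = proj_pt w"
  obtains c where "v = c *s w"
proof -
  have "cline v = cline w" using assms Abs_proj_inject[of "cline v" "cline w"] by (auto simp: proj_pt_def)
  moreover have "v \<in> cline v" unfolding cline_def by (metis (mono_tags) mem_Collect_eq vector_smult_lid)
  ultimately show ?thesis using that by (auto simp: cline_def)
qed

lemma proj_pt_scale:
  assumes "c \<noteq> 0"
  shows "proj_pt (c *s w) = proj_pt w"
proof -
  have 1: "a *s w = (a / c) *s (c *s w)" and 2: "a *s (c *s w) = (a * c) *s w" for a
    using assms by (simp_all add: vector_smult_assoc)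
  have "cline (c *s w) = cline w"
  proof
    show "cline (c *s w) \<subseteq> cline w" unfolding cline_def 2 by blast
    show "cline w \<subseteq> cline (c *s w)" unfolding cline_def using 1 by blast
  qed
  then show ?thesis by (simp add: proj_pt_def)
qed

lemma proj_chart_exists: "\<exists>v i. P = proj_pt v \<and> v $ i = 1"
proof -
  obtain w where w: "P = proj_pt w" "w \<noteq> 0" by (cases P) (auto simp: proj_pt_def)
  then obtain i where i: "w $ i \<noteq> 0" by (auto simp: vec_eq_iff)
  have "proj_pt (inverse (w $ i) *s w) = P" unfolding w(1) by (rule proj_pt_scale) (use i in simp)
  moreover have "(inverse (w $ i) *s w) $ i = 1" using i by simp
  ultimately show ?thesis by metis
qed

lemma continuous_peval: "continuous_on UNIV (peval f)"
  unfolding peval_def by (intro continuous_intros)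

text \<open>Isolatedness gives each singular point a neighbourhood containing no other one; the
  singular vectors of norm 1 form a compact set, so finitely many of these neighbourhoods
  suffice.\<close>

lemma finite_sing_locus:
  assumes f: "f \<in> forms d" and iso: "isolated_singularities f"
  shows "finite (sing_locus f)"
proof -
  have hom: "peval f (c *s v) = 0" "peval (pdiff j f) (c *s v) = 0"
    if "peval f v = 0" "\<And>j. peval (pdiff j f) v = 0" for c v j
    using that peval_form_scale[OF f] peval_form_scale[OF pdiff_forms[OF f]] by auto
  define C where "C = {v. norm v = 1 \<and> peval f v = 0 \<and> (\<forall>j. peval (pdiff j f) v = 0)}"
  have "closed C"
    unfolding C_def
    by (intro closed_Collect_conj closed_Collect_all closed_Collect_eq continuous_peval continuous_intros)
  moreover have "bounded C" by (rule boundedI[of _ 1]) (auto simp: C_def)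
  ultimately have C: "compact C" by (simp add: compact_eq_bounded_closed)
  have "\<forall>P\<in>sing_locus f. \<exists>W. open W \<and> W \<inter> sing_locus f = {P}"
    using iso by (auto simp: isolated_singularities_def isolated_in_def)
  then obtain W where W: "\<And>P. P \<in> sing_locus f \<Longrightarrow> open (W P)"
    "\<And>P. P \<in> sing_locus f \<Longrightarrow> W P \<inter> sing_locus f = {P}" by metis
  let ?O = "\<lambda>P. {v. v \<noteq> 0 \<and> proj_pt v \<in> W P}"
  have op: "open (?O P)" if "P \<in> sing_locus f" for P using W(1)[OF that] by (simp add: open_proj_def)
  have CS: "v \<noteq> 0 \<and> proj_pt v \<in> sing_locus f" if "v \<in> C" for v
    using that by (auto simp: C_def sing_locus_def)
  have cov: "C \<subseteq> (\<Union>P\<in>sing_locus f. ?O P)"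
  proof
    fix v assume "v \<in> C"
    with CS have v: "v \<noteq> 0" "proj_pt v \<in> sing_locus f" by auto
    with W(2)[OF v(2)] have "v \<in> ?O (proj_pt v)" by blast
    with v(2) show "v \<in> (\<Union>P\<in>sing_locus f. ?O P)" by blast
  qed
  obtain S where S: "S \<subseteq> sing_locus f" "finite S" "C \<subseteq> (\<Union>P\<in>S. ?O P)"
    by (rule compactE_image[OF C op cov])
  have "sing_locus f \<subseteq> S"
  proof
    fix Q assume Q: "Q \<in> sing_locus f"
    then obtain v where v: "Q = proj_pt v" "v \<noteq> 0" "peval f v = 0" "\<And>j. peval (pdiff j f) v = 0"
      by (auto simp: sing_locus_def)
    \<comment> \<open>Normalization to the unit sphere does not change the projective point.\<close>
    let ?c = "complex_of_real (1 / norm v)"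
    let ?u = "?c *s v"
    have u: "?u = (1 / norm v) *\<^sub>R v" by (simp add: vec_eq_iff) (simp add: scaleR_conv_of_real)
    have "norm ?u = 1" unfolding u using v(2) by simp
    then have "?u \<in> C" using hom[OF v(3,4)] by (simp add: C_def)
    then obtain P where P: "P \<in> S" "proj_pt ?u \<in> W P" using S(3) by auto
    have "proj_pt ?u = Q" using v by (simp add: proj_pt_scale)
    then have "Q \<in> W P \<inter> sing_locus f" using P(2) Q by simp
    moreover have "W P \<inter> sing_locus f = {P}" using W(2) P(1) S(1) by blast
    ultimately show "Q \<in> S" using P(1) by simp
  qed
  with S(2) show ?thesis by (rule finite_subset[rotated])
qed

text \<open>The same choice as inside \<open>tjurina_at\<close>, so that both refer to one
  chart.\<close>

definition chart_at :: "'n::finite proj \<Rightarrow> (complex ^ 'n) \<times> 'n" where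
  "chart_at P = (SOME (v, i). P = proj_pt v \<and> v $ i = 1)"

lemma chart_at: "proj_pt (fst (chart_at P)) = P" "fst (chart_at P) $ snd (chart_at P) = 1"
proof -
  have "\<exists>x. case x of (v, i) \<Rightarrow> P = proj_pt v \<and> v $ i = 1" using proj_chart_exists[of P] by auto
  from someI_ex[OF this] have "case chart_at P of (v, i) \<Rightarrow> P = proj_pt v \<and> v $ i = 1"
    unfolding chart_at_def .
  then show "proj_pt (fst (chart_at P)) = P" "fst (chart_at P) $ snd (chart_at P) = 1"
    by (auto simp: split_def)
qed

lemma tjurina_at_chart:
  "tjurina_at f P = tjurina_number (- {snd (chart_at P)}) (local_eq f (fst (chart_at P)) (snd (chart_at P)))"
  by (simp add: tjurina_at_def chart_at_def Let_def split_def)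

section \<open>Normal form of the Jacobian ideal\<close>

text \<open>Collects the algebraic and local results for one hypersurface. It also covers the smooth
  one, with an empty set of points; \<open>d \<ge> 2\<close> makes the degree of the partial
  derivatives positive.\<close>

lemma jacobian_normal_form:
  fixes f :: "'n::finite cpoly" and i0 :: 'n
  assumes f: "f \<in> forms d" "d \<ge> 2" and fin: "finite (sing_locus f)"
  obtains q l h where "one_dim_ci q ((CARD('n) - 1) * (d - 2)) i0 l (q ` (- {i0}))"
    "\<And>j. j \<noteq> i0 \<Longrightarrow> q j \<in> forms (d - 1)" "h \<in> forms (d - 1)"
    "jacobian_ideal f = pideal (insert h (q ` (- {i0})))"
    "\<exists>K1. \<forall>K\<ge>K1. saturation (jacobian_ideal f) \<inter> forms K \<subseteq> jacobian_ideal f \<longrightarrow>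
      hilb (jacobian_ideal f) (int K) = total_tjurina f"
proof -
  let ?pt = "\<lambda>P :: 'n proj. fst (chart_at P)" and ?ix = "\<lambda>P :: 'n proj. snd (chart_at P)"
  let ?S = "sing_locus f"
  have d1: "d \<ge> 1" "d - 1 \<ge> 1" using f(2) by auto
  have pt0: "?pt P \<noteq> 0" for P using chart_at(2)[of P] by auto
  have ptz: "peval (pdiff j f) (?pt P) = 0" if P: "P \<in> ?S" for P j
  proof -
    obtain v where v: "P = proj_pt v" "v \<noteq> 0" "peval (pdiff j f) v = 0" using P by (auto simp: sing_locus_def)
    obtain c where "?pt P = c *s v" using proj_pt_eqD[OF pt0 v(2), of P] chart_at(1)[of P] v(1) by metis
    then show ?thesis using peval_form_scale[OF pdiff_forms[OF f(1)], of j c v] v(3) by simp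
  qed
  have ptn: "?pt P \<noteq> c *s ?pt Q" if "P \<noteq> Q" for P Q c
  proof
    assume e: "?pt P = c *s ?pt Q"
    then have "c \<noteq> 0" using pt0[of P] by auto
    then have "proj_pt (?pt P) = proj_pt (?pt Q)" unfolding e by (rule proj_pt_scale)
    with that show False by (simp add: chart_at)
  qed
  have cov: "\<exists>P\<in>?S. \<exists>c. x = c *s ?pt P" if x: "x \<noteq> 0" "\<And>j. peval (pdiff j f) x = 0" for x
  proof -
    \<comment> \<open>By the Euler formula, zeros of all partial derivatives lie on the
      hypersurface.\<close>
    have "peval f x = 0" using peval_jacobian_ideal[OF euler_in_jacobian_ideal[OF f(1) d1(1)]] x(2) by blast
    with x have "proj_pt x \<in> ?S" by (auto simp: sing_locus_def)
    moreover obtain c where "x = c *s ?pt (proj_pt x)"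
      using proj_pt_eqD[OF x(1) pt0] chart_at(1)[of "proj_pt x"] by metis
    ultimately show ?thesis by blast
  qed
  obtain l F where lF: "l \<in> forms 1" "\<And>j. F j \<in> forms (d - 1)"
    "pideal (range F) = pideal (range (\<lambda>j. pdiff j f))"
    "complete_intersection (F(i0 := l)) ((CARD('n) - 1) * (d - 1 - 1))"
  proof (rule general_position[of "\<lambda>j. pdiff j f" "d - 1" "?pt ` ?S" i0])
    show "pdiff j f \<in> forms (d - 1)" for j by (rule pdiff_forms[OF f(1)])
    show "finite (?pt ` ?S)" using fin by simp
    show "0 \<notin> ?pt ` ?S" using pt0 by force
    show "\<exists>w\<in>?pt ` ?S. \<exists>c. v = c *s w" if "v \<noteq> 0" "\<And>j. peval (pdiff j f) v = 0" for v
      using cov[OF that] by blast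
  qed (use d1 in auto)
  let ?q = "F(i0 := l)"
  have im: "?q ` (- {i0}) = F ` (- {i0})" by (rule image_cong) auto
  have dd: "d - 1 - 1 = d - 2" by simp
  obtain K1 where K1: "\<And>K. K \<ge> K1 \<Longrightarrow> saturation (jacobian_ideal f) \<inter> forms K \<subseteq> jacobian_ideal f \<Longrightarrow>
    has_qdim pscale (forms K) (jacobian_ideal f \<inter> forms K)
      (\<Sum>P\<in>?S. tjurina_number (- {?ix P}) (local_eq f (?pt P) (?ix P)))"
    by (rule tjurina_sum[OF f(1) d1(1) fin, of ?pt ?ix]) (use chart_at(2) ptz ptn cov in auto)
  show ?thesis
  proof (rule that[of ?q l "F i0"])
    show "one_dim_ci ?q ((CARD('n) - 1) * (d - 2)) i0 l (?q ` (- {i0}))"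
      by unfold_locales (use lF(1,4) in \<open>auto simp only: dd fun_upd_same\<close>)
    show "?q j \<in> forms (d - 1)" if "j \<noteq> i0" for j using lF(2) that by simp
    show "F i0 \<in> forms (d - 1)" by (rule lF(2))
    show "jacobian_ideal f = pideal (insert (F i0) (?q ` (- {i0})))"
      unfolding im range_family[symmetric] jacobian_ideal_eq lF(3) ..
    show "\<exists>K1. \<forall>K\<ge>K1. saturation (jacobian_ideal f) \<inter> forms K \<subseteq> jacobian_ideal f \<longrightarrow>
        hilb (jacobian_ideal f) (int K) = total_tjurina f"
      using hilb_eqI[OF K1] by (auto simp: total_tjurina_def tjurina_at_chart jacobian_ideal_eq intro!: exI[of _ K1])
  qed
qed

text \<open>Without singular points the Jacobian ideal has no zero besides the origin, so
  \<open>h\<close> may take the place of \<open>l\<close> by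
  \<open>nonzerodivisor_exchange\<close>.\<close>

lemma smooth_complete_intersection:
  assumes ci: "one_dim_ci q s i0 l G" and f: "f \<in> forms d" "d \<ge> 2" and sm: "sing_locus f = {}"
    and h: "h \<in> forms (d - 1)" "jacobian_ideal f = pideal (insert h G)"
  shows "nonzerodivisor h (pideal G)"
proof -
  interpret one_dim_ci q s i0 l G by (rule ci)
  have "cofinite_ideal (pideal (insert h G))"
    unfolding cofinite_ideal_def h(2)[symmetric]
  proof (rule cofinite_if_no_zeros[OF graded_jacobian_ideal[OF f(1)]])
    fix v assume v: "\<And>p. p \<in> jacobian_ideal f \<Longrightarrow> peval p v = 0"
    have "peval f v = 0" by (rule v) (use euler_in_jacobian_ideal[OF f(1)] f(2) in simp)
    moreover have "peval (pdiff j f) v = 0" for j by (rule v) (simp add: jacobian_ideal_eq pideal_base)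
    ultimately show "v = 0" using sm by (auto simp: sing_locus_def)
  qed
  moreover have "cofinite_ideal (pideal (insert l G))"
    using ci unfolding one_dim_ci_def complete_intersection_def by (simp add: range_q)
  ultimately show ?thesis
    using nonzerodivisor_exchange[OF gr l _ nz _ h(1)] f(2) by simp
qed

text \<open>Degree 1 must be separated, since the derivatives have degree 0. By the Euler formula at
  least one of them is a nonzero constant.\<close>

lemma linear_jacobian_ideal:
  assumes "hypersurface 1 f"
  shows "jacobian_ideal f = UNIV" "sing_locus f = {}"
proof -
  have f: "f \<in> forms 1" "f \<noteq> 0" using assms by (auto simp: hypersurface_def)
  have pd: "pdiff j f \<in> forms 0" for j using pdiff_forms[OF f(1), of j] by simp
  have "\<exists>j. pdiff j f \<noteq> 0"
  proof (rule ccontr)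
    assume "\<not> ?thesis"
    then have "(\<Sum>j\<in>UNIV. pvar j * pdiff j f) = 0" by simp
    with euler_formula[OF f(1)] f(2) show False by simp
  qed
  then obtain j c where c: "pdiff j f = pconst c" "c \<noteq> 0" using forms_0_const[OF pd] by (metis pconst_0)
  have "pconst (inverse c) * pdiff j f \<in> jacobian_ideal f"
    unfolding jacobian_ideal_eq by (intro pideal_mult pideal_base) auto
  then show "jacobian_ideal f = UNIV"
    using c pideal_one unfolding jacobian_ideal_eq by (simp add: pconst_mult[symmetric])
  have "peval (pdiff j f) v \<noteq> 0" for v using c by simp
  then show "sing_locus f = {}" by (auto simp: sing_locus_def)
qed

lemma quot_dim_eq_0: "V \<subseteq> W \<Longrightarrow> pv.subspace W \<Longrightarrow> quot_dim pscale V W = 0"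
  using pv.quot_dim_eq[OF pv.has_qdim_0] .

theorem proposition4p4:
  fixes f f_smooth :: "'n::finite cpoly" and n d :: nat and T :: int
  assumes "CARD('n) = n + 1"
    and "hypersurface d f" and "isolated_singularities f"
    and "hypersurface d f_smooth" and "smooth_hypersurface f_smooth"
    and "T = (int n + 1) * (int d - 2)"
  shows "int (quot_dim pscale (saturation (jacobian_ideal f) \<inter> hom_comp (int d))
                              (jacobian_ideal f \<inter> hom_comp (int d)))
         = int (milnor_dim f (int d)) - int (milnor_dim f_smooth (int d))
           + int (milnor_dim f (T - int d)) - int (total_tjurina f)"
proof -
  let ?J = "jacobian_ideal f" and ?J' = "jacobian_ideal f_smooth"
  have f: "f \<in> forms d" "d \<ge> 1" and f': "f_smooth \<in> forms d" using assms by (auto simp: hypersurface_def)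
  have md: "milnor_dim g k = hilb (jacobian_ideal g) k" for g :: "'n cpoly" and k
    by (simp add: milnor_dim_def hilb_def)
  show ?thesis
  proof (cases "d = 1")
    case True
    \<comment> \<open>Both Jacobian ideals are the whole ring, so every term of the formula is
      0.\<close>
    have "hilb (UNIV :: 'n cpoly set) k = 0" for k :: int
      unfolding hilb_def by (rule quot_dim_eq_0) auto
    moreover have "quot_dim pscale (saturation (UNIV :: 'n cpoly set) \<inter> forms 1) (UNIV \<inter> forms 1) = 0"
      by (rule quot_dim_eq_0) auto
    ultimately show ?thesis
      using linear_jacobian_ideal[of f] linear_jacobian_ideal[of f_smooth] assms(2,4) True
      by (simp add: md total_tjurina_def)
  next
    case False
    then have d2: "d \<ge> 2" using f(2) by simp
    let ?s = "(CARD('n) - 1) * (d - 2)"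
    fix i0 :: 'n
    obtain q l h where ci: "one_dim_ci q ?s i0 l (q ` (- {i0}))"
      and q: "\<And>j. j \<noteq> i0 \<Longrightarrow> q j \<in> forms (d - 1)" and h: "h \<in> forms (d - 1)"
      "?J = pideal (insert h (q ` (- {i0})))"
      and tj: "\<exists>K1. \<forall>K\<ge>K1. saturation ?J \<inter> forms K \<subseteq> ?J \<longrightarrow> hilb ?J (int K) = total_tjurina f"
      using jacobian_normal_form[OF f(1) d2 finite_sing_locus[OF f(1) assms(3)], of i0] by metis
    have sm: "sing_locus f_smooth = {}" using assms(5) by (simp add: smooth_hypersurface_def)
    obtain q' l' h' where ci': "one_dim_ci q' ?s i0 l' (q' ` (- {i0}))"
      and q': "\<And>j. j \<noteq> i0 \<Longrightarrow> q' j \<in> forms (d - 1)" and h': "h' \<in> forms (d - 1)"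
      "?J' = pideal (insert h' (q' ` (- {i0})))"
      using jacobian_normal_form[OF f' d2, of i0] sm by (metis finite.emptyI)
    interpret A: one_dim_ci q ?s i0 l "q ` (- {i0})" by (rule ci)
    interpret A': one_dim_ci q' ?s i0 l' "q' ` (- {i0})" by (rule ci')
    let ?I = "pideal (q ` (- {i0}))"
    \<comment> \<open>The link between the two hypersurfaces: their complete intersections have
      members of equal degrees.\<close>
    have same: "hilb (pideal (q' ` (- {i0}))) k = hilb ?I k" for k
      by (rule hilb_regular_unique[of _ _ "d - 1"])
        (use A.ci A'.ci q q' in \<open>auto simp: complete_intersection_def\<close>)
    \<comment> \<open>For the smooth hypersurface \<open>h'\<close> is a non-zero-divisor of degree
      \<open>d - 1\<close>, so degree \<open>d\<close> is compared with degree 1.\<close>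
    have "hilb ?J' (1 + int (d - 1)) + hilb ?I 1 = hilb ?I (1 + int (d - 1))"
      using hilb_insert_nonzerodivisor[OF A'.gr h'(1) smooth_complete_intersection[OF ci' f' d2 sm h'], of 1]
      by (simp only: same h'(2))
    moreover have "1 + int (d - 1) = int d" using d2 by simp
    ultimately have smooth: "hilb ?J' (int d) + hilb ?I 1 = hilb ?I (int d)" by simp
    obtain K0 where K0: "\<And>k K. K \<ge> K0 \<Longrightarrow> K \<ge> k \<Longrightarrow>
        saturation ?J \<inter> forms k = {y \<in> forms k. l ^ (K - k) * y \<in> ?J}"
    proof (rule A.saturation_forms[OF h(1), folded h(2)])
      fix K0
      assume "\<And>k K. K \<ge> K0 \<Longrightarrow> K \<ge> k \<Longrightarrow>
        saturation ?J \<inter> forms k = {y \<in> forms k. l ^ (K - k) * y \<in> ?J}"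
      then show thesis by (rule that)
    qed
    obtain K1 where K1: "\<And>K. K \<ge> K1 \<Longrightarrow> saturation ?J \<inter> forms K \<subseteq> ?J \<Longrightarrow> hilb ?J (int K) = total_tjurina f"
      using tj by blast
    \<comment> \<open>Beyond both thresholds, and large enough for the duality and the two
      symmetries below.\<close>
    define K where "K = max (max K0 K1) (?s + d + d + 1)"
    have K: "K \<ge> K0" "K \<ge> K1" "K \<ge> d" "?s + (d - 1) + d \<le> K" "?s + d \<le> K" "?s + 1 \<le> K"
      by (auto simp: K_def)
    \<comment> \<open>With \<open>k = K\<close> the power of \<open>l\<close> is trivial, so
      \<open>K0\<close> shows that saturation and \<open>?J\<close> agree in degree
      \<open>K\<close>, as \<open>K1\<close> requires.\<close>
    have tau: "hilb ?J (int K) = total_tjurina f"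
      by (rule K1[OF K(2)]) (use K0[of K K] K in auto)
    have sat: "saturation ?J \<inter> forms d = {y \<in> forms d. l ^ (K - d) * y \<in> ?J}"
      by (rule K0) (use K in auto)
    have sS: "pv.subspace (saturation ?J \<inter> forms d)" unfolding sat unfolding h(2) by (rule subspace_mult_preimage)
    obtain r where r: "has_qdim pscale (forms d) (saturation ?J \<inter> forms d) r"
      using has_qdim_forms[OF sS] by blast
    define j where "j = int ?s - 1 - int d"
    have sn: "int ?s = int n * (int d - 2)" using assms(1) d2 by simp
    \<comment> \<open>\<open>T - d = s - 2\<close> plays two roles: it is the degree reached from
      \<open>j\<close> by multiplication with \<open>h\<close>, and it is the dual of degree
      1.\<close>
    have Td: "T - int d = j + int (d - 1)" "T - int d = int ?s - 1 - int 1"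
      unfolding j_def sn assms(6) using d2 by (simp_all add: algebra_simps)
    have 1: "hilb ?J (T - int d) + hilb ?I j + r = hilb ?I (T - int d) + hilb ?J (int K)"
      unfolding Td(1) h(2)
      by (rule A.hilb_duality[OF h(1) j_def K(4)]) (rule r[unfolded sat, unfolded h(2)])
    have 2: "hilb ?I j + hilb ?I (int d) = hilb ?I (int K)"
      by (rule A.hilb_symmetric[OF j_def K(5)])
    have 3: "hilb ?I (T - int d) + hilb ?I (int 1) = hilb ?I (int K)"
      by (rule A.hilb_symmetric[OF Td(2) K(6)])
    have JS: "?J \<inter> forms d \<subseteq> saturation ?J \<inter> forms d"
      unfolding sat unfolding h(2) by (auto intro: pideal_mult)
    have sJd: "pv.subspace (?J \<inter> forms d)" unfolding h(2) by (auto intro: pv.subspace_inter)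
    obtain m where m: "has_qdim pscale (saturation ?J \<inter> forms d) (?J \<inter> forms d) m"
    proof -
      have "has_qdim pscale (forms d) (?J \<inter> forms d) (hilb ?J (int d))"
        by (rule has_qdim_hilb) (simp add: h(2))
      from pv.has_qdim_sub[OF this subspace_hom_comp sJd sS JS] that show ?thesis by auto
    qed
    have 4: "hilb ?J (int d) = r + m"
      by (rule hilb_eqI[OF pv.has_qdim_add[OF r m _ JS sS]]) (auto simp: h(2))
    have "quot_dim pscale (saturation ?J \<inter> forms d) (?J \<inter> forms d) = m"
      by (rule pv.quot_dim_eq[OF m sJd])
    with 1 2 3 4 smooth tau show ?thesis by (simp add: md)
  qed
qed

end
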